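(* For every integer $n\ge 3$ there exists a constant $\mathfrak e>0$, depending only on $n$, such that every closed strictly convex projective manifold $Y=\Omega/\Gamma$ of dimension $n$ whose underlying manifold admits a hyperbolic structure satisfies $$\mathrm{Vol}(Y,F_\Omega)\ \ge\ \mathfrak e,$$ where $\mathrm{Vol}(Y,F_\Omega)$ is the Hilbert volume of $Y$.
   Context: A subset $\Omega\subset\mathbb{RP}^n$ is proper if it is bounded in some affine patch; convex if its intersection with any projective line is connected; strictly convex if, moreover, its topological boundary in an affine patch contains no open line segment. A (strictly) convex projective manifold is a quotient $Y=\Omega/\Gamma$, where $\Omega\subset\mathbb{RP}^n$ is open and properly (strictly) convex and $\Gamma<\mathrm{PGL}(n+1,\mathbb R)$ is a discrete subgroup preserving $\Omega$ and containing no nontrivial element of finite order. Closed means compact without boundary. Hilbert Finsler structure: in an affine patch in which $\Omega$ is bounded, with Euclidean norm $\|\cdot\|$, for $y\in\Omega$ and $v\in T_y\Omega$, $v\neq 0$, $$F_\Omega(y,v)=\frac{\|v\|}{2}\left(\frac1{\|y-v^-\|}+\frac1{\|y-v^+\|}\right),$$ where $v^-,v^+$ are the two points of intersection with $\partial\Omega$ of the projective line through $y$ in the direction $v$ (and $F_\Omega(y,0)=0$). It is invariant under projective transformations preserving $\Omega$, so it descends to $Y$. Hilbert volume: for any Riemannian metric $g$ on $Y$, the Hilbert volume is the total mass of $$dF_\Omega(y)=\frac{\mathrm{Vol}_g(B_g(1,y))}{\mathrm{Vol}_g(B_{F_\Omega}(1,y))}\,dg,$$ where $B_g(1,y),B_{F_\Omega}(1,y)\subset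 T_yY$ are the unit balls of $g$ and $F_\Omega$ in the tangent space; this is independent of $g$. A hyperbolic structure is a Riemannian metric of constant sectional curvature $-1$ on the underlying manifold. *)

theory Defs
  imports "HOL-Analysis.Analysis" "HOL-Algebra.Coset"
begin

section \<open>Quotient topologies\<close>

definition quotient_topology :: "'a topology \<Rightarrow> ('a \<Rightarrow> 'b) \<Rightarrow> 'b topology"
  where "quotient_topology X f =
    topology (\<lambda>U. U \<subseteq> f ` topspace X \<and> openin X {x \<in> topspace X. f x \<in> U})"

lemma openin_quotient_topology:
  "openin (quotient_topology X f) U \<longleftrightarrow>
    U \<subseteq> f ` topspace X \<and> openin X {x \<in> topspace X. f x \<in> U}"
proof -
  have "istopology (\<lambda>U. U \<subseteq> f ` topspace X \<and> openin X {x \<in> topspace X. f x \<in> U})"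
    unfolding istopology_def
  proof (intro conjI allI impI; (elim conjE)?)
    fix S T
    assume "openin X {x \<in> topspace X. f x \<in> S}" "openin X {x \<in> topspace X. f x \<in> T}"
    then have "openin X ({x \<in> topspace X. f x \<in> S} \<inter> {x \<in> topspace X. f x \<in> T})"
      by (rule openin_Int)
    also have "{x \<in> topspace X. f x \<in> S} \<inter> {x \<in> topspace X. f x \<in> T}
        = {x \<in> topspace X. f x \<in> S \<inter> T}" by auto
    finally show "openin X {x \<in> topspace X. f x \<in> S \<inter> T}" .
  next
    fix K
    assume "\<forall>U\<in>K. U \<subseteq> f ` topspace X \<and> openin X {x \<in> topspace X. f x \<in> U}"
    then have "openin X (\<Union>U\<in>K. {x \<in> topspace X. f x \<in> U})" by blast
    also have "(\<Union>U\<in>K. {x \<in> topspace X. f x \<in> U}) = {x \<in> topspace X. f x \<in> \<Union>K}" by auto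
    finally show "openin X {x \<in> topspace X. f x \<in> \<Union>K}" .
  qed auto
  then show ?thesis
    by (simp add: quotient_topology_def)
qed


section \<open>Real projective space\<close>

text \<open>
  For \<open>n = CARD('n)\<close>, the type \<open>'n rp\<close> is the set of lines in \<open>\<real>\<^sup>n\<^sup>+\<^sup>1\<close>. Homogeneous coordinates are
  indexed by \<open>'n option\<close>, the index \<open>None\<close> being the additional one.
\<close>

typedef (overloaded) 'n rp = "{L :: (real^('n::finite option)) set. \<exists>x. x \<noteq> 0 \<and> L = span {x}}"
  morphisms line_of Abs_rp
proof -
  have "axis None 1 \<noteq> (0 :: real^('n option))" by (simp add: axis_eq_0_iff)
  then show ?thesis by blast
qed

definition rp_class :: "real^('n::finite option) \<Rightarrow> 'n rp"
  where "rp_class x = Abs_rp (span {x})"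

instantiation rp :: (finite) topological_space
begin

definition open_rp :: "'a rp set \<Rightarrow> bool"
  where "open_rp U \<longleftrightarrow> open {x. x \<noteq> 0 \<and> rp_class x \<in> U}"

instance
proof
  have "{x :: real^('a option). x \<noteq> 0} = - {0}" by auto
  then show "open (UNIV :: 'a rp set)" by (simp add: open_rp_def open_Compl)
next
  fix S T :: "'a rp set"
  assume "open S" "open T"
  then have "open ({x. x \<noteq> 0 \<and> rp_class x \<in> S} \<inter> {x. x \<noteq> 0 \<and> rp_class x \<in> T})"
    unfolding open_rp_def by (rule open_Int)
  also have "{x. x \<noteq> 0 \<and> rp_class x \<in> S} \<inter> {x. x \<noteq> 0 \<and> rp_class x \<in> T}
      = {x. x \<noteq> 0 \<and> rp_class x \<in> S \<inter> T}" by auto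
  finally show "open (S \<inter> T)" by (simp add: open_rp_def)
next
  fix K :: "'a rp set set"
  assume "\<forall>S\<in>K. open S"
  then have "open (\<Union>S\<in>K. {x. x \<noteq> 0 \<and> rp_class x \<in> S})"
    unfolding open_rp_def by blast
  also have "(\<Union>S\<in>K. {x. x \<noteq> 0 \<and> rp_class x \<in> S}) = {x. x \<noteq> 0 \<and> rp_class x \<in> \<Union>K}" by auto
  finally show "open (\<Union>K)" by (simp add: open_rp_def)
qed

end

definition projective_line :: "'n::finite rp set \<Rightarrow> bool"
  where "projective_line L \<longleftrightarrow> (\<exists>P. subspace P \<and> dim P = 2 \<and> L = {p. line_of p \<subseteq> P})"

text \<open>
  \<open>patch A\<close> is the affine coordinate system \<open>y \<mapsto> A[y : 1]\<close>. As \<open>A\<close> ranges over the invertible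
  matrices, its image ranges over all affine patches (complements of projective hyperplanes), and
  all affine coordinates on them occur.
\<close>

definition homog :: "real^'n \<Rightarrow> real^('n::finite option)"
  where "homog y = (\<chi> i. case i of None \<Rightarrow> 1 | Some j \<Rightarrow> y $ j)"

definition patch :: "real^('n option)^('n option) \<Rightarrow> real^'n \<Rightarrow> 'n::finite rp"
  where "patch A y = rp_class (A *v homog y)"

definition bounded_in_patch :: "real^('n option)^('n option) \<Rightarrow> 'n::finite rp set \<Rightarrow> bool"
  where "bounded_in_patch A \<Omega> \<longleftrightarrow>
    invertible A \<and> \<Omega> \<subseteq> range (patch A) \<and> bounded (patch A -` \<Omega>)"

definition proj_proper :: "'n::finite rp set \<Rightarrow> bool"
  where "proj_proper \<Omega> \<longleftrightarrow> (\<exists>A. bounded_in_patch A \<Omega>)"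

definition proj_convex :: "'n::finite rp set \<Rightarrow> bool"
  where "proj_convex \<Omega> \<longleftrightarrow> (\<forall>L. projective_line L \<longrightarrow> connected (\<Omega> \<inter> L))"

definition properly_strictly_convex :: "'n::finite rp set \<Rightarrow> bool"
  where "properly_strictly_convex \<Omega> \<longleftrightarrow> proj_proper \<Omega> \<and> proj_convex \<Omega> \<and>
    (\<exists>A. bounded_in_patch A \<Omega> \<and>
      \<not> (\<exists>a b. a \<noteq> b \<and> open_segment a b \<subseteq> frontier (patch A -` \<Omega>)))"


section \<open>The projective linear group\<close>

definition GL :: "(real^'m^'m::finite) monoid"
  where "GL = \<lparr>carrier = {A. invertible A}, monoid.mult = (**), one = mat 1\<rparr>"

definition GL_scalars :: "(real^'m^'m::finite) set"
  where "GL_scalars = {c *\<^sub>R mat 1 | c. c \<noteq> 0}"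

definition PGL :: "(real^'m^'m::finite) set monoid"
  where "PGL = GL Mod GL_scalars"

definition PGL_topology :: "(real^'m^'m::finite) set topology"
  where "PGL_topology =
    quotient_topology (top_of_set (carrier GL)) (\<lambda>A. GL_scalars #>\<^bsub>GL\<^esub> A)"

definition discrete_subgroup :: "(real^'m^'m::finite) set set \<Rightarrow> bool"
  where "discrete_subgroup \<Gamma> \<longleftrightarrow>
    subgroup \<Gamma> PGL \<and> subtopology PGL_topology \<Gamma> = discrete_topology \<Gamma>"

definition torsion_free :: "(real^'m^'m::finite) set set \<Rightarrow> bool"
  where "torsion_free \<Gamma> \<longleftrightarrow>
    (\<forall>\<gamma>\<in>\<Gamma>. \<forall>k::nat. k > 0 \<longrightarrow> \<gamma> [^]\<^bsub>PGL\<^esub> k = \<one>\<^bsub>PGL\<^esub> \<longrightarrow> \<gamma> = \<one>\<^bsub>PGL\<^esub>)"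

text \<open>
  An element \<open>\<gamma>\<close> of \<open>PGL\<close> is a class of proportional matrices, all of which map a given line to the
  same line; so the union below is just that line (see \<open>pgl_act_coset\<close>).
\<close>

definition pgl_act :: "(real^('n option)^('n option)) set \<Rightarrow> 'n::finite rp \<Rightarrow> 'n rp"
  where "pgl_act \<gamma> p = Abs_rp (\<Union>A\<in>\<gamma>. (*v) A ` line_of p)"

lemma line_of_rp_class:
  assumes "x \<noteq> 0"
  shows "line_of (rp_class x) = span {x}"
  unfolding rp_class_def using assms by (subst Abs_rp_inverse) auto

lemma GL_coset: "GL_scalars #>\<^bsub>GL\<^esub> A = {c *\<^sub>R A | c. c \<noteq> 0}"
  by (auto simp: r_coset_def GL_scalars_def GL_def scalar_matrix_assoc[symmetric] scalar_mult_eq_scaleR[symmetric])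

lemma group_GL: "group GL"
proof (rule groupI)
  fix A :: "real^'m^'m" assume "A \<in> carrier GL"
  then show "\<exists>B\<in>carrier GL. B \<otimes>\<^bsub>GL\<^esub> A = \<one>\<^bsub>GL\<^esub>"
    unfolding GL_def invertible_def by auto
qed (auto simp: GL_def matrix_mul_assoc intro: invertible_mult, simp add: invertible_def)

lemma invertible_scalar: "c \<noteq> 0 \<Longrightarrow> invertible (c *\<^sub>R mat 1 :: real^'m^'m::finite)"
  unfolding invertible_def
  by (intro exI[of _ "inverse c *\<^sub>R mat 1"]) (simp add: matrix_scalar_ac scalar_matrix_assoc[symmetric])

lemma group_PGL: "group PGL"
proof -
  interpret G: group GL by (rule group_GL)
  have "subgroup GL_scalars (GL :: (real^'m^'m) monoid)"
  proof (rule G.subgroupI)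
    fix S :: "real^'m^'m" assume "S \<in> GL_scalars"
    then obtain c where c: "c \<noteq> 0" "S = c *\<^sub>R mat 1" by (auto simp: GL_scalars_def)
    have "inv\<^bsub>GL\<^esub> S = (1 / c) *\<^sub>R mat 1"
      using c by (intro G.inv_equality)
        (auto simp: GL_def matrix_scalar_ac scalar_matrix_assoc[symmetric] intro: invertible_scalar)
    then show "inv\<^bsub>GL\<^esub> S \<in> GL_scalars" using c by (auto simp: GL_scalars_def)
  next
    fix S T :: "real^'m^'m" assume "S \<in> GL_scalars" "T \<in> GL_scalars"
    then show "S \<otimes>\<^bsub>GL\<^esub> T \<in> GL_scalars"
      by (auto simp: GL_scalars_def GL_def matrix_scalar_ac scalar_matrix_assoc[symmetric])
  qed (auto simp: GL_scalars_def GL_def intro: invertible_scalar exI[of _ "1::real"])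
  moreover have "x \<otimes>\<^bsub>GL\<^esub> h \<otimes>\<^bsub>GL\<^esub> inv\<^bsub>GL\<^esub> x \<in> GL_scalars"
    if x: "x \<in> carrier GL" and h: "h \<in> GL_scalars" for x h :: "real^'m^'m"
  proof -
    obtain c where "c \<noteq> 0" "h = c *\<^sub>R mat 1" using h by (auto simp: GL_scalars_def)
    moreover have "x ** inv\<^bsub>GL\<^esub> x = mat 1" using G.r_inv[OF x] by (simp add: GL_def)
    ultimately show ?thesis
      by (auto simp: GL_scalars_def GL_def matrix_scalar_ac scalar_matrix_assoc[symmetric])
  qed
  ultimately have "normal GL_scalars (GL :: (real^'m^'m) monoid)"
    by (auto simp: G.normal_inv_iff)
  then show ?thesis unfolding PGL_def by (rule normal.factorgroup_is_group)
qed

lemma pgl_act_coset: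
  assumes "invertible A" "x \<noteq> 0"
  shows "pgl_act (GL_scalars #>\<^bsub>GL\<^esub> A) (rp_class x) = rp_class (A *v x)"
proof -
  have "(*v) (c *\<^sub>R A) ` span {x} = span {A *v x}" if "c \<noteq> 0" for c
  proof -
    have "(*v) (c *\<^sub>R A) ` span {x} = span ((*v) (c *\<^sub>R A) ` {x})"
      by (rule linear_span_image[symmetric]) (rule matrix_vector_mul_linear)
    also have "\<dots> = span {c *\<^sub>R (A *v x)}" by (simp add: scaleR_matrix_vector_assoc)
    also have "\<dots> = span {A *v x}"
    proof -
      have "range (\<lambda>k. k *\<^sub>R (c *\<^sub>R (A *v x))) = range (\<lambda>k. k *\<^sub>R (A *v x))"
      proof (intro equalityI subsetI)
        fix z assume "z \<in> range (\<lambda>k. k *\<^sub>R (A *v x))"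
        then obtain k where "z = k *\<^sub>R (A *v x)" by auto
        then have "z = (k / c) *\<^sub>R (c *\<^sub>R (A *v x))" using that by simp
        then show "z \<in> range (\<lambda>k. k *\<^sub>R (c *\<^sub>R (A *v x)))" by blast
      qed auto
      then show ?thesis by (simp add: span_singleton)
    qed
    finally show ?thesis .
  qed
  then have "(\<Union>B\<in>GL_scalars #>\<^bsub>GL\<^esub> A. (*v) B ` span {x}) = span {A *v x}"
    unfolding GL_coset by (intro SUP_eq_const) (auto intro: exI[of _ "1::real"])
  then show ?thesis
    unfolding pgl_act_def line_of_rp_class[OF assms(2)] by (simp only: rp_class_def)
qed

lemma inj_patch:
  assumes "invertible A"
  shows "inj (patch A)"
proof (rule injI)
  fix y z assume eq: "patch A y = patch A z"
  have N: "homog w $ None = 1" for w :: "real^'n" by (simp add: homog_def)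
  have inj: "inj ((*v) A)" using assms by (simp add: inj_matrix_vector_mult)
  have nz: "A *v homog w \<noteq> 0" for w
  proof
    assume "A *v homog w = 0"
    then have "homog w = 0" using inj by (metis injD matrix_vector_mult_0_right)
    then show False using N[of w] by simp
  qed
  have "span {A *v homog y} = span {A *v homog z}"
    using eq nz by (metis line_of_rp_class patch_def)
  then have "A *v homog y \<in> span {A *v homog z}" by (metis span_base singletonI)
  then obtain k where "A *v homog y = k *\<^sub>R (A *v homog z)" by (auto simp: span_singleton)
  then have "A *v homog y = A *v (k *\<^sub>R homog z)" by (simp add: matrix_vector_mult_scaleR)
  then have h: "homog y = k *\<^sub>R homog z" using inj by (auto dest: injD)
  then have "k = 1" using N[of y] N[of z] by simp
  then have "homog y $ Some j = homog z $ Some j" for j using h by simp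
  then show "y = z" by (simp add: homog_def vec_eq_iff)
qed


section \<open>Convex projective manifolds\<close>

definition orbit :: "(real^('n option)^('n option)) set set \<Rightarrow> 'n::finite rp \<Rightarrow> 'n rp set"
  where "orbit \<Gamma> p = (\<lambda>\<gamma>. pgl_act \<gamma> p) ` \<Gamma>"

text \<open>The underlying topological space of \<open>Y = \<Omega>/\<Gamma>\<close>; its points are the \<open>\<Gamma>\<close>-orbits in \<open>\<Omega>\<close>.\<close>

definition quotient_manifold ::
    "'n::finite rp set \<Rightarrow> (real^('n option)^('n option)) set set \<Rightarrow> 'n rp set topology"
  where "quotient_manifold \<Omega> \<Gamma> = quotient_topology (top_of_set \<Omega>) (orbit \<Gamma>)"

definition strictly_convex_projective_manifold ::
    "'n::finite rp set \<Rightarrow> (real^('n option)^('n option)) set set \<Rightarrow> bool"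
  where "strictly_convex_projective_manifold \<Omega> \<Gamma> \<longleftrightarrow>
    \<Omega> \<noteq> {} \<and> open \<Omega> \<and> properly_strictly_convex \<Omega> \<and>
    discrete_subgroup \<Gamma> \<and> (\<forall>\<gamma>\<in>\<Gamma>. pgl_act \<gamma> ` \<Omega> = \<Omega>) \<and> torsion_free \<Gamma>"

text \<open>Manifolds here have no boundary, so closed amounts to compact.\<close>

definition closed_strictly_convex_projective_manifold ::
    "'n::finite rp set \<Rightarrow> (real^('n option)^('n option)) set set \<Rightarrow> bool"
  where "closed_strictly_convex_projective_manifold \<Omega> \<Gamma> \<longleftrightarrow>
    strictly_convex_projective_manifold \<Omega> \<Gamma> \<and> compact_space (quotient_manifold \<Omega> \<Gamma>)"


section \<open>Riemannian metrics on the quotient\<close>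

definition partial_deriv :: "'n \<Rightarrow> (real^'n::finite \<Rightarrow> real) \<Rightarrow> real^'n \<Rightarrow> real"
  where "partial_deriv i f y = frechet_derivative f (at y) (axis i 1)"

fun C_k_on :: "nat \<Rightarrow> (real^'n::finite \<Rightarrow> real) \<Rightarrow> (real^'n) set \<Rightarrow> bool"
  where
    "C_k_on 0 f S \<longleftrightarrow> continuous_on S f"
  | "C_k_on (Suc k) f S \<longleftrightarrow>
      f differentiable_on S \<and> (\<forall>i. C_k_on k (partial_deriv i f) S)"

definition smooth_on :: "(real^'n::finite \<Rightarrow> real) \<Rightarrow> (real^'n) set \<Rightarrow> bool"
  where "smooth_on f S \<longleftrightarrow> (\<forall>k. C_k_on k f S)"

text \<open>The transformation of affine coordinates induced by \<open>\<gamma>\<close>.\<close>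

definition act_in_patch :: "real^('n option)^('n option) \<Rightarrow>
    (real^('n option)^('n option)) set \<Rightarrow> real^'n \<Rightarrow> real^'n::finite"
  where "act_in_patch A \<gamma> y = the_inv_into UNIV (patch A) (pgl_act \<gamma> (patch A y))"

text \<open>
  The projection \<open>\<Omega> \<rightarrow> Y\<close> is a smooth covering with deck group \<open>\<Gamma>\<close>, so Riemannian metrics on \<open>Y\<close> are
  the \<open>\<Gamma>\<close>-invariant Riemannian metrics on \<open>\<Omega>\<close>. They are written as fields \<open>g\<close> of Gram matrices with
  respect to the affine coordinates \<open>patch A\<close>, in which all of \<open>\<Omega>\<close> is contained.
\<close>

definition riemannian_metric :: "real^('n option)^('n option) \<Rightarrow> 'n::finite rp set \<Rightarrow>
    (real^('n option)^('n option)) set set \<Rightarrow> (real^'n \<Rightarrow> real^'n^'n) \<Rightarrow> bool"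
  where "riemannian_metric A \<Omega> \<Gamma> g \<longleftrightarrow>
    (\<forall>i j. smooth_on (\<lambda>y. g y $ i $ j) (patch A -` \<Omega>)) \<and>
    (\<forall>y \<in> patch A -` \<Omega>. transpose (g y) = g y \<and> (\<forall>v. v \<noteq> 0 \<longrightarrow> v \<bullet> (g y *v v) > 0)) \<and>
    (\<forall>\<gamma>\<in>\<Gamma>. \<forall>y \<in> patch A -` \<Omega>. \<forall>v w.
      (let D = frechet_derivative (act_in_patch A \<gamma>) (at y)
       in D v \<bullet> (g (act_in_patch A \<gamma> y) *v D w) = v \<bullet> (g y *v w)))"

text \<open>\<open>christoffel g k i j\<close> is the symbol with upper index \<open>k\<close> and lower indices \<open>i\<close>, \<open>j\<close>.\<close>

definition christoffel ::
    "(real^'n \<Rightarrow> real^'n^'n) \<Rightarrow> 'n \<Rightarrow> 'n \<Rightarrow> 'n \<Rightarrow> real^'n::finite \<Rightarrow> real"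
  where "christoffel g k i j y = (\<Sum>l\<in>UNIV. matrix_inv (g y) $ k $ l *
    (partial_deriv i (\<lambda>x. g x $ j $ l) y + partial_deriv j (\<lambda>x. g x $ i $ l) y
      - partial_deriv l (\<lambda>x. g x $ i $ j) y)) / 2"

text \<open>
  \<open>riemann_component g l i j k\<close> is the \<open>l\<close>-th component of \<open>R(\<partial>\<^sub>i, \<partial>\<^sub>j)\<partial>\<^sub>k\<close>, where
  \<open>R(X, Y) = \<nabla>\<^sub>X\<nabla>\<^sub>Y - \<nabla>\<^sub>Y\<nabla>\<^sub>X - \<nabla>\<^bsub>[X, Y]\<^esub>\<close>.
\<close>

definition riemann_component ::
    "(real^'n \<Rightarrow> real^'n^'n) \<Rightarrow> 'n \<Rightarrow> 'n \<Rightarrow> 'n \<Rightarrow> 'n \<Rightarrow> real^'n::finite \<Rightarrow> real"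
  where "riemann_component g l i j k y =
    partial_deriv i (christoffel g l j k) y - partial_deriv j (christoffel g l i k) y
    + (\<Sum>m\<in>UNIV. christoffel g m j k y * christoffel g l i m y
              - christoffel g m i k y * christoffel g l j m y)"

definition riemann_curvature ::
    "(real^'n \<Rightarrow> real^'n^'n) \<Rightarrow> real^'n::finite \<Rightarrow> real^'n \<Rightarrow> real^'n \<Rightarrow> real^'n \<Rightarrow> real^'n"
  where "riemann_curvature g y u v w =
    (\<chi> l. \<Sum>i\<in>UNIV. \<Sum>j\<in>UNIV. \<Sum>k\<in>UNIV. u $ i * v $ j * w $ k * riemann_component g l i j k y)"

definition sectional_curvature ::
    "(real^'n \<Rightarrow> real^'n^'n) \<Rightarrow> real^'n::finite \<Rightarrow> real^'n \<Rightarrow> real^'n \<Rightarrow> real"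
  where "sectional_curvature g y u v =
    (riemann_curvature g y u v v \<bullet> (g y *v u)) /
    ((u \<bullet> (g y *v u)) * (v \<bullet> (g y *v v)) - (u \<bullet> (g y *v v))\<^sup>2)"

definition hyperbolic_structure :: "real^('n option)^('n option) \<Rightarrow> 'n::finite rp set \<Rightarrow>
    (real^('n option)^('n option)) set set \<Rightarrow> (real^'n \<Rightarrow> real^'n^'n) \<Rightarrow> bool"
  where "hyperbolic_structure A \<Omega> \<Gamma> h \<longleftrightarrow> riemannian_metric A \<Omega> \<Gamma> h \<and>
    (\<forall>y \<in> patch A -` \<Omega>. \<forall>u v. u \<noteq> v \<longrightarrow> independent {u, v} \<longrightarrow> sectional_curvature h y u v = -1)"

definition admits_hyperbolic_structure ::
    "'n::finite rp set \<Rightarrow> (real^('n option)^('n option)) set set \<Rightarrow> bool"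
  where "admits_hyperbolic_structure \<Omega> \<Gamma> \<longleftrightarrow>
    (\<exists>A h. bounded_in_patch A \<Omega> \<and> hyperbolic_structure A \<Omega> \<Gamma> h)"


section \<open>Hilbert metric and Hilbert volume\<close>

text \<open>
  For a bounded convex open set \<open>C\<close> of \<open>\<real>\<^sup>n\<close> and \<open>v \<noteq> 0\<close>, \<open>boundary_hit C y v\<close> is the point \<open>v\<^sup>+\<close> where
  the ray from \<open>y \<in> C\<close> in direction \<open>v\<close> leaves \<open>C\<close>.
\<close>

definition boundary_hit :: "(real^'n) set \<Rightarrow> real^'n \<Rightarrow> real^'n \<Rightarrow> real^'n::finite"
  where "boundary_hit C y v = (THE z. z \<in> frontier C \<and> (\<exists>t>0. z = y + t *\<^sub>R v))"

definition hilbert_finsler :: "(real^'n) set \<Rightarrow> real^'n \<Rightarrow> real^'n::finite \<Rightarrow> real"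
  where "hilbert_finsler C y v =
    (if v = 0 then 0
     else norm v / 2 * (1 / norm (y - boundary_hit C y (- v)) + 1 / norm (y - boundary_hit C y v)))"

text \<open>The volume on a tangent space of the inner product with Gram matrix \<open>G\<close>.\<close>

definition gram_volume :: "real^'n^'n \<Rightarrow> (real^'n::finite) set \<Rightarrow> real"
  where "gram_volume G S = sqrt (det G) * measure lborel S"

definition hilbert_density :: "(real^'n) set \<Rightarrow> (real^'n \<Rightarrow> real^'n^'n) \<Rightarrow> real^'n::finite \<Rightarrow> real"
  where "hilbert_density C g y =
    gram_volume (g y) {v. sqrt (v \<bullet> (g y *v v)) < 1} /
    gram_volume (g y) {v. hilbert_finsler C y v < 1}"

text \<open>
  The total mass on \<open>Y = \<Omega>/\<Gamma>\<close> of the measure \<open>hilbert_density dg\<close>, where \<open>dg = sqrt (det g) dy\<close>. The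
  measure on \<open>Y\<close> is the one for which the projection \<open>\<Omega> \<rightarrow> Y\<close> preserves the mass of Borel sets on
  which it is injective; the total mass is the supremum of these masses, attained at every Borel
  set of representatives of the \<open>\<Gamma>\<close>-orbits.
\<close>

definition hilbert_volume :: "real^('n option)^('n option) \<Rightarrow> 'n::finite rp set \<Rightarrow>
    (real^('n option)^('n option)) set set \<Rightarrow> (real^'n \<Rightarrow> real^'n^'n) \<Rightarrow> ennreal"
  where "hilbert_volume A \<Omega> \<Gamma> g =
    (SUP D \<in> {D \<in> sets borel. D \<subseteq> patch A -` \<Omega> \<and> inj_on (\<lambda>y. orbit \<Gamma> (patch A y)) D}.
      \<integral>\<^sup>+y\<in>D. ennreal (hilbert_density (patch A -` \<Omega>) g y * sqrt (det (g y))) \<partial>lborel)"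

end

(*
  Let K be the open cone over Omega, and let G consist of the matrices of determinant +-1 that represent
  elements of Gamma and preserve K. Each x in K carries the order-unit norm with unit ball
  {v. -x <= v <= x}. In this norm an element of G that moves x a little has operator norm close to 1,
  and commutators of elements close to the identity are contracted (Zassenhaus).

  By cocompactness, a nontrivial M in G attains its minimal displacement a x <= M x <= b x, and strict
  convexity makes b x - M x and M x - a x eigenvectors of M on the boundary of K. M has no further
  boundary fixed points, so commuting nontrivial elements have the same pair of fixed points. If every x
  were moved only slightly by a nontrivial element close to the identity, then a nearly smallest such
  element would commute with all the others; its pair of fixed points would be a locally constant function of x,
  hence constant and G-invariant. But G cannot preserve two boundary rays p, q: every x in K would lie
  within bounded distance of the segment between them, which fails near the rest of the boundary.

  So some x is moved by no nontrivial element close to the identity. Since Gamma is torsion-free,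
  pigeonhole on powers shows that x is displaced by a definite amount depending only on n. Let C be
  Omega in affine coordinates, y the point of C below x, and W = {v. y + v : C, y - v : C}. For a suitable
  r depending only on n, the set y + r W injects into the quotient, and the Hilbert unit balls at its
  points lie in a fixed dilate of W, which bounds the Hilbert mass from below.
*)
theory Submission
  imports Defs
begin

section \<open>Volumes of linear images and packing\<close>

text \<open>The obstacle is uniformity: no constant comparing an order-unit norm with the Euclidean
  norm may enter the bound. Such comparisons serve only qualitative statements such as compactness
  and discreteness. The quantitative steps are numerical estimates in the order-unit norm; the
  dimension enters through packing in the space of matrices and through Euclidean volumes.

  The normalisation of determinants gives displacement an absolute meaning on a cone, where only
  rays are canonical: as M preserves volume, \<open>a x <= M x <= b x\<close> forces
  \<open>a <= 1 <= b\<close>, so a bound on \<open>b / a\<close> bounds both ends.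

  Zassenhaus contraction needs closeness to the identity and not just small displacement, since an
  element that hardly moves x may still turn its neighbourhood by a large angle.\<close>

lemmas mv_simps = matrix_vector_mult_diff_distrib matrix_vector_right_distrib matrix_vector_mult_scaleR

text \<open>\<open>measure_linear_image\<close> asks for a well-ordered index type. This copy of
  \<open>'n\<close> carries the order of the enumeration \<open>to_nat_on UNIV\<close>, so the
  formula transfers to every finite index type.\<close>

typedef 'n wo = "UNIV :: 'n set" morphisms of_wo to_wo ..

instantiation wo :: (finite) wellorder
begin

definition less_eq_wo :: "'a wo \<Rightarrow> 'a wo \<Rightarrow> bool"
  where "less_eq_wo a b \<longleftrightarrow> to_nat_on UNIV (of_wo a) \<le> to_nat_on UNIV (of_wo b)"

definition less_wo :: "'a wo \<Rightarrow> 'a wo \<Rightarrow> bool"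
  where "less_wo a b \<longleftrightarrow> to_nat_on UNIV (of_wo a) < to_nat_on UNIV (of_wo b)"

instance
proof
  have inj: "to_nat_on UNIV (of_wo a) = to_nat_on UNIV (of_wo b) \<longleftrightarrow> a = b" for a b :: "'a wo"
    by (simp add: countable_finite of_wo_inject)
  show "a \<le> b \<Longrightarrow> b \<le> a \<Longrightarrow> a = b" for a b :: "'a wo"
    using inj by (simp add: less_eq_wo_def)
  fix P :: "'a wo \<Rightarrow> bool" and a
  assume *: "\<And>x. (\<And>y. y < x \<Longrightarrow> P y) \<Longrightarrow> P x"
  show "P a"
    by (induction a rule: measure_induct_rule[of "\<lambda>a. to_nat_on UNIV (of_wo a)"])
      (metis * less_wo_def)
qed (auto simp: less_eq_wo_def less_wo_def)

end

instance wo :: (finite) finite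
proof
  have "UNIV = range (to_wo :: 'a \<Rightarrow> 'a wo)"
    by (metis UNIV_eq_I of_wo_inverse rangeI)
  then show "finite (UNIV :: 'a wo set)"
    by (metis finite finite_imageI)
qed

lemma bij_to_wo: "bij to_wo"
  by (metis UNIV_I bijI' of_wo_inverse to_wo_inject)

lemma bij_of_wo: "bij of_wo"
  by (metis UNIV_I bijI' of_wo_inject to_wo_inverse)

definition relabel :: "real^'n \<Rightarrow> real^('n::finite wo)"
  where "relabel v = (\<chi> i. v $ of_wo i)"

definition unlabel :: "real^('n::finite wo) \<Rightarrow> real^'n"
  where "unlabel v = (\<chi> i. v $ to_wo i)"

lemma unlabel_relabel [simp]: "unlabel (relabel v) = v"
  by (simp add: relabel_def unlabel_def to_wo_inverse)

lemma relabel_unlabel [simp]: "relabel (unlabel v) = v"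
  by (simp add: relabel_def unlabel_def of_wo_inverse)

lemma linear_relabel: "linear relabel"
  by (rule linearI) (simp_all add: relabel_def vec_eq_iff)

lemma linear_unlabel: "linear unlabel"
  by (rule linearI) (simp_all add: unlabel_def vec_eq_iff)

text \<open>Conjugation by the bijection \<open>of_wo\<close> matches the permutations of the two
  index types and preserves signs, so the Leibniz expansions agree term by term.\<close>

lemma det_relabel:
  fixes M :: "real^'n::finite^'n"
  shows "det (\<chi> a b. M $ of_wo a $ of_wo b) = det M"
proof -
  have "(\<Sum>q | q permutes (UNIV :: 'n wo set). of_int (sign q) * (\<Prod>i\<in>UNIV. M $ of_wo i $ of_wo (q i)))
      = (\<Sum>p | p permutes (UNIV :: 'n set). of_int (sign p) * (\<Prod>i\<in>UNIV. M $ i $ p i))"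
  proof (rule sum.reindex_bij_witness[where j = "map_permutation UNIV of_wo" and i = "map_permutation UNIV to_wo"])
    fix q :: "'n wo \<Rightarrow> 'n wo" assume "q \<in> {q. q permutes UNIV}"
    then have q: "q permutes UNIV" by simp
    show "map_permutation UNIV to_wo (map_permutation UNIV of_wo q) = q"
      using q bij_of_wo by (intro map_permutation_compose_inv) (auto simp: of_wo_inverse)
    show "map_permutation UNIV of_wo q \<in> {p. p permutes UNIV}"
      using map_permutation_permutes[OF bij_of_wo q] by simp
    have m: "map_permutation UNIV of_wo q (of_wo i) = of_wo (q i)" for i
      using bij_of_wo unfolding map_permutation_def restrict_id_def by (simp add: inv_f_f[OF bij_is_inj[OF bij_of_wo]])
    have "(\<Prod>i\<in>UNIV. M $ i $ map_permutation UNIV of_wo q i)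
        = (\<Prod>i\<in>UNIV. M $ of_wo i $ map_permutation UNIV of_wo q (of_wo i))"
      using bij_of_wo by (intro prod.reindex_bij_betw[symmetric]) simp
    then show "of_int (sign (map_permutation UNIV of_wo q)) * (\<Prod>i\<in>UNIV. M $ i $ map_permutation UNIV of_wo q i)
        = of_int (sign q) * (\<Prod>i\<in>UNIV. M $ of_wo i $ of_wo (q i))"
      using sign_map_permutation[OF bij_is_inj[OF bij_of_wo] q] by (simp add: m)
  next
    fix p :: "'n \<Rightarrow> 'n" assume "p \<in> {p. p permutes UNIV}"
    then have p: "p permutes UNIV" by simp
    show "map_permutation UNIV of_wo (map_permutation UNIV to_wo p) = p"
      using p bij_to_wo by (intro map_permutation_compose_inv) (auto simp: to_wo_inverse)
    show "map_permutation UNIV to_wo p \<in> {p. p permutes UNIV}"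
      using map_permutation_permutes[OF bij_to_wo p] by simp
  qed
  then show ?thesis by (simp add: det_def)
qed

text \<open>Lebesgue measure is determined by its values on boxes, and renaming coordinates
  preserves boxes and their side lengths.\<close>

lemma lborel_unlabel: "lborel = distr lborel borel (unlabel :: _ \<Rightarrow> real^'n::finite)"
proof (rule lborel_eqI)
  fix l u :: "real^'n" assume lu: "\<And>b. b \<in> Basis \<Longrightarrow> l \<bullet> b \<le> u \<bullet> b"
  have le: "l $ i \<le> u $ i" for i
    using lu[of "axis i 1"] by (simp add: inner_axis axis_in_Basis_iff)
  have m: "unlabel \<in> measurable lborel borel"
    by (simp add: linear_unlabel linear_continuous_on linear_conv_bounded_linear[symmetric] borel_measurable_continuous_onI)
  have "unlabel -` box l u = box (relabel l) (relabel u)"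
    unfolding set_eq_iff vimage_eq mem_box_cart relabel_def unlabel_def
    by (auto simp: of_wo_inverse to_wo_inverse) (metis UNIV_I to_wo_inverse of_wo_inverse)+
  then have "emeasure (distr lborel borel unlabel) (box l u) = emeasure lborel (box (relabel l) (relabel u))"
    using m by (subst emeasure_distr) auto
  also have "\<dots> = ennreal (prod ((\<bullet>) (relabel u - relabel l)) Basis)"
    by (rule emeasure_lborel_box) (auto simp: Basis_vec_def inner_axis relabel_def le)
  also have "prod ((\<bullet>) (relabel u - relabel l)) Basis = (\<Prod>i\<in>UNIV. u $ of_wo i - l $ of_wo i)"
    unfolding Basis_vec_def
    by (subst prod.UNION_disjoint) (auto simp: inner_axis relabel_def axis_eq_axis)
  also have "\<dots> = (\<Prod>i\<in>UNIV. u $ i - l $ i)"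
    using bij_of_wo by (intro prod.reindex_bij_betw) simp
  also have "\<dots> = prod ((\<bullet>) (u - l)) Basis"
    unfolding Basis_vec_def
    by (subst prod.UNION_disjoint) (auto simp: inner_axis axis_eq_axis)
  finally show "emeasure (distr lborel borel unlabel) (box l u) = ennreal (prod ((\<bullet>) (u - l)) Basis)" .
qed simp

lemma measure_relabel:
  fixes S :: "(real^'n::finite) set"
  assumes "S \<in> sets borel"
  shows "measure lebesgue (relabel ` S) = measure lebesgue S"
proof -
  have m: "unlabel \<in> measurable lborel (borel :: (real^'n) measure)"
    by (simp add: linear_unlabel linear_continuous_on linear_conv_bounded_linear[symmetric] borel_measurable_continuous_onI)
  have eq: "relabel ` S = unlabel -` S"
    by (auto simp: image_iff) (metis relabel_unlabel)
  have "measure lborel S = measure (distr lborel borel unlabel) S"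
    by (subst lborel_unlabel) simp
  also have "\<dots> = measure lborel (relabel ` S)"
    using m assms by (simp add: measure_distr eq)
  finally have "measure lborel (relabel ` S) = measure lborel S" ..
  moreover have "relabel ` S \<in> sets borel"
    unfolding eq using measurable_sets[OF m assms] by simp
  ultimately show ?thesis using assms by (simp add: measure_completion)
qed

text \<open>The library has this only for index types that are well-ordered.\<close>

lemma measure_linear_image_compact:
  fixes M :: "real^'n::finite^'n"
  assumes "compact S"
  shows "measure lebesgue ((*v) M ` S) = \<bar>det M\<bar> * measure lebesgue S"
proof -
  define M' :: "real^('n wo)^('n wo)" where "M' = (\<chi> a b. M $ of_wo a $ of_wo b)"
  have rel: "relabel (M *v v) = M' *v relabel v" for v
  proof -
    have "(\<Sum>j\<in>UNIV. M $ of_wo a $ of_wo j * v $ of_wo j) = (\<Sum>j\<in>UNIV. M $ of_wo a $ j * v $ j)" for a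
      using bij_of_wo by (intro sum.reindex_bij_betw) simp
    then show ?thesis
      by (simp add: relabel_def M'_def matrix_vector_mult_def)
  qed
  have c: "compact (relabel ` S)"
    using assms linear_relabel by (intro compact_continuous_image linear_continuous_on) (simp add: linear_conv_bounded_linear)
  have c': "compact ((*v) M ` S)"
    using assms by (intro compact_continuous_image matrix_vector_mult_linear_continuous_on)
  have "measure lebesgue ((*v) M ` S) = measure lebesgue (relabel ` (*v) M ` S)"
    using c' by (simp add: measure_relabel borel_compact)
  also have "relabel ` (*v) M ` S = (*v) M' ` relabel ` S"
    by (simp add: image_image rel)
  also have "measure lebesgue \<dots> = \<bar>det M'\<bar> * measure lebesgue (relabel ` S)"
    using measure_linear_image[of "(*v) M'" "relabel ` S"] c by (simp add: lmeasurable_compact)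
  also have "\<dots> = \<bar>det M\<bar> * measure lebesgue S"
    using assms by (simp add: M'_def det_relabel measure_relabel borel_compact)
  finally show ?thesis .
qed

section \<open>Packing by volume comparison\<close>

lemma measure_scaleR_image:
  fixes S :: "'a::euclidean_space set"
  shows "measure lebesgue ((*\<^sub>R) r ` S) = \<bar>r\<bar> ^ DIM('a) * measure lebesgue S"
  using measure_lebesgue_affine[of r 0 S] by simp

lemma measure_pos_interior:
  fixes S :: "'a::euclidean_space set"
  assumes "S \<in> lmeasurable" "ball a r \<subseteq> S" "r > 0"
  shows "measure lebesgue S > 0"
proof -
  have "0 < measure lebesgue (ball a r)"
    using assms(3) by (simp add: content_ball_pos)
  also have "\<dots> \<le> measure lebesgue S"
    using assms by (intro measure_mono_fmeasurable) auto
  finally show ?thesis .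
qed

text \<open>The translates of \<open>(s/2) B\<close> by the points of \<open>T\<close> are disjoint
  and lie in \<open>(R + s/2) B\<close>; on comparing volumes, that of \<open>B\<close> cancels. The
  bound is thus the same for all symmetric convex bodies.\<close>

lemma card_separated_le:
  fixes B :: "'a::euclidean_space set"
  assumes B: "convex B" "bounded B" "ball 0 r \<subseteq> B" "r > 0" "\<And>v. v \<in> B \<Longrightarrow> - v \<in> B"
    and T: "finite T" "T \<subseteq> (*\<^sub>R) R ` B" "R \<ge> 0" "s > 0"
    and sep: "\<And>t t'. t \<in> T \<Longrightarrow> t' \<in> T \<Longrightarrow> t \<noteq> t' \<Longrightarrow> t - t' \<notin> (*\<^sub>R) s ` B"
  shows "real (card T) \<le> (1 + 2 * R / s) ^ DIM('a)"
proof -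
  let ?n = "DIM('a)"
  define \<mu> where "\<mu> = measure lebesgue B"
  have Bm: "B \<in> lmeasurable" using B by (simp add: measurable_convex)
  have pos: "\<mu> > 0"
    unfolding \<mu>_def using Bm B(3,4) by (rule measure_pos_interior)
  have scm: "(*\<^sub>R) c ` B \<in> lmeasurable" for c
    using B by (intro measurable_convex convex_scaling bounded_scaling)
  have B2: "(1/2) *\<^sub>R (b - b') \<in> B" if "b \<in> B" "b' \<in> B" for b b'
    using convexD[OF B(1) that(1) B(5)[OF that(2)], of "1/2" "1/2"] by (simp add: algebra_simps)
  let ?A = "\<lambda>t. (+) t ` (*\<^sub>R) (s/2) ` B"
  have disj: "?A t \<inter> ?A t' = {}" if "t \<in> T" "t' \<in> T" "t \<noteq> t'" for t t'
  proof (rule ccontr)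
    assume "?A t \<inter> ?A t' \<noteq> {}"
    then obtain b b' where b: "b \<in> B" "b' \<in> B" "t + (s/2) *\<^sub>R b = t' + (s/2) *\<^sub>R b'" by auto
    then have "t - t' = s *\<^sub>R ((1/2) *\<^sub>R (b' - b))"
      by (simp add: algebra_simps)
    then show False using sep[OF that] B2[OF b(2,1)] by blast
  qed
  have sub: "?A t \<subseteq> (*\<^sub>R) (R + s/2) ` B" if "t \<in> T" for t
  proof
    fix z assume "z \<in> ?A t"
    moreover obtain b' where "b' \<in> B" "t = R *\<^sub>R b'" using \<open>t \<in> T\<close> T(2) by auto
    ultimately obtain b where b: "b \<in> B" "b' \<in> B" "z = R *\<^sub>R b' + (s/2) *\<^sub>R b" by auto
    have "z = (R + s/2) *\<^sub>R ((R / (R + s/2)) *\<^sub>R b' + ((s/2) / (R + s/2)) *\<^sub>R b)"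
    proof -
      have "c * (d / c) = d" if "c \<noteq> 0" for c d :: real using that by simp
      moreover have "R + s/2 \<noteq> 0" using T(3,4) by simp
      ultimately have "(R + s/2) * (R / (R + s/2)) = R" "(R + s/2) * ((s/2) / (R + s/2)) = s/2"
        by blast+
      then show ?thesis by (simp only: b scaleR_add_right scaleR_scaleR)
    qed
    moreover have "(R / (R + s/2)) *\<^sub>R b' + ((s/2) / (R + s/2)) *\<^sub>R b \<in> B"
    proof (rule convexD[OF B(1) b(2) b(1)])
      have "R + s/2 \<noteq> 0" using T(3,4) by simp
      then show "R / (R + s/2) + (s/2) / (R + s/2) = 1"
        by (metis add_divide_distrib divide_self)
    qed (use T(3,4) in auto)
    ultimately show "z \<in> (*\<^sub>R) (R + s/2) ` B" by blast
  qed
  have Am: "?A t \<in> lmeasurable" for t by (intro measurable_translation scm)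
  have "real (card T) * ((s/2) ^ ?n * \<mu>) = (\<Sum>t\<in>T. measure lebesgue (?A t))"
    using T(4) by (simp add: measure_translation measure_scaleR_image \<mu>_def)
  also have "\<dots> = measure lebesgue (\<Union>t\<in>T. ?A t)"
    using T(1) disj Am by (intro measure_UNION'[symmetric]) (auto simp: pairwise_def disjnt_def)
  also have "\<dots> \<le> measure lebesgue ((*\<^sub>R) (R + s/2) ` B)"
    using T(1) sub Am scm by (intro measure_mono_fmeasurable UN_least sets.finite_UN fmeasurableD)
  also have "\<dots> = (R + s/2) ^ ?n * \<mu>"
    using T(3,4) by (simp add: measure_scaleR_image \<mu>_def)
  finally have "real (card T) * (s/2) ^ ?n \<le> (R + s/2) ^ ?n" using pos by simp
  then have "real (card T) \<le> (R + s/2) ^ ?n / (s/2) ^ ?n"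
    using T(4) by (subst pos_le_divide_eq) auto
  then have "real (card T) \<le> ((R + s/2) / (s/2)) ^ ?n"
    by (simp only: power_divide)
  also have "(R + s/2) / (s/2) = 1 + 2 * R / s" using T(4) by (simp add: field_simps)
  finally show ?thesis .
qed

section \<open>Order-unit norms of a strictly convex cone\<close>

lemma scaleR_diff_add_cancel:
  fixes x :: "'a::real_vector"
  shows "t *\<^sub>R x - v + (t *\<^sub>R x + v) = (2 * t) *\<^sub>R x"
proof -
  have "t *\<^sub>R x - v + (t *\<^sub>R x + v) = t *\<^sub>R x + t *\<^sub>R x" by simp
  also have "\<dots> = (t + t) *\<^sub>R x" by (simp only: scaleR_add_left)
  finally show ?thesis by (simp only: mult_2)
qed

text \<open>\<open>proper\<close> is boundedness in a patch, expressed by a functional that is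
  positive on the closed cone minus 0. \<open>strict\<close> expresses the absence of boundary
  segments without reference to a patch: a sum of two boundary vectors stays on the boundary only if
  they span the same ray.\<close>

locale strictly_convex_cone =
  fixes K :: "(real^'m::finite) set"
  assumes open_K: "open K"
    and nonempty_K: "K \<noteq> {}"
    and add_K: "x \<in> K \<Longrightarrow> y \<in> K \<Longrightarrow> x + y \<in> K"
    and scale_K: "x \<in> K \<Longrightarrow> c > 0 \<Longrightarrow> c *\<^sub>R x \<in> K"
    and proper: "\<exists>a. \<forall>x\<in>K. norm x \<le> a \<bullet> x"
    and strict: "p \<in> closure K \<Longrightarrow> q \<in> closure K \<Longrightarrow> p \<noteq> 0 \<Longrightarrow> q \<noteq> 0 \<Longrightarrow> p + q \<notin> K
      \<Longrightarrow> \<exists>c>0. q = c *\<^sub>R p"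
begin

abbreviation "Kc \<equiv> closure K"

text \<open>
  \<open>bnd x v t\<close> says that \<open>v\<close> has size at most \<open>t\<close> in the order-unit norm of \<open>x\<close>, and \<open>obnd x L e\<close> that
  \<open>L\<close> has operator norm at most \<open>e\<close> with respect to this norm.
\<close>

definition bnd :: "real^'m \<Rightarrow> real^'m \<Rightarrow> real \<Rightarrow> bool"
  where "bnd x v t \<longleftrightarrow> t *\<^sub>R x - v \<in> Kc \<and> t *\<^sub>R x + v \<in> Kc"

definition obnd :: "real^'m \<Rightarrow> real^'m^'m \<Rightarrow> real \<Rightarrow> bool"
  where "obnd x L e \<longleftrightarrow> (\<forall>v t. bnd x v t \<longrightarrow> bnd x (L *v v) (e * t))"

lemma K_subset: "x \<in> K \<Longrightarrow> x \<in> Kc"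
  using closure_subset by blast

lemma KP_add:
  assumes "x \<in> K" "y \<in> Kc"
  shows "x + y \<in> K"
proof -
  obtain e where e: "e > 0" "ball x e \<subseteq> K" using open_K assms(1) by (meson openE)
  obtain z where z: "z \<in> K" "dist z y < e" using assms(2) e(1) by (meson closure_approachable)
  have "x + (y - z) \<in> ball x e" using z by (simp add: dist_norm norm_minus_commute)
  then have "x + (y - z) + z \<in> K" using e z add_K by blast
  then show ?thesis by simp
qed

lemma P_add: "x \<in> Kc \<Longrightarrow> y \<in> Kc \<Longrightarrow> x + y \<in> Kc"
proof -
  assume x: "x \<in> Kc" and y: "y \<in> Kc"
  obtain f where f: "\<And>n. f n \<in> K" "f \<longlonglongrightarrow> x" using x by (auto simp: closure_sequential)
  have "(\<lambda>n. f n + y) \<longlonglongrightarrow> x + y" by (intro tendsto_intros f)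
  moreover have "\<And>n. f n + y \<in> Kc" using f(1) y KP_add K_subset by blast
  ultimately show ?thesis by (meson closed_closure closed_sequentially)
qed

lemma P_zero: "0 \<in> Kc"
proof -
  obtain x where x: "x \<in> K" using nonempty_K by auto
  have "(\<lambda>n. inverse (real (Suc n)) *\<^sub>R x) \<longlonglongrightarrow> 0 *\<^sub>R x"
    by (intro tendsto_intros LIMSEQ_inverse_real_of_nat)
  then have 1: "(\<lambda>n. inverse (real (Suc n)) *\<^sub>R x) \<longlonglongrightarrow> 0" by simp
  have 2: "inverse (real (Suc n)) *\<^sub>R x \<in> Kc" for n
    by (intro K_subset scale_K x) simp
  show ?thesis by (rule closed_sequentially[OF closed_closure 2 1])
qed

lemma P_scale:
  assumes "x \<in> Kc" "c \<ge> 0"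
  shows "c *\<^sub>R x \<in> Kc"
proof (cases "c = 0")
  case True then show ?thesis by (simp add: P_zero)
next
  case False
  obtain f where f: "\<And>n. f n \<in> K" "f \<longlonglongrightarrow> x" using assms by (auto simp: closure_sequential)
  have "(\<lambda>n. c *\<^sub>R f n) \<longlonglongrightarrow> c *\<^sub>R x" by (intro tendsto_intros f)
  moreover have "\<And>n. c *\<^sub>R f n \<in> Kc" using f(1) scale_K K_subset assms False by simp
  ultimately show ?thesis by (meson closed_closure closed_sequentially)
qed

lemma P_proper: "\<exists>a. \<forall>x\<in>Kc. norm x \<le> a \<bullet> x"
proof -
  obtain a where a: "\<And>x. x \<in> K \<Longrightarrow> norm x \<le> a \<bullet> x" using proper by auto
  have "closed {x. norm x \<le> a \<bullet> x}" by (intro closed_Collect_le continuous_intros)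
  then have "Kc \<subseteq> {x. norm x \<le> a \<bullet> x}" using a by (intro closure_minimal) auto
  then show ?thesis by auto
qed

lemma P_pointed: "x \<in> Kc \<Longrightarrow> - x \<in> Kc \<Longrightarrow> x = 0"
proof -
  assume x: "x \<in> Kc" "- x \<in> Kc"
  obtain a where "\<And>x. x \<in> Kc \<Longrightarrow> norm x \<le> a \<bullet> x" using P_proper by auto
  from this[OF x(1)] this[OF x(2)] have "norm x \<le> 0" by (simp only: norm_minus_cancel inner_minus_right)
  then show ?thesis by simp
qed

lemma zero_notin_K: "0 \<notin> K"
proof
  assume "0 \<in> K"
  then obtain e where e: "e > 0" "ball 0 e \<subseteq> K" using open_K by (meson openE)
  define v :: "real^'m" where "v = (e/2) *\<^sub>R axis undefined 1"
  have "v \<in> ball 0 e" "- v \<in> ball 0 e" using e by (auto simp: v_def norm_axis_1)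
  then have "v = 0" using e by (intro P_pointed K_subset) blast+
  then show False using e by (simp add: v_def axis_eq_0_iff)
qed

text \<open>The boundary vector \<open>r\<close> is the sum of \<open>s p\<close> and
  \<open>r - s p\<close>, both in the closed cone, so strictness puts them on one ray. Hence a
  boundary vector dominates only vectors on its own ray.\<close>

lemma strict_order:
  assumes "r \<in> Kc" "r \<notin> K" "p \<in> Kc" "p \<noteq> 0" "s > 0" "r - s *\<^sub>R p \<in> Kc"
  shows "\<exists>c>0. r = c *\<^sub>R p"
proof (cases "r - s *\<^sub>R p = 0")
  case True then show ?thesis using assms by auto
next
  case False
  then obtain c where c: "c > 0" "r - s *\<^sub>R p = c *\<^sub>R (s *\<^sub>R p)"
    using strict[of "s *\<^sub>R p" "r - s *\<^sub>R p"] assms P_scale by auto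
  then have "r = (c * s + s) *\<^sub>R p" by (simp add: algebra_simps)
  then show ?thesis using c assms(5) by (intro exI[of _ "c * s + s"]) (auto intro: add_pos_pos)
qed

text \<open>This constant and those of \<open>bnd_ex\<close>, \<open>obnd_norm\<close> and
  \<open>obnd_ball\<close> depend on \<open>x\<close> and on the cone. They serve boundedness,
  discreteness and the like and never enter the final bound.\<close>

lemma bnd_norm: "x \<in> K \<Longrightarrow> \<exists>c>0. \<forall>v t. bnd x v t \<longrightarrow> norm v \<le> c * t"
proof -
  assume x: "x \<in> K"
  obtain a where a: "\<And>x. x \<in> Kc \<Longrightarrow> norm x \<le> a \<bullet> x" using P_proper by auto
  have *: "norm v \<le> (a \<bullet> x) * t" if "bnd x v t" for v t
  proof -
    have "norm (2 *\<^sub>R v) = norm ((t *\<^sub>R x + v) - (t *\<^sub>R x - v))" by (simp add: scaleR_2)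
    also have "\<dots> \<le> norm (t *\<^sub>R x + v) + norm (t *\<^sub>R x - v)" by (rule norm_triangle_ineq4)
    also have "\<dots> \<le> a \<bullet> (t *\<^sub>R x + v) + a \<bullet> (t *\<^sub>R x - v)"
      using that a unfolding bnd_def by (intro add_mono) auto
    also have "\<dots> = 2 * ((a \<bullet> x) * t)" by (simp add: inner_diff_right inner_add_right)
    finally show ?thesis by simp
  qed
  have "x \<noteq> 0" using x zero_notin_K by auto
  then have "a \<bullet> x > 0" using a[OF K_subset[OF x]] by (smt (verit) zero_less_norm_iff)
  then show ?thesis using * by blast
qed

lemma bnd_ex: "x \<in> K \<Longrightarrow> \<exists>r>0. \<forall>v. bnd x v (norm v / r)"
proof -
  assume x: "x \<in> K"
  obtain r where r: "r > 0" "cball x r \<subseteq> K" using open_K x by (meson open_contains_cball)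
  have "bnd x v (norm v / r)" for v
  proof (cases "v = 0")
    case True then show ?thesis by (simp add: bnd_def P_zero)
  next
    case False
    have "x + (r / norm v) *\<^sub>R v \<in> K" "x - (r / norm v) *\<^sub>R v \<in> K"
      using r False by (auto intro!: subsetD[OF r(2)] simp: dist_norm)
    then have "(norm v / r) *\<^sub>R (x + (r / norm v) *\<^sub>R v) \<in> Kc"
       "(norm v / r) *\<^sub>R (x - (r / norm v) *\<^sub>R v) \<in> Kc"
      using r by (intro P_scale K_subset; simp)+
    then show ?thesis using r False by (simp add: bnd_def scaleR_add_right scaleR_diff_right)
  qed
  then show ?thesis using r(1) by blast
qed

section \<open>Rules for the order-unit norm and its operator norm\<close>

lemma bnd_nonneg: "x \<in> K \<Longrightarrow> bnd x v t \<Longrightarrow> t \<ge> 0"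
proof (rule ccontr)
  assume x: "x \<in> K" and b: "bnd x v t" and "\<not> t \<ge> 0"
  have "t *\<^sub>R x - v + (t *\<^sub>R x + v) \<in> Kc" using b unfolding bnd_def by (blast intro: P_add)
  moreover have "t *\<^sub>R x - v + (t *\<^sub>R x + v) = (2 * t) *\<^sub>R x" by (rule scaleR_diff_add_cancel)
  ultimately have "(2 * t) *\<^sub>R x \<in> Kc" by (simp only:)
  then have "(1 / - (2*t)) *\<^sub>R ((2 * t) *\<^sub>R x) \<in> Kc"
    by (rule P_scale) (use \<open>\<not> t \<ge> 0\<close> in simp)
  then have "- x \<in> Kc" using \<open>\<not> t \<ge> 0\<close> by simp
  then have "x = 0" using P_pointed[OF K_subset[OF x]] by simp
  then show False using x zero_notin_K by simp
qed

lemma bnd_mono: "x \<in> Kc \<Longrightarrow> bnd x v t \<Longrightarrow> t \<le> t' \<Longrightarrow> bnd x v t'"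
proof -
  assume "x \<in> Kc" "bnd x v t" "t \<le> t'"
  then have "(t' - t) *\<^sub>R x + (t *\<^sub>R x - v) \<in> Kc" "(t' - t) *\<^sub>R x + (t *\<^sub>R x + v) \<in> Kc"
    unfolding bnd_def by (auto intro!: P_add P_scale)
  then show ?thesis by (simp add: bnd_def algebra_simps)
qed

lemma bnd_add: "bnd x v t \<Longrightarrow> bnd x w u \<Longrightarrow> bnd x (v + w) (t + u)"
proof -
  assume "bnd x v t" "bnd x w u"
  then have "(t *\<^sub>R x - v) + (u *\<^sub>R x - w) \<in> Kc" "(t *\<^sub>R x + v) + (u *\<^sub>R x + w) \<in> Kc"
    unfolding bnd_def by (auto intro!: P_add)
  then show ?thesis by (simp add: bnd_def algebra_simps)
qed

lemma bnd_minus: "bnd x (- v) t \<longleftrightarrow> bnd x v t"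
  by (auto simp: bnd_def)

lemma bnd_scale: "bnd x v t \<Longrightarrow> bnd x (c *\<^sub>R v) (\<bar>c\<bar> * t)"
proof -
  assume b: "bnd x v t"
  have "\<bar>c\<bar> *\<^sub>R (t *\<^sub>R x - v) \<in> Kc" "\<bar>c\<bar> *\<^sub>R (t *\<^sub>R x + v) \<in> Kc"
    using b unfolding bnd_def by (auto intro!: P_scale)
  then have "bnd x (\<bar>c\<bar> *\<^sub>R v) (\<bar>c\<bar> * t)" by (simp add: bnd_def algebra_simps)
  then show ?thesis by (cases "c \<ge> 0") (auto simp: bnd_minus)
qed

lemma bnd_base: "bnd x v t \<Longrightarrow> t \<ge> 0 \<Longrightarrow> b *\<^sub>R y - x \<in> Kc \<Longrightarrow> bnd y v (b * t)"
proof -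
  assume "bnd x v t" "t \<ge> 0" "b *\<^sub>R y - x \<in> Kc"
  then have "t *\<^sub>R (b *\<^sub>R y - x) + (t *\<^sub>R x - v) \<in> Kc" "t *\<^sub>R (b *\<^sub>R y - x) + (t *\<^sub>R x + v) \<in> Kc"
    unfolding bnd_def by (auto intro!: P_add P_scale)
  then show ?thesis by (simp add: bnd_def algebra_simps)
qed

lemma bnd_self: "x \<in> Kc \<Longrightarrow> bnd x x 1"
  using P_add[of x x] by (simp only: bnd_def P_zero scaleR_one diff_self simp_thms)

lemma obndD: "obnd x L e \<Longrightarrow> bnd x v t \<Longrightarrow> bnd x (L *v v) (e * t)"
  by (auto simp: obnd_def)

lemma obnd_mult: "obnd x L e \<Longrightarrow> obnd x M f \<Longrightarrow> obnd x (L ** M) (e * f)"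
  unfolding obnd_def by (simp add: matrix_vector_mul_assoc[symmetric] mult.assoc)

lemma obnd_add: "obnd x L e \<Longrightarrow> obnd x M f \<Longrightarrow> obnd x (L + M) (e + f)"
  unfolding obnd_def by (auto simp: matrix_vector_mult_add_rdistrib distrib_right intro!: bnd_add)

lemma obnd_scale:
  assumes "obnd x L e"
  shows "obnd x (c *\<^sub>R L) (\<bar>c\<bar> * e)"
  unfolding obnd_def
proof (intro allI impI)
  fix v t assume "bnd x v t"
  from bnd_scale[OF obndD[OF assms this], of c]
  show "bnd x (c *\<^sub>R L *v v) (\<bar>c\<bar> * e * t)" by (simp only: scaleR_matrix_vector_assoc mult.assoc)
qed

lemma obnd_minus: "obnd x L e \<Longrightarrow> obnd x (- L) e"
  using obnd_scale[of x L e "-1"] by simp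

lemma obnd_diff: "obnd x L e \<Longrightarrow> obnd x M f \<Longrightarrow> obnd x (L - M) (e + f)"
  using obnd_add[OF _ obnd_minus, of x L e M f] by simp

lemma obnd_mono:
  assumes "x \<in> K" "obnd x L e" "e \<le> f"
  shows "obnd x L f"
  unfolding obnd_def
proof (intro allI impI)
  fix v t assume v: "bnd x v t"
  show "bnd x (L *v v) (f * t)"
    by (rule bnd_mono[OF K_subset[OF assms(1)] obndD[OF assms(2) v]])
      (intro mult_right_mono assms(3) bnd_nonneg[OF assms(1) v])
qed

lemma obnd_nonneg: "x \<in> K \<Longrightarrow> obnd x L e \<Longrightarrow> e \<ge> 0"
  using bnd_nonneg[of x "L *v x" "e * 1"] obndD[of x L e x 1] bnd_self[OF K_subset, of x] by simp

text \<open>The base point changes twice: \<open>y <= a x\<close> turns a bound on the argument at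
  \<open>y\<close> into one at \<open>x\<close>, and \<open>x <= b y\<close> turns the bound on its
  image back.\<close>

lemma obnd_base:
  assumes "x \<in> K" "y \<in> K" "obnd x L e" "b *\<^sub>R y - x \<in> Kc" "a *\<^sub>R x - y \<in> Kc"
  shows "obnd y L (b * e * a)"
  unfolding obnd_def
proof (intro allI impI)
  fix v t assume v: "bnd y v t"
  have "bnd x v (a * t)" by (rule bnd_base[OF v bnd_nonneg[OF assms(2) v] assms(5)])
  then have 1: "bnd x (L *v v) (e * (a * t))" using assms(3) by (rule obndD[rotated])
  have "bnd y (L *v v) (b * (e * (a * t)))"
    by (rule bnd_base[OF 1 bnd_nonneg[OF assms(1) 1] assms(4)])
  then show "bnd y (L *v v) (b * e * a * t)" by (simp add: mult.assoc)
qed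

lemma obnd_one: "obnd x (mat 1) 1"
  by (simp add: obnd_def)

lemma obnd_norm: "x \<in> K \<Longrightarrow> \<exists>C>0. \<forall>L e. obnd x L e \<longrightarrow> norm L \<le> C * e"
proof -
  assume x: "x \<in> K"
  obtain r where r: "r > 0" "\<And>v. bnd x v (norm v / r)" using bnd_ex[OF x] by auto
  obtain c where c: "c > 0" "\<And>v t. bnd x v t \<Longrightarrow> norm v \<le> c * t" using bnd_norm[OF x] by auto
  let ?n = "real CARD('m)"
  have "norm L \<le> (?n * (?n * (c / r))) * e" if "obnd x L e" for L e
  proof -
    have 1: "\<bar>L $ i $ j\<bar> \<le> (c / r) * e" for i j
    proof -
      have "\<bar>L $ i $ j\<bar> = \<bar>(L *v axis j 1) $ i\<bar>"
        by (simp add: matrix_vector_mult_basis column_def)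
      also have "\<dots> \<le> norm (L *v axis j 1)" by (rule component_le_norm_cart)
      also have "\<dots> \<le> c * (e * (1 / r))"
        using c(2)[OF obndD[OF that r(2)[of "axis j 1"]]] by (simp add: norm_axis_1)
      finally show ?thesis by simp
    qed
    have "norm L \<le> (\<Sum>i\<in>UNIV. norm (L $ i))" by (simp add: norm_vec_def L2_set_le_sum)
    also have "\<dots> \<le> (\<Sum>i\<in>(UNIV::'m set). ?n * ((c / r) * e))"
    proof (rule sum_mono)
      fix i
      have "norm (L $ i) \<le> (\<Sum>j\<in>UNIV. \<bar>L $ i $ j\<bar>)" by (rule norm_le_l1_cart)
      also have "\<dots> \<le> (\<Sum>j\<in>(UNIV::'m set). (c / r) * e)" using 1 by (intro sum_mono)
      finally show "norm (L $ i) \<le> ?n * ((c / r) * e)" by simp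
    qed
    finally show ?thesis by simp
  qed
  moreover have "?n * (?n * (c / r)) > 0" using c r by simp
  ultimately show ?thesis by blast
qed

lemma obnd_ball: "x \<in> K \<Longrightarrow> \<exists>s>0. \<forall>L. norm L < s \<longrightarrow> obnd x L 1"
proof -
  assume x: "x \<in> K"
  obtain r where r: "r > 0" "\<And>v. bnd x v (norm v / r)" using bnd_ex[OF x] by auto
  obtain c where c: "c > 0" "\<And>v t. bnd x v t \<Longrightarrow> norm v \<le> c * t" using bnd_norm[OF x] by auto
  let ?n = "real CARD('m)"
  define s where "s = r / (?n * ?n * c)"
  have s: "s > 0" using r c by (simp add: s_def)
  have "obnd x L 1" if L: "norm L < s" for L :: "real^'m^'m"
    unfolding obnd_def
  proof (intro allI impI)
    fix v t assume v: "bnd x v t"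
    have "\<bar>L $ i $ j\<bar> \<le> s" for i j
    proof -
      have "\<bar>L $ i $ j\<bar> \<le> norm (L $ i)" by (rule component_le_norm_cart)
      also have "\<dots> \<le> norm L" by (rule Finite_Cartesian_Product.norm_nth_le)
      finally show ?thesis using L by simp
    qed
    then have o: "onorm ((*v) L) \<le> ?n * ?n * s" by (rule onorm_le_matrix_component)
    have "norm (L *v v) \<le> onorm ((*v) L) * norm v" by (rule onorm) simp
    also have "\<dots> \<le> (?n * ?n * s) * (c * t)"
      using o c(2)[OF v] by (intro mult_mono) (use s in \<open>auto simp: onorm_pos_le\<close>)
    also have "\<dots> = r * t" using c by (simp add: s_def)
    finally have "norm (L *v v) / r \<le> t" using r by (simp add: field_simps)
    then show "bnd x (L *v v) (1 * t)" using bnd_mono[OF K_subset[OF x] r(2)] by simp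
  qed
  then show ?thesis using s by blast
qed

lemma near_K: "x \<in> K \<Longrightarrow> e > 0 \<Longrightarrow> \<exists>d>0. \<forall>y. dist y x < d \<longrightarrow> bnd x (y - x) e"
proof -
  assume x: "x \<in> K" and e: "e > 0"
  obtain r where r: "r > 0" "\<And>v. bnd x v (norm v / r)" using bnd_ex[OF x] by auto
  have "bnd x (y - x) e" if "dist y x < e * r" for y
    using that r by (intro bnd_mono[OF K_subset[OF x] r(2)]) (simp add: field_simps dist_norm)
  then show ?thesis using e r(1) by (intro exI[of _ "e * r"]) auto
qed

lemma bnd_near: "bnd x (y - x) e \<Longrightarrow> (1 + e) *\<^sub>R x - y \<in> Kc \<and> y - (1 - e) *\<^sub>R x \<in> Kc"
  by (simp add: bnd_def algebra_simps)

lemma near_K':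
  assumes "x \<in> K" "c > 1"
  shows "\<exists>d>0. \<forall>y. dist y x < d \<longrightarrow> c *\<^sub>R x - y \<in> Kc \<and> c *\<^sub>R y - x \<in> Kc"
proof -
  \<comment> \<open>With this \<open>e\<close>, the estimate \<open>y >= (1 - e) x\<close> reads
    exactly \<open>c y >= x\<close>, while \<open>1 + e <= c\<close> amounts to
    \<open>c + 1/c >= 2\<close>.\<close>
  define e where "e = 1 - 1 / c"
  have e: "e > 0" "e < 1" "1 + e \<le> c" unfolding e_def
  proof -
    have "0 \<le> (c - 1) * (c - 1) / c" using assms(2) by simp
    also have "\<dots> = c - 2 + 1 / c" using assms(2) by (simp add: field_simps)
    finally show "1 + (1 - 1 / c) \<le> c" by simp
  qed (use assms(2) in auto)
  obtain d where d: "d > 0" "\<And>y. dist y x < d \<Longrightarrow> bnd x (y - x) e"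
    using near_K[OF assms(1) e(1)] by auto
  have "c *\<^sub>R x - y \<in> Kc \<and> c *\<^sub>R y - x \<in> Kc" if y: "dist y x < d" for y
  proof
    have 1: "(1 + e) *\<^sub>R x - y \<in> Kc" "y - (1 - e) *\<^sub>R x \<in> Kc"
      using bnd_near[OF d(2)[OF y]] by auto
    have "(c - (1 + e)) *\<^sub>R x + ((1 + e) *\<^sub>R x - y) \<in> Kc"
      using 1 e assms K_subset by (intro P_add P_scale) auto
    then show "c *\<^sub>R x - y \<in> Kc" by (simp add: algebra_simps)
    have "c *\<^sub>R (y - (1 - e) *\<^sub>R x) \<in> Kc" using 1 assms by (intro P_scale) auto
    then show "c *\<^sub>R y - x \<in> Kc" using assms by (simp add: e_def scaleR_diff_right)
  qed
  then show ?thesis using d(1) by blast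
qed

end

section \<open>Discrete groups of automorphisms of a cone\<close>

definition matpow :: "real^'m::finite^'m \<Rightarrow> nat \<Rightarrow> real^'m^'m"
  where "matpow M k = (((**) M) ^^ k) (mat 1)"

lemma matpow_0 [simp]: "matpow M 0 = mat 1"
  by (simp add: matpow_def)

lemma matpow_Suc [simp]: "matpow M (Suc k) = M ** matpow M k"
  by (simp add: matpow_def)

lemma matpow_add: "matpow M (i + j) = matpow M i ** matpow M j"
  by (induction i) (simp_all add: matrix_mul_assoc)

text \<open>\<open>det_G\<close> removes the positive scalar ambiguity of a lift.
  \<open>cocompact\<close> remains up to positive scalars, since the compact quotient is that of the
  projectivised cone. \<open>dim\<close> leaves room for a boundary ray outside the plane of two
  given ones.\<close>

locale divisible_cone = strictly_convex_cone K for K :: "(real^'m::finite) set" +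
  fixes G :: "(real^'m^'m) set"
  assumes one_G: "mat 1 \<in> G"
    and mult_G: "M \<in> G \<Longrightarrow> N \<in> G \<Longrightarrow> M ** N \<in> G"
    and inv_G: "M \<in> G \<Longrightarrow> \<exists>N\<in>G. M ** N = mat 1 \<and> N ** M = mat 1"
    and pres_K: "M \<in> G \<Longrightarrow> x \<in> K \<Longrightarrow> M *v x \<in> K"
    and det_G: "M \<in> G \<Longrightarrow> \<bar>det M\<bar> = 1"
    and discrete: "\<exists>e>0. \<forall>M\<in>G. norm (M - mat 1) < e \<longrightarrow> M = mat 1"
    and torsion_free: "M \<in> G \<Longrightarrow> k > 0 \<Longrightarrow> matpow M k = mat 1 \<Longrightarrow> M = mat 1"
    and cocompact: "\<exists>D. compact D \<and> D \<subseteq> K \<and> (\<forall>x\<in>K. \<exists>N\<in>G. \<exists>t>0. t *\<^sub>R (N *v x) \<in> D)"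
    and dim: "CARD('m) \<ge> 3"
begin

lemma matpow_G: "M \<in> G \<Longrightarrow> matpow M k \<in> G"
  by (induction k) (auto intro: one_G mult_G)

lemma pres_P:
  assumes "M \<in> G" "x \<in> Kc"
  shows "M *v x \<in> Kc"
proof -
  obtain f where f: "\<And>n. f n \<in> K" "f \<longlonglongrightarrow> x" using assms by (auto simp: closure_sequential)
  have 1: "(\<lambda>n. M *v f n) \<longlonglongrightarrow> M *v x"
    by (rule isCont_tendsto_compose[OF _ f(2)]) (simp add: linear_continuous_at linear_conv_bounded_linear[symmetric])
  have 2: "M *v f n \<in> Kc" for n using f assms pres_K K_subset by blast
  show ?thesis by (rule closed_sequentially[OF closed_closure 2 1])
qed

lemma bnd_G:
  assumes "N \<in> G" "bnd x v t"
  shows "bnd (N *v x) (N *v v) t"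
proof -
  have "N *v (t *\<^sub>R x - v) \<in> Kc" "N *v (t *\<^sub>R x + v) \<in> Kc"
    using assms by (auto simp: bnd_def intro: pres_P)
  then show ?thesis
    by (simp add: bnd_def mv_simps)
qed

lemma obnd_conj:
  assumes "N \<in> G" "N' \<in> G" "N' ** N = mat 1" "obnd x L e"
  shows "obnd (N *v x) (N ** L ** N') e"
  unfolding obnd_def
proof (intro allI impI)
  fix v t assume "bnd (N *v x) v t"
  from bnd_G[OF assms(2) this] have "bnd x (N' *v v) t"
    by (simp add: matrix_vector_mul_assoc assms(3))
  from bnd_G[OF assms(1) obndD[OF assms(4) this]] show "bnd (N *v x) (N ** L ** N' *v v) (e * t)"
    by (simp add: matrix_vector_mul_assoc matrix_mul_assoc)
qed

text \<open>\<open>M\<close> carries the norm of \<open>x\<close> isometrically to that of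
  \<open>M x\<close>, and \<open>M x <= b x\<close> compares the two norms. So the displacement of a
  single point bounds an operator norm.\<close>

lemma obnd_disp:
  assumes "M \<in> G" "x \<in> K" "b *\<^sub>R x - M *v x \<in> Kc"
  shows "obnd x M b"
  unfolding obnd_def
proof (intro allI impI)
  fix v t assume v: "bnd x v t"
  show "bnd x (M *v v) (b * t)"
    by (rule bnd_base[OF bnd_G[OF assms(1) v] bnd_nonneg[OF assms(2) v] assms(3)])
qed

lemma unit_compact: "x \<in> K \<Longrightarrow> compact {v. bnd x v 1}"
proof -
  assume x: "x \<in> K"
  obtain c where c: "c > 0" "\<And>v t. bnd x v t \<Longrightarrow> norm v \<le> c * t" using bnd_norm[OF x] by auto
  have "closed ((\<lambda>v. x - v) -` Kc \<inter> (\<lambda>v. x + v) -` Kc)"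
    by (intro closed_Int continuous_closed_vimage) (auto intro!: continuous_intros)
  moreover have "{v. bnd x v 1} = (\<lambda>v. x - v) -` Kc \<inter> (\<lambda>v. x + v) -` Kc"
    by (auto simp: bnd_def)
  moreover have "bounded {v. bnd x v 1}"
    using c(2)[of _ 1] by (intro boundedI[of _ c]) auto
  ultimately show ?thesis by (simp add: compact_eq_bounded_closed)
qed

lemma unit_measure_pos: "x \<in> K \<Longrightarrow> measure lebesgue {v. bnd x v 1} > 0"
proof -
  assume x: "x \<in> K"
  obtain r where r: "r > 0" "\<And>v. bnd x v (norm v / r)" using bnd_ex[OF x] by auto
  have "ball 0 r \<subseteq> {v. bnd x v 1}"
    using r by (auto intro!: bnd_mono[OF K_subset[OF x] r(2)])
  then show ?thesis
    using r(1) unit_compact[OF x] by (intro measure_pos_interior[where a = 0 and r = r]) (auto simp: lmeasurable_compact)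
qed

text \<open>\<open>M\<close> preserves volume, hence cannot map the unit ball of \<open>x\<close> to a set containing a dilate of it.\<close>

lemma disp_lower_le_1:
  assumes M: "M \<in> G" and x: "x \<in> K" and a: "M *v x - a *\<^sub>R x \<in> Kc"
  shows "a \<le> 1"
proof (rule ccontr)
  assume "\<not> a \<le> 1"
  then have a1: "a > 1" by simp
  obtain N where N: "N \<in> G" "M ** N = mat 1" "N ** M = mat 1" using inv_G[OF M] by auto
  let ?B = "{v. bnd x v 1}"
  have sub: "(*\<^sub>R) a ` ?B \<subseteq> (*v) M ` ?B"
  proof
    fix z assume "z \<in> (*\<^sub>R) a ` ?B"
    then obtain v where v: "bnd x v 1" "z = a *\<^sub>R v" by auto
    have "bnd x z a" using bnd_scale[OF v(1), of a] v(2) a1 by simp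
    moreover have "(1/a) *\<^sub>R (M *v x) - x \<in> Kc"
      using P_scale[OF a, of "1/a"] a1 by (simp add: scaleR_diff_right)
    ultimately have "bnd (M *v x) z (1 / a * a)" using a1 by (intro bnd_base[of x]) auto
    then have "bnd (M *v x) z 1" using a1 by simp
    from bnd_G[OF N(1) this] have "bnd x (N *v z) 1" by (simp add: matrix_vector_mul_assoc N)
    moreover have "z = M *v (N *v z)" by (simp add: matrix_vector_mul_assoc N)
    ultimately show "z \<in> (*v) M ` ?B" by blast
  qed
  have c: "compact ((*\<^sub>R) a ` ?B)" "compact ((*v) M ` ?B)"
    using unit_compact[OF x]
    by (auto intro!: compact_continuous_image continuous_intros matrix_vector_mult_linear_continuous_on)
  have "\<bar>a\<bar> ^ DIM(real^'m) * measure lebesgue ?B = measure lebesgue ((*\<^sub>R) a ` ?B)"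
    by (simp only: measure_scaleR_image)
  also have "\<dots> \<le> measure lebesgue ((*v) M ` ?B)"
    using c sub by (intro measure_mono_fmeasurable) (auto simp: lmeasurable_compact fmeasurableD)
  also have "\<dots> = measure lebesgue ?B"
    using measure_linear_image_compact[OF unit_compact[OF x], of M] det_G[OF M] by simp
  finally have "\<bar>a\<bar> ^ DIM(real^'m) \<le> 1" using unit_measure_pos[OF x] by simp
  moreover have "1 < \<bar>a\<bar> ^ DIM(real^'m)" using a1 by (intro one_less_power) auto
  ultimately show False by linarith
qed

lemma disp_pos:
  assumes M: "M \<in> G" and x: "x \<in> K" and b: "b *\<^sub>R x - M *v x \<in> Kc"
  shows "b > 0"
proof (rule ccontr)
  assume "\<not> b > 0"
  have "M *v x + (- b) *\<^sub>R x \<in> K"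
    using \<open>\<not> b > 0\<close> by (intro KP_add pres_K P_scale M x K_subset) auto
  then have "M *v x - b *\<^sub>R x \<in> K" by simp
  moreover have "- (M *v x - b *\<^sub>R x) \<in> Kc" using b by simp
  ultimately show False using P_pointed K_subset zero_notin_K by metis
qed

lemma disp_inv:
  assumes N: "N \<in> G" "N ** M = mat 1" and b: "b *\<^sub>R x - M *v x \<in> Kc" "b > 0"
  shows "N *v x - (1 / b) *\<^sub>R x \<in> Kc"
proof -
  have "N *v (b *\<^sub>R x - M *v x) \<in> Kc" by (rule pres_P[OF N(1) b(1)])
  then have "b *\<^sub>R (N *v x) - x \<in> Kc"
    by (simp add: mv_simps matrix_vector_mul_assoc N)
  then have "(1/b) *\<^sub>R (b *\<^sub>R (N *v x) - x) \<in> Kc" by (rule P_scale) (use b in simp)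
  then show ?thesis using b(2) by (simp add: scaleR_diff_right)
qed

lemma disp_inv':
  assumes N: "N \<in> G" "N ** M = mat 1" and b: "M *v x - a *\<^sub>R x \<in> Kc" "a > 0"
  shows "(1 / a) *\<^sub>R x - N *v x \<in> Kc"
proof -
  have "N *v (M *v x - a *\<^sub>R x) \<in> Kc" by (rule pres_P[OF N(1) b(1)])
  then have "x - a *\<^sub>R (N *v x) \<in> Kc"
    by (simp add: mv_simps matrix_vector_mul_assoc N)
  then have "(1/a) *\<^sub>R (x - a *\<^sub>R (N *v x)) \<in> Kc" by (rule P_scale) (use b in simp)
  then show ?thesis using b(2) by (simp add: scaleR_diff_right)
qed

lemma disp_upper_ge_1:
  assumes M: "M \<in> G" and x: "x \<in> K" and b: "b *\<^sub>R x - M *v x \<in> Kc"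
  shows "b \<ge> 1"
proof -
  obtain N where N: "N \<in> G" "M ** N = mat 1" "N ** M = mat 1" using inv_G[OF M] by auto
  have "b > 0" by (rule disp_pos[OF M x b])
  have "1 / b \<le> 1" by (rule disp_lower_le_1[OF N(1) x disp_inv[OF N(1,3) b \<open>b > 0\<close>]])
  then show ?thesis using \<open>b > 0\<close> by (simp add: field_simps)
qed

section \<open>Packing of operators and proper discontinuity\<close>

definition unit_op :: "real^'m \<Rightarrow> (real^'m^'m) set"
  where "unit_op x = {L. obnd x L 1}"

lemma mem_scale_unit_op:
  assumes "s > 0"
  shows "L \<in> (*\<^sub>R) s ` unit_op x \<longleftrightarrow> obnd x L s"
proof
  assume "L \<in> (*\<^sub>R) s ` unit_op x"
  then show "obnd x L s" using obnd_scale[of x _ 1 s] assms by (auto simp: unit_op_def)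
next
  assume "obnd x L s"
  then have "obnd x ((1/s) *\<^sub>R L) (\<bar>1/s\<bar> * s)" by (rule obnd_scale)
  then have "(1/s) *\<^sub>R L \<in> unit_op x" using assms by (simp add: unit_op_def)
  then show "L \<in> (*\<^sub>R) s ` unit_op x" using assms by (intro image_eqI[of _ _ "(1/s) *\<^sub>R L"]) auto
qed

text \<open>The unit ball of the operator norm at \<open>x\<close> is a symmetric convex body in the
  space of matrices, so \<open>card_separated_le\<close> gives a bound that involves neither
  \<open>x\<close> nor the cone.\<close>

lemma card_obnd_separated:
  assumes x: "x \<in> K" and T: "finite T" "\<And>L. L \<in> T \<Longrightarrow> obnd x L R" "R > 0" "s > 0"
    and sep: "\<And>L M. L \<in> T \<Longrightarrow> M \<in> T \<Longrightarrow> L \<noteq> M \<Longrightarrow> \<not> obnd x (L - M) s"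
  shows "real (card T) \<le> (1 + 2 * R / s) ^ DIM(real^'m^'m)"
proof -
  obtain C where C: "C > 0" "\<And>L e. obnd x L e \<Longrightarrow> norm L \<le> C * e" using obnd_norm[OF x] by auto
  obtain r where r: "r > 0" "\<And>L. norm L < r \<Longrightarrow> obnd x L 1" using obnd_ball[OF x] by auto
  show ?thesis
  proof (rule card_separated_le[where B = "unit_op x" and r = r])
    show "convex (unit_op x)"
    proof (rule convexI)
      fix L M and u v :: real assume "L \<in> unit_op x" "M \<in> unit_op x" "0 \<le> u" "0 \<le> v" "u + v = 1"
      then show "u *\<^sub>R L + v *\<^sub>R M \<in> unit_op x"
        using obnd_add[OF obnd_scale[of x L 1 u] obnd_scale[of x M 1 v]] by (simp add: unit_op_def)
    qed
    show "bounded (unit_op x)" using C(2)[of _ 1] by (intro boundedI[of _ C]) (auto simp: unit_op_def)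
    show "ball 0 r \<subseteq> unit_op x" using r(2) by (auto simp: unit_op_def)
    show "- v \<in> unit_op x" if "v \<in> unit_op x" for v using that by (simp add: unit_op_def obnd_minus)
    show "T \<subseteq> (*\<^sub>R) R ` unit_op x" using T mem_scale_unit_op by blast
    show "t - t' \<notin> (*\<^sub>R) s ` unit_op x" if "t \<in> T" "t' \<in> T" "t \<noteq> t'" for t t'
      using sep[OF that] mem_scale_unit_op[OF T(4)] by blast
  qed (use T r in auto)
qed

lemma discrete_obnd: "x \<in> K \<Longrightarrow> \<exists>e>0. \<forall>M\<in>G. obnd x (M - mat 1) e \<longrightarrow> M = mat 1"
proof -
  assume x: "x \<in> K"
  obtain C where C: "C > 0" "\<And>L e. obnd x L e \<Longrightarrow> norm L \<le> C * e" using obnd_norm[OF x] by auto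
  obtain e where e: "e > 0" "\<And>M. M \<in> G \<Longrightarrow> norm (M - mat 1) < e \<Longrightarrow> M = mat 1" using discrete by auto
  have "M = mat 1" if "M \<in> G" "obnd x (M - mat 1) (e / (2 * C))" for M
  proof (rule e(2)[OF that(1)])
    have "norm (M - mat 1) \<le> C * (e / (2 * C))" by (rule C(2)[OF that(2)])
    also have "\<dots> < e" using C(1) e(1) by simp
    finally show "norm (M - mat 1) < e" .
  qed
  moreover have "e / (2 * C) > 0" using C(1) e(1) by simp
  ultimately show ?thesis by blast
qed

lemma mat_mult_diff: "(A::real^'m^'m) ** (B - C) = A ** B - A ** C"
  by (simp add: matrix_eq matrix_vector_mul_assoc[symmetric] matrix_vector_mult_diff_distrib matrix_vector_mult_diff_rdistrib)

lemma mat_diff_mult: "((B::real^'m^'m) - C) ** A = B ** A - C ** A"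
  by (simp add: matrix_eq matrix_vector_mul_assoc[symmetric] matrix_vector_mult_diff_distrib matrix_vector_mult_diff_rdistrib)

text \<open>Proper discontinuity. If \<open>L\<close> and \<open>M\<close> in this set were close in
  operator norm, then \<open>N L\<close>, with \<open>N\<close> the inverse of \<open>M\<close>,
  would be close to the identity and hence equal to it. So the set is separated as well as
  bounded.\<close>

lemma finite_bounded_disp:
  assumes x: "x \<in> K" and c: "c > 0"
  shows "finite {M\<in>G. c *\<^sub>R x - M *v x \<in> Kc \<and>
    (\<exists>N\<in>G. M ** N = mat 1 \<and> N ** M = mat 1 \<and> c *\<^sub>R x - N *v x \<in> Kc)}" (is "finite ?F")
proof -
  obtain e where e: "e > 0" "\<And>M. M \<in> G \<Longrightarrow> obnd x (M - mat 1) e \<Longrightarrow> M = mat 1"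
    using discrete_obnd[OF x] by auto
  \<comment> \<open>Left multiplication by the inverse \<open>N\<close>, of operator norm at most
    \<open>c\<close>, enlarges \<open>s\<close> to \<open>e\<close>.\<close>
  define s where "s = e / c"
  have s: "s > 0" using e c by (simp add: s_def)
  define C where "C = nat \<lfloor>(1 + 2 * c / s) ^ DIM(real^'m^'m)\<rfloor>"
  have "card T \<le> C" if T: "T \<subseteq> ?F" "finite T" for T
  proof -
    have "real (card T) \<le> (1 + 2 * c / s) ^ DIM(real^'m^'m)"
    proof (rule card_obnd_separated[OF x T(2) _ c s])
      show "obnd x L c" if "L \<in> T" for L using T(1) that x by (intro obnd_disp) auto
      fix L M assume LM: "L \<in> T" "M \<in> T" "L \<noteq> M"
      then have G: "L \<in> G" "M \<in> G" using T(1) by auto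
      obtain N where N: "N \<in> G" "M ** N = mat 1" "N ** M = mat 1" "c *\<^sub>R x - N *v x \<in> Kc"
        using LM T(1) by auto
      show "\<not> obnd x (L - M) s"
      proof
        assume "obnd x (L - M) s"
        then have "obnd x (N ** (L - M)) (c * s)"
          by (rule obnd_mult[OF obnd_disp[OF N(1) x N(4)]])
        then have "obnd x (N ** L - mat 1) e" using c by (simp add: s_def mat_mult_diff N)
        then have "N ** L = mat 1" using e(2) N G mult_G by blast
        then have "M ** (N ** L) = M" by simp
        then show False using LM(3) by (simp add: matrix_mul_assoc N)
      qed
    qed
    then show ?thesis unfolding C_def by linarith
  qed
  then show ?thesis using finite_if_finite_subsets_card_bdd[of ?F C] by blast
qed

text \<open>The volume argument makes the eigenvalue 1, so all powers of \<open>M\<close> fix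
  \<open>x\<close>; by \<open>finite_bounded_disp\<close> two of them coincide, and there is no
  torsion.\<close>

lemma fixed_imp_one:
  assumes M: "M \<in> G" and x: "x \<in> K" and fx: "M *v x = c *\<^sub>R x"
  shows "M = mat 1"
proof -
  have "c \<le> 1" by (rule disp_lower_le_1[OF M x]) (simp add: fx P_zero)
  moreover have "c \<ge> 1" by (rule disp_upper_ge_1[OF M x]) (simp add: fx P_zero)
  ultimately have fx: "M *v x = x" using fx by simp
  have fk: "matpow M k *v x = x" for k
    by (induction k) (simp_all add: matrix_vector_mul_assoc[symmetric] fx)
  have "range (matpow M) \<subseteq> {M\<in>G. 1 *\<^sub>R x - M *v x \<in> Kc \<and>
    (\<exists>N\<in>G. M ** N = mat 1 \<and> N ** M = mat 1 \<and> 1 *\<^sub>R x - N *v x \<in> Kc)}"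
  proof (clarify, intro conjI)
    fix k
    show "matpow M k \<in> G" using M by (rule matpow_G)
    show "1 *\<^sub>R x - matpow M k *v x \<in> Kc" by (simp add: fk P_zero)
    obtain N where N: "N \<in> G" "matpow M k ** N = mat 1" "N ** matpow M k = mat 1"
      using inv_G[OF matpow_G[OF M]] by blast
    have "N *v x = N *v (matpow M k *v x)" by (simp only: fk)
    also have "\<dots> = x" by (simp add: matrix_vector_mul_assoc N)
    finally show "\<exists>N\<in>G. matpow M k ** N = mat 1 \<and> N ** matpow M k = mat 1 \<and> 1 *\<^sub>R x - N *v x \<in> Kc"
      using N by (intro bexI[of _ N]) (auto simp: P_zero)
  qed
  then have "finite (range (matpow M))" by (rule finite_subset) (rule finite_bounded_disp[OF x], simp)
  then have "\<not> inj (matpow M)" using finite_imageD by blast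
  then obtain i j where "i \<noteq> j" "matpow M i = matpow M j" by (auto simp: inj_def)
  then obtain i j where ij: "i < j" "matpow M i = matpow M j" by (metis linorder_neqE_nat)
  obtain N where N: "N \<in> G" "matpow M i ** N = mat 1" "N ** matpow M i = mat 1"
    using inv_G[OF matpow_G[OF M]] by blast
  have "matpow M j = matpow M i ** matpow M (j - i)"
    using ij(1) matpow_add[of M i "j - i"] by simp
  then have "matpow M i = matpow M i ** matpow M (j - i)" by (simp only: ij(2))
  then have "N ** matpow M i = N ** (matpow M i ** matpow M (j - i))" by (rule arg_cong)
  then have "matpow M (j - i) = mat 1" by (simp add: matrix_mul_assoc N)
  then show ?thesis using torsion_free[OF M, of "j - i"] ij by simp
qed

lemma order_unit: "x \<in> K \<Longrightarrow> \<exists>c>0. c *\<^sub>R x - v \<in> Kc"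
proof -
  assume x: "x \<in> K"
  obtain r where r: "r > 0" "\<And>v. bnd x v (norm v / r)" using bnd_ex[OF x] by auto
  have "bnd x v (norm v / r + 1)" by (rule bnd_mono[OF K_subset[OF x] r(2)]) simp
  then show ?thesis using r(1) by (intro exI[of _ "norm v / r + 1"]) (auto simp: bnd_def add_nonneg_pos)
qed

end

section \<open>Minimal displacement and eigenvectors\<close>

text \<open>The identity behind \<open>chain\<close> in \<open>min_displacement\<close>, where
  \<open>a = L z\<close> and \<open>b = L y0\<close>.\<close>

lemma scaleR_combination:
  fixes a b y z :: "'a::real_vector"
  shows "(2 *\<^sub>R a - b) + 2 *\<^sub>R (u *\<^sub>R z - a) + (2 * u) *\<^sub>R (2 *\<^sub>R y - z) + (c - 4 * u) *\<^sub>R y = c *\<^sub>R y - b"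
  by (simp add: scaleR_diff_right scaleR_diff_left)

context divisible_cone
begin

lemma eigen_pos:
  assumes M: "M \<in> G" and p: "p \<in> Kc" "p \<noteq> 0" "M *v p = l *\<^sub>R p"
  shows "l > 0"
proof (rule ccontr)
  assume "\<not> l > 0"
  obtain N where N: "N \<in> G" "N ** M = mat 1" using inv_G[OF M] by auto
  have "M *v p \<noteq> 0"
  proof
    assume "M *v p = 0"
    moreover have "N *v (M *v p) = p" by (simp add: matrix_vector_mul_assoc N)
    ultimately show False using p(2) by simp
  qed
  moreover have "- (M *v p) \<in> Kc"
    using P_scale[OF p(1), of "- l"] \<open>\<not> l > 0\<close> p(3) by simp
  ultimately show False using P_pointed pres_P[OF M p(1)] by blast
qed

text \<open>For optimal \<open>a\<close> and \<open>r\<close>, \<open>log r / 2\<close> is the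
  Hilbert distance from \<open>x\<close> to \<open>M x\<close>. A minimising sequence may leave
  every compact set; cocompactness moves it back into \<open>D\<close> at the price of conjugating
  \<open>M\<close>. These conjugates have bounded displacement near a limit point, so one of them
  recurs, and the infimum is attained for it and hence for \<open>M\<close>.\<close>

lemma min_displacement:
  assumes M: "M \<in> G"
  defines "R \<equiv> {r. \<exists>x\<in>K. \<exists>a>0. M *v x - a *\<^sub>R x \<in> Kc \<and> (r * a) *\<^sub>R x - M *v x \<in> Kc}"
  shows "\<exists>r\<in>R. \<forall>r'\<in>R. r \<le> r'"
proof -
  have R1: "r \<ge> 1" if "r \<in> R" for r
  proof -
    obtain x a where xa: "x \<in> K" "a > 0" "M *v x - a *\<^sub>R x \<in> Kc" "(r * a) *\<^sub>R x - M *v x \<in> Kc"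
      using \<open>r \<in> R\<close> by (auto simp: R_def)
    have "a \<le> 1" "r * a \<ge> 1"
      using disp_lower_le_1[OF M xa(1,3)] disp_upper_ge_1[OF M xa(1,4)] by auto
    show ?thesis
    proof (rule ccontr)
      assume "\<not> r \<ge> 1"
      then have "r * a < 1 * a" using xa(2) by (intro mult_strict_right_mono) auto
      then show False using \<open>a \<le> 1\<close> \<open>r * a \<ge> 1\<close> by simp
    qed
  qed
  have "R \<noteq> {}"
  proof -
    obtain x where x: "x \<in> K" using nonempty_K by auto
    obtain b where b: "b > 0" "b *\<^sub>R x - M *v x \<in> Kc" using order_unit[OF x] by auto
    obtain c where c: "c > 0" "c *\<^sub>R (M *v x) - x \<in> Kc" using order_unit[OF pres_K[OF M x]] by auto
    have "(1/c) *\<^sub>R (c *\<^sub>R (M *v x) - x) \<in> Kc" by (rule P_scale[OF c(2)]) (use c in simp)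
    then have "M *v x - (1/c) *\<^sub>R x \<in> Kc" using c by (simp add: scaleR_diff_right)
    then have "b * c \<in> R" using b c x unfolding R_def by (intro CollectI bexI[of _ x] exI[of _ "1/c"]) auto
    then show ?thesis by auto
  qed
  have bdd: "bdd_below R" using R1 by (intro bdd_belowI[of _ 1])
  define r0 where "r0 = Inf R"
  have r01: "r0 \<ge> 1" unfolding r0_def using \<open>R \<noteq> {}\<close> R1 by (intro cInf_greatest)
  obtain D where D: "compact D" "D \<subseteq> K" "\<And>x. x \<in> K \<Longrightarrow> \<exists>N\<in>G. \<exists>t>0. t *\<^sub>R (N *v x) \<in> D"
    using cocompact by blast
  \<comment> \<open>The interval keeps \<open>a\<close> away from 0 in the limit:
    \<open>1 <= r a\<close> and \<open>r <= r0 + 1\<close> give the lower end, the volume argument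
    the upper one.\<close>
  define Q where "Q k y a N N' \<longleftrightarrow> y \<in> D \<and> a \<in> {1/(r0+1)..1} \<and> N \<in> G \<and> N' \<in> G \<and> N ** N' = mat 1 \<and> N' ** N = mat 1 \<and>
      N ** M ** N' *v y - a *\<^sub>R y \<in> Kc \<and>
      ((r0 + inverse (real (Suc k))) * a) *\<^sub>R y - N ** M ** N' *v y \<in> Kc" for k y a N N'
  have "\<exists>y a N N'. Q k y a N N'" for k
  proof -
    have "r0 < r0 + inverse (real (Suc k))" by simp
    then obtain r where r: "r \<in> R" "r < r0 + inverse (real (Suc k))"
      unfolding r0_def using \<open>R \<noteq> {}\<close> bdd by (metis cInf_less_iff)
    obtain x a where xa: "x \<in> K" "a > 0" "M *v x - a *\<^sub>R x \<in> Kc" "(r * a) *\<^sub>R x - M *v x \<in> Kc"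
      using r(1) by (auto simp: R_def)
    obtain N t where N: "N \<in> G" "t > 0" "t *\<^sub>R (N *v x) \<in> D" using D(3)[OF xa(1)] by auto
    obtain N' where N': "N' \<in> G" "N ** N' = mat 1" "N' ** N = mat 1" using inv_G[OF N(1)] by auto
    let ?y = "t *\<^sub>R (N *v x)"
    have My: "N ** M ** N' *v ?y = t *\<^sub>R (N *v (M *v x))"
    proof -
      have "N ** M ** N' *v ?y = t *\<^sub>R (N *v (M *v ((N' ** N) *v x)))"
        by (simp add: matrix_vector_mul_assoc matrix_vector_mult_scaleR matrix_mul_assoc)
      then show ?thesis by (simp add: N')
    qed
    have a1: "a \<le> 1" by (rule disp_lower_le_1[OF M xa(1,3)])
    have "inverse (real (Suc k)) \<le> 1" by (simp add: field_simps)
    then have "r \<le> r0 + 1" using r by linarith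
    have "1 \<le> r * a" by (rule disp_upper_ge_1[OF M xa(1,4)])
    also have "\<dots> \<le> (r0 + 1) * a" using \<open>r \<le> r0 + 1\<close> xa by (intro mult_right_mono) auto
    finally have a2: "1/(r0+1) \<le> a" using r01 by (simp add: field_simps)
    have "t *\<^sub>R (N *v (M *v x - a *\<^sub>R x)) \<in> Kc"
      using N xa by (intro P_scale pres_P) auto
    then have 1: "N ** M ** N' *v ?y - a *\<^sub>R ?y \<in> Kc"
      unfolding My by (simp add: mv_simps scaleR_diff_right mult.commute)
    let ?s = "r0 + inverse (real (Suc k))"
    have "(?s * a - r * a) *\<^sub>R x + ((r * a) *\<^sub>R x - M *v x) \<in> Kc"
      using xa(2) r(2) by (intro P_add[OF P_scale[OF K_subset[OF xa(1)]] xa(4)]) (auto intro!: mult_right_mono)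
    then have "(?s * a) *\<^sub>R x - M *v x \<in> Kc" by (simp add: scaleR_diff_left)
    then have "t *\<^sub>R (N *v ((?s * a) *\<^sub>R x - M *v x)) \<in> Kc"
      using N by (intro P_scale pres_P) auto
    then have 2: "(?s * a) *\<^sub>R ?y - N ** M ** N' *v ?y \<in> Kc"
      unfolding My
      by (simp only: mv_simps scaleR_diff_right scaleR_scaleR mult.commute)
    show ?thesis
      unfolding Q_def using N N' a1 a2 1 2 by (intro exI[of _ ?y] exI[of _ a] exI[of _ N] exI[of _ N']) auto
  qed
  then obtain y a N N' where Q: "\<And>k. Q k (y k) (a k) (N k) (N' k)" by metis
  have seq: "\<And>k. y k \<in> D" "\<And>k. a k \<in> {1/(r0+1)..1}"
      "\<And>k. N k \<in> G" "\<And>k. N' k \<in> G" "\<And>k. N k ** N' k = mat 1" "\<And>k. N' k ** N k = mat 1"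
      "\<And>k. N k ** M ** N' k *v y k - a k *\<^sub>R y k \<in> Kc"
      "\<And>k. ((r0 + inverse (real (Suc k))) * a k) *\<^sub>R y k - N k ** M ** N' k *v y k \<in> Kc"
    by (use Q in \<open>simp_all only: Q_def\<close>)
  have "compact (D \<times> {1/(r0+1)..1})" by (intro compact_Times D) auto
  then have "seq_compact (D \<times> {1/(r0+1)..1})" by (rule compact_imp_seq_compact)
  moreover have "\<forall>k. (y k, a k) \<in> D \<times> {1/(r0+1)..1}" using seq(1,2) by simp
  ultimately obtain l f where "l \<in> D \<times> {1/(r0+1)..1}" "strict_mono f" "((\<lambda>k. (y k, a k)) \<circ> f) \<longlonglongrightarrow> l"
    by (rule seq_compactE)
  then obtain y0 a0 where f: "y0 \<in> D" "a0 \<in> {1/(r0+1)..1}" "strict_mono f"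
      "((\<lambda>k. (y k, a k)) \<circ> f) \<longlonglongrightarrow> (y0, a0)" by auto
  have yl: "(\<lambda>k. y (f k)) \<longlonglongrightarrow> y0" and al: "(\<lambda>k. a (f k)) \<longlonglongrightarrow> a0"
    using tendsto_fst[OF f(4)] tendsto_snd[OF f(4)] by (simp_all add: o_def)
  have y0: "y0 \<in> K" using f D by auto
  obtain M' where M': "M ** M' = mat 1" "M' ** M = mat 1" "M' \<in> G" using inv_G[OF M] by auto
  obtain d where d: "d > 0" "\<And>y. dist y y0 < d \<Longrightarrow> 2 *\<^sub>R y0 - y \<in> Kc \<and> 2 *\<^sub>R y - y0 \<in> Kc"
    using near_K'[OF y0, of 2] by auto
  have ev: "eventually (\<lambda>k. dist (y (f k)) y0 < d) sequentially"
    using yl d(1) by (rule tendstoD)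
  \<comment> \<open>Points near \<open>y0\<close> are comparable with it up to a factor 2. Passing
    from the displacement at such a point to that at \<open>y0\<close> uses this twice, hence the
    4.\<close>
  define c where "c = 4 * (r0 + 1)"
  let ?F = "{M\<in>G. c *\<^sub>R y0 - M *v y0 \<in> Kc \<and>
    (\<exists>N\<in>G. M ** N = mat 1 \<and> N ** M = mat 1 \<and> c *\<^sub>R y0 - N *v y0 \<in> Kc)}"
  have finF: "finite ?F" using r01 by (intro finite_bounded_disp[OF y0]) (simp add: c_def)
  have chain: "c *\<^sub>R y0 - L *v y0 \<in> Kc"
    if L: "L \<in> G" "u *\<^sub>R z - L *v z \<in> Kc" "u \<le> r0 + 1" "u \<ge> 0" "dist z y0 < d" for L u z
  proof -
    have z: "2 *\<^sub>R y0 - z \<in> Kc" "2 *\<^sub>R z - y0 \<in> Kc" using d(2) L by auto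
    have "L *v (2 *\<^sub>R z - y0) + 2 *\<^sub>R (u *\<^sub>R z - L *v z) + (2 * u) *\<^sub>R (2 *\<^sub>R y0 - z) + (c - 4 * u) *\<^sub>R y0 \<in> Kc"
      using z L K_subset[OF y0] by (intro P_add P_scale pres_P) (auto simp: c_def)
    moreover have "L *v (2 *\<^sub>R z - y0) + 2 *\<^sub>R (u *\<^sub>R z - L *v z) + (2 * u) *\<^sub>R (2 *\<^sub>R y0 - z) + (c - 4 * u) *\<^sub>R y0
        = c *\<^sub>R y0 - L *v y0"
      by (simp only: mv_simps scaleR_combination)
    ultimately show ?thesis by simp
  qed
  have inF: "N k ** M ** N' k \<in> ?F" if k: "dist (y k) y0 < d" for k
  proof -
    have 1: "N k ** M ** N' k \<in> G" "N k ** M' ** N' k \<in> G" by (intro mult_G seq M M')+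
    have inv: "(N k ** M ** N' k) ** (N k ** M' ** N' k) = mat 1" "(N k ** M' ** N' k) ** (N k ** M ** N' k) = mat 1"
    proof -
      have "(N k ** M ** N' k) ** (N k ** M' ** N' k) = N k ** M ** (N' k ** N k) ** M' ** N' k"
        by (simp only: matrix_mul_assoc)
      also have "\<dots> = N k ** (M ** M') ** N' k" by (simp only: seq(6) matrix_mul_rid matrix_mul_assoc)
      finally show "(N k ** M ** N' k) ** (N k ** M' ** N' k) = mat 1" by (simp add: M' seq)
      have "(N k ** M' ** N' k) ** (N k ** M ** N' k) = N k ** M' ** (N' k ** N k) ** M ** N' k"
        by (simp only: matrix_mul_assoc)
      also have "\<dots> = N k ** (M' ** M) ** N' k" by (simp only: seq(6) matrix_mul_rid matrix_mul_assoc)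
      finally show "(N k ** M' ** N' k) ** (N k ** M ** N' k) = mat 1" by (simp add: M' seq)
    qed
    have a: "1/(r0+1) \<le> a k" "a k \<le> 1" using seq(2)[of k] by auto
    then have apos: "a k > 0" using r01 by (smt (verit) divide_pos_pos)
    have i: "inverse (real (Suc k)) \<le> 1" "inverse (real (Suc k)) > 0" by (simp_all add: field_simps)
    have "(r0 + inverse (real (Suc k))) * a k \<le> (r0 + 1) * 1"
      using a apos r01 i by (intro mult_mono) auto
    moreover have "(r0 + inverse (real (Suc k))) * a k \<ge> 0" using apos r01 i by simp
    ultimately have u1: "c *\<^sub>R y0 - N k ** M ** N' k *v y0 \<in> Kc"
      using chain[OF 1(1) seq(8)] k by simp
    have "(1 / a k) *\<^sub>R y k - (N k ** M' ** N' k) *v y k \<in> Kc"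
      by (rule disp_inv'[OF 1(2) inv(2) seq(7) apos])
    moreover have "1 / a k \<le> r0 + 1" using a apos r01 by (simp add: field_simps)
    ultimately have u2: "c *\<^sub>R y0 - N k ** M' ** N' k *v y0 \<in> Kc"
      using chain[OF 1(2)] k apos by simp
    show ?thesis using 1 u1 u2 inv by auto
  qed
  obtain k0 where k0: "\<And>k. k \<ge> k0 \<Longrightarrow> dist (y (f k)) y0 < d"
    using ev unfolding eventually_sequentially by auto
  have "(\<lambda>k. N (f k) ** M ** N' (f k)) ` {k0..} \<subseteq> ?F" using k0 inF by blast
  then have "finite ((\<lambda>k. N (f k) ** M ** N' (f k)) ` {k0..})" using finF by (rule finite_subset)
  then obtain k1 where k1: "k1 \<ge> k0"
      "infinite {k \<in> {k0..}. N (f k) ** M ** N' (f k) = N (f k1) ** M ** N' (f k1)}"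
    using pigeonhole_infinite[of "{k0..}" "\<lambda>k. N (f k) ** M ** N' (f k)"] infinite_Ici by auto
  define L where "L = N (f k1) ** M ** N' (f k1)"
  define S where "S = {k \<in> {k0..}. N (f k) ** M ** N' (f k) = L}"
  have "infinite S" unfolding S_def L_def by (rule k1(2))
  from infinite_enumerate[OF this] obtain g :: "nat \<Rightarrow> nat" where g: "strict_mono g" "\<And>n. g n \<in> S" by blast
  let ?h = "\<lambda>n. f (g n)"
  have hm: "strict_mono ?h" using f(3) g(1) by (simp add: strict_mono_def)
  have Lh: "N (?h n) ** M ** N' (?h n) = L" for n using g(2)[of n] by (simp only: S_def mem_Collect_eq)
  have yl: "(\<lambda>n. y (?h n)) \<longlonglongrightarrow> y0" and al: "(\<lambda>n. a (?h n)) \<longlonglongrightarrow> a0"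
    using LIMSEQ_subseq_LIMSEQ[OF yl g(1)] LIMSEQ_subseq_LIMSEQ[OF al g(1)] by (simp_all add: o_def)
  have il: "(\<lambda>n. inverse (real (Suc (?h n)))) \<longlonglongrightarrow> 0"
    using LIMSEQ_subseq_LIMSEQ[OF LIMSEQ_inverse_real_of_nat hm] by (simp add: o_def)
  have Ll: "(\<lambda>n. L *v y (?h n)) \<longlonglongrightarrow> L *v y0"
    by (rule isCont_tendsto_compose[OF _ yl]) (simp add: linear_continuous_at linear_conv_bounded_linear[symmetric])
  have lim1: "L *v y0 - a0 *\<^sub>R y0 \<in> Kc"
  proof (rule closed_sequentially[OF closed_closure])
    show "L *v y (?h n) - a (?h n) *\<^sub>R y (?h n) \<in> Kc" for n using seq(7)[of "?h n"] Lh by simp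
    show "(\<lambda>n. L *v y (?h n) - a (?h n) *\<^sub>R y (?h n)) \<longlonglongrightarrow> L *v y0 - a0 *\<^sub>R y0"
      by (intro tendsto_intros Ll yl al)
  qed
  have lim2: "((r0 + 0) * a0) *\<^sub>R y0 - L *v y0 \<in> Kc"
  proof (rule closed_sequentially[OF closed_closure])
    show "((r0 + inverse (real (Suc (?h n)))) * a (?h n)) *\<^sub>R y (?h n) - L *v y (?h n) \<in> Kc" for n
      using seq(8)[of "?h n"] Lh by simp
    show "(\<lambda>n. ((r0 + inverse (real (Suc (?h n)))) * a (?h n)) *\<^sub>R y (?h n) - L *v y (?h n))
        \<longlonglongrightarrow> ((r0 + 0) * a0) *\<^sub>R y0 - L *v y0"
      by (intro tendsto_intros Ll yl al il)
  qed
  let ?N = "N (f k1)" and ?N' = "N' (f k1)"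
  have N'L: "?N' *v (L *v y0) = M *v (?N' *v y0)"
  proof -
    have "?N' *v (L *v y0) = (?N' ** ?N) *v (M *v (?N' *v y0))"
      unfolding L_def by (simp only: matrix_vector_mul_assoc matrix_mul_assoc)
    then show ?thesis by (simp add: seq)
  qed
  \<comment> \<open>Undoing the conjugation turns the inequalities for \<open>L\<close> at
    \<open>y0\<close> into inequalities for \<open>M\<close> at \<open>?N' *v y0\<close>, with the
    same constants.\<close>
  have "?N' *v (L *v y0 - a0 *\<^sub>R y0) \<in> Kc" "?N' *v (((r0 + 0) * a0) *\<^sub>R y0 - L *v y0) \<in> Kc"
    using lim1 lim2 seq by (auto intro!: pres_P)
  then have "M *v (?N' *v y0) - a0 *\<^sub>R (?N' *v y0) \<in> Kc" "(r0 * a0) *\<^sub>R (?N' *v y0) - M *v (?N' *v y0) \<in> Kc"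
    by (simp_all add: mv_simps N'L)
  moreover have "?N' *v y0 \<in> K" using seq y0 by (intro pres_K)
  moreover have "a0 > 0" using f(2) r01 by (smt (verit) atLeastAtMost_iff divide_pos_pos)
  ultimately have "r0 \<in> R" unfolding R_def by blast
  moreover have "r0 \<le> r'" if "r' \<in> R" for r' unfolding r0_def using that bdd by (rule cInf_lower)
  ultimately show ?thesis by blast
qed

text \<open>
  At a point \<open>x\<close> of minimal displacement \<open>a x \<le> M x \<le> b x\<close>, the inequality for \<open>x + M x\<close> cannot
  improve, so strict convexity forces \<open>b x - M x\<close> and \<open>M x - a x\<close> to be eigenvectors.
\<close>

lemma two_eigenvectors:
  assumes M: "M \<in> G" "M \<noteq> mat 1"
  shows "\<exists>w\<in>Kc. \<exists>w'\<in>Kc. \<exists>l l'. w \<noteq> 0 \<and> w' \<noteq> 0 \<and> M *v w = l *\<^sub>R w \<and> M *v w' = l' *\<^sub>R w' \<and> w + w' \<in> K"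
proof -
  define R where "R = {r. \<exists>x\<in>K. \<exists>a>0. M *v x - a *\<^sub>R x \<in> Kc \<and> (r * a) *\<^sub>R x - M *v x \<in> Kc}"
  obtain r where r: "r \<in> R" "\<And>r'. r' \<in> R \<Longrightarrow> r \<le> r'"
    using min_displacement[OF M(1)] unfolding R_def by blast
  obtain x a where xa: "x \<in> K" "a > 0" "M *v x - a *\<^sub>R x \<in> Kc" "(r * a) *\<^sub>R x - M *v x \<in> Kc"
    using r(1) by (auto simp: R_def)
  define b where "b = r * a"
  have bpos: "b > 0" using disp_pos[OF M(1) xa(1,4)] by (simp add: b_def)
  have rb: "r = b / a" using xa by (simp add: b_def)
  define w where "w = b *\<^sub>R x - M *v x"
  define w' where "w' = M *v x - a *\<^sub>R x"
  have P: "w \<in> Kc" "w' \<in> Kc" using xa by (auto simp: w_def w'_def b_def)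
  have "w \<noteq> 0" using fixed_imp_one[OF M(1) xa(1), of b] M(2) by (auto simp: w_def)
  have "w' \<noteq> 0" using fixed_imp_one[OF M(1) xa(1), of a] M(2) by (auto simp: w'_def)
  define y where "y = x + M *v x"
  have y: "y \<in> K" unfolding y_def by (intro add_K xa pres_K M)
  have wy: "w + M *v w = b *\<^sub>R y - M *v y" "w' + M *v w' = M *v y - a *\<^sub>R y"
    by (simp_all add: w_def w'_def y_def mv_simps scaleR_add_right)
  have yP: "b *\<^sub>R y - M *v y \<in> Kc" "M *v y - a *\<^sub>R y \<in> Kc"
    unfolding wy[symmetric] by (intro P_add P pres_P M)+
  \<comment> \<open>If \<open>w + M w\<close> were interior, a small multiple of \<open>y\<close>
    could be subtracted from it, lowering \<open>b\<close> at \<open>y\<close> while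
    \<open>a\<close> is kept, and the ratio would fall below \<open>r\<close>. The statement for
    \<open>w'\<close> raises \<open>a\<close> instead.\<close>
  have 1: "w + M *v w \<notin> K"
  proof
    assume "w + M *v w \<in> K"
    then obtain c where c: "c > 0" "c *\<^sub>R (b *\<^sub>R y - M *v y) - y \<in> Kc"
      using order_unit unfolding wy by blast
    have "(1/c) *\<^sub>R (c *\<^sub>R (b *\<^sub>R y - M *v y) - y) \<in> Kc"
      by (rule P_scale[OF c(2)]) (use c in simp)
    then have "(b - 1/c) *\<^sub>R y - M *v y \<in> Kc"
      using c by (simp add: scaleR_diff_right scaleR_diff_left cancel_ab_semigroup_add_class.diff_right_commute[of "b *\<^sub>R y" "M *v y"])
    then have "(b - 1/c) / a \<in> R" unfolding R_def using y xa yP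
      by (intro CollectI bexI[of _ y] exI[of _ a]) auto
    then have "b / a \<le> (b - 1/c) / a" using r(2) rb by blast
    then show False using xa(2) c(1) by (simp add: divide_le_cancel)
  qed
  have 2: "w' + M *v w' \<notin> K"
  proof
    assume "w' + M *v w' \<in> K"
    then obtain c where c: "c > 0" "c *\<^sub>R (M *v y - a *\<^sub>R y) - y \<in> Kc"
      using order_unit unfolding wy by blast
    have "(1/c) *\<^sub>R (c *\<^sub>R (M *v y - a *\<^sub>R y) - y) \<in> Kc"
      by (rule P_scale[OF c(2)]) (use c in simp)
    then have 3: "M *v y - (a + 1/c) *\<^sub>R y \<in> Kc"
      using c by (simp add: scaleR_diff_right scaleR_add_left algebra_simps)
    have 4: "a + 1/c > 0" using xa c by (simp add: add_pos_pos)
    then have "b / (a + 1/c) \<in> R" unfolding R_def using y xa yP 3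
      by (intro CollectI bexI[of _ y] exI[of _ "a + 1/c"]) auto
    then have "b / a \<le> b / (a + 1/c)" using r(2) rb by blast
    moreover have "b / (a + 1/c) < b / a" using bpos xa(2) c(1) 4 by (intro divide_strict_left_mono) auto
    ultimately show False by simp
  qed
  have nz: "M *v v \<noteq> 0" if "v \<noteq> 0" for v
  proof
    assume 0: "M *v v = 0"
    obtain N where N: "N \<in> G" "N ** M = mat 1" using inv_G[OF M(1)] by auto
    have "N *v (M *v v) = v" by (simp add: matrix_vector_mul_assoc N)
    then show False using 0 that by simp
  qed
  obtain l where l: "M *v w = l *\<^sub>R w"
    using strict[OF P(1) pres_P[OF M(1) P(1)] \<open>w \<noteq> 0\<close> nz[OF \<open>w \<noteq> 0\<close>] 1] by auto
  obtain l' where l': "M *v w' = l' *\<^sub>R w'"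
    using strict[OF P(2) pres_P[OF M(1) P(2)] \<open>w' \<noteq> 0\<close> nz[OF \<open>w' \<noteq> 0\<close>] 2] by auto
  have ww: "w + w' = (b - a) *\<^sub>R x" by (simp add: w_def w'_def scaleR_diff_left)
  have "b - a > 0"
  proof (rule ccontr)
    assume "\<not> b - a > 0"
    then have "(a - b) *\<^sub>R x + w' \<in> Kc" using \<open>\<not> b - a > 0\<close> by (intro P_add[OF P_scale[OF K_subset[OF xa(1)]] P(2)]) simp
    moreover have "(a - b) *\<^sub>R x + w' = - w" using ww by (simp add: algebra_simps)
    ultimately show False using P_pointed[OF P(1)] \<open>w \<noteq> 0\<close> by simp
  qed
  then have "w + w' \<in> K" unfolding ww using xa by (intro scale_K)
  then show ?thesis using P \<open>w \<noteq> 0\<close> \<open>w' \<noteq> 0\<close> l l' by blast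
qed

text \<open>Some multiple of the interior vector \<open>q + q'\<close> dominates \<open>p\<close>.
  Applying \<open>M\<close> repeatedly and dividing by \<open>l ^ k\<close> keeps \<open>p\<close>
  while the terms in \<open>q\<close> and \<open>q'\<close> shrink to 0, so \<open>- p\<close> lies
  in the closed cone.\<close>

lemma dominant_eigenvector_False:
  assumes M: "M \<in> G" and p: "p \<in> Kc" "p \<noteq> 0" "M *v p = l *\<^sub>R p"
    and q: "M *v q = m *\<^sub>R q" "\<bar>m\<bar> < l" and q': "M *v q' = m' *\<^sub>R q'" "\<bar>m'\<bar> < l"
    and qq: "q + q' \<in> K"
  shows False
proof -
  have l: "l > 0" using q by linarith
  obtain c where c: "c > 0" "c *\<^sub>R (q + q') - p \<in> Kc" using order_unit[OF qq] by auto
  have it: "(c * m ^ k) *\<^sub>R q + (c * m' ^ k) *\<^sub>R q' - (l ^ k) *\<^sub>R p \<in> Kc" for k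
  proof (induction k)
    case 0 then show ?case using c by (simp add: scaleR_add_right)
  next
    case (Suc k)
    have "M *v ((c * m ^ k) *\<^sub>R q + (c * m' ^ k) *\<^sub>R q' - (l ^ k) *\<^sub>R p) \<in> Kc"
      by (rule pres_P[OF M Suc])
    then show ?case
      by (simp only: mv_simps p q q'
          scaleR_scaleR power_Suc2 mult.assoc)
  qed
  have "(c * (m/l) ^ k) *\<^sub>R q + (c * (m'/l) ^ k) *\<^sub>R q' - p \<in> Kc" for k
  proof -
    have "(1 / l ^ k) *\<^sub>R ((c * m ^ k) *\<^sub>R q + (c * m' ^ k) *\<^sub>R q' - (l ^ k) *\<^sub>R p) \<in> Kc"
      by (rule P_scale[OF it]) (use l in simp)
    then show ?thesis using l by (simp add: scaleR_add_right scaleR_diff_right power_divide)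
  qed
  moreover have "(\<lambda>k. (c * (m/l) ^ k) *\<^sub>R q + (c * (m'/l) ^ k) *\<^sub>R q' - p) \<longlonglongrightarrow> (c * 0) *\<^sub>R q + (c * 0) *\<^sub>R q' - p"
    using q q' l by (intro tendsto_intros LIMSEQ_power_zero) auto
  ultimately have "(c * 0) *\<^sub>R q + (c * 0) *\<^sub>R q' - p \<in> Kc"
    by (rule closed_sequentially[OF closed_closure])
  then have "- p \<in> Kc" by simp
  then show False using P_pointed p by blast
qed

end

section \<open>Existence of a thick point\<close>

context divisible_cone
begin

definition eigs :: "real^'m^'m \<Rightarrow> (real^'m) set"
  where "eigs M = {p \<in> Kc. p \<noteq> 0 \<and> (\<exists>l. M *v p = l *\<^sub>R p)}"

definition ray :: "real^'m \<Rightarrow> (real^'m) set"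
  where "ray p = {c *\<^sub>R p | c. c > 0}"

text \<open>Given an eigenvector \<open>p\<close> on a third ray, the pairwise sums of
  \<open>p\<close>, \<open>w\<close>, \<open>w'\<close> are interior. Equal eigenvalues would make
  such a sum a fixed interior ray, so one eigenvalue is strictly largest;
  \<open>dominant_eigenvector_False\<close> refutes this with the interior sum of the other
  two.\<close>

lemma eigs_two_rays:
  assumes M: "M \<in> G" "M \<noteq> mat 1"
  obtains w w' l l' where "w \<in> Kc" "w' \<in> Kc" "w \<noteq> 0" "w' \<noteq> 0" "w + w' \<in> K"
    "M *v w = l *\<^sub>R w" "M *v w' = l' *\<^sub>R w'" "l \<noteq> l'" "eigs M = ray w \<union> ray w'"
proof -
  obtain w w' l l' where w: "w \<in> Kc" "w' \<in> Kc" "w \<noteq> 0" "w' \<noteq> 0" "w + w' \<in> K"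
      "M *v w = l *\<^sub>R w" "M *v w' = l' *\<^sub>R w'"
    using two_eigenvectors[OF M] by blast
  have ne: "l \<noteq> l'"
  proof
    assume "l = l'"
    then have "M *v (w + w') = l *\<^sub>R (w + w')" by (simp add: w matrix_vector_right_distrib scaleR_add_right)
    then show False using fixed_imp_one[OF M(1) w(5)] M(2) by blast
  qed
  have l: "l > 0" "l' > 0" using eigen_pos[OF M(1)] w by blast+
  have "p \<in> ray w \<union> ray w'" if pE: "p \<in> eigs M" for p
  proof (rule ccontr)
    assume n: "p \<notin> ray w \<union> ray w'"
    obtain m where p: "p \<in> Kc" "p \<noteq> 0" "M *v p = m *\<^sub>R p" using pE by (auto simp: eigs_def)
    have m: "m > 0" using eigen_pos[OF M(1) p] .
    have s: "w + p \<in> K" using strict[OF w(1) p(1) w(3) p(2)] n by (auto simp: ray_def)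
    have s': "w' + p \<in> K" using strict[OF w(2) p(1) w(4) p(2)] n by (auto simp: ray_def)
    have "m \<noteq> l"
    proof
      assume "m = l"
      then have "M *v (w + p) = l *\<^sub>R (w + p)" by (simp add: w p matrix_vector_right_distrib scaleR_add_right)
      then show False using fixed_imp_one[OF M(1) s] M(2) by blast
    qed
    moreover have "m \<noteq> l'"
    proof
      assume "m = l'"
      then have "M *v (w' + p) = l' *\<^sub>R (w' + p)" by (simp add: w p matrix_vector_right_distrib scaleR_add_right)
      then show False using fixed_imp_one[OF M(1) s'] M(2) by blast
    qed
    ultimately consider "l < m" "l' < m" | "l' < l" "m < l" | "l < l'" "m < l'" using ne by linarith
    then show False
    proof cases
      case 1 show False by (rule dominant_eigenvector_False[OF M(1) p w(6) _ w(7) _ w(5)]) (use 1 l m in auto)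
    next
      case 2 show False by (rule dominant_eigenvector_False[OF M(1) w(1) w(3) w(6) w(7) _ p(3) _ s']) (use 2 l m in auto)
    next
      case 3 show False by (rule dominant_eigenvector_False[OF M(1) w(2) w(4) w(7) w(6) _ p(3) _ s]) (use 3 l m in auto)
    qed
  qed
  moreover have "ray w \<union> ray w' \<subseteq> eigs M"
    using w by (auto simp: eigs_def ray_def matrix_vector_mult_scaleR intro!: P_scale)
  ultimately have "eigs M = ray w \<union> ray w'" by blast
  then show ?thesis using that w ne by blast
qed

text \<open>\<open>N\<close> maps eigenvectors of \<open>M\<close> to eigenvectors with the same
  eigenvalue. Since the two eigenvalues differ, \<open>N\<close> cannot exchange the two
  rays.\<close>

lemma commute_eigs_subset:
  assumes M: "M \<in> G" "M \<noteq> mat 1" and N: "N \<in> G" and MN: "M ** N = N ** M"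
  shows "eigs M \<subseteq> eigs N"
proof
  fix p assume pE: "p \<in> eigs M"
  obtain w w' l l' where w: "w \<in> Kc" "w' \<in> Kc" "w \<noteq> 0" "w' \<noteq> 0" "w + w' \<in> K"
    "M *v w = l *\<^sub>R w" "M *v w' = l' *\<^sub>R w'" "l \<noteq> l'" "eigs M = ray w \<union> ray w'"
    by (rule eigs_two_rays[OF M])
  obtain m where p: "p \<in> Kc" "p \<noteq> 0" "M *v p = m *\<^sub>R p" using pE by (auto simp: eigs_def)
  obtain N' where N': "N' \<in> G" "N' ** N = mat 1" using inv_G[OF N] by auto
  have nz: "N *v p \<noteq> 0"
  proof
    assume "N *v p = 0"
    moreover have "N' *v (N *v p) = p" by (simp add: matrix_vector_mul_assoc N')
    ultimately show False using p(2) by simp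
  qed
  have "M *v (N *v p) = N *v (M *v p)" by (simp add: matrix_vector_mul_assoc MN)
  then have MNp: "M *v (N *v p) = m *\<^sub>R (N *v p)" by (simp add: p matrix_vector_mult_scaleR)
  then have NpE: "N *v p \<in> eigs M" using nz pres_P[OF N p(1)] by (auto simp: eigs_def)
  have ray_eig: "k = h" if q: "q \<in> ray u" "M *v u = h *\<^sub>R u" "M *v q = k *\<^sub>R q" "q \<noteq> 0" for q u k h
  proof -
    obtain c where "q = c *\<^sub>R u" using q(1) by (auto simp: ray_def)
    then have "M *v q = h *\<^sub>R q" using q(2) by (simp add: matrix_vector_mult_scaleR)
    then have "(k - h) *\<^sub>R q = 0" using q(3) by (simp add: scaleR_diff_left)
    then show ?thesis using q(4) by simp
  qed
  have same: "\<exists>c. N *v p = c *\<^sub>R p" if pu: "p \<in> ray u" "N *v p \<in> ray u" for u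
  proof -
    obtain c d where "p = c *\<^sub>R u" "c > 0" "N *v p = d *\<^sub>R u" using pu by (auto simp: ray_def)
    then have "N *v p = (d / c) *\<^sub>R p" by simp
    then show ?thesis by blast
  qed
  consider "p \<in> ray w" | "p \<in> ray w'" using pE w by auto
  then have "\<exists>c. N *v p = c *\<^sub>R p"
  proof cases
    case 1
    then have "m = l" using ray_eig w(6) p by blast
    then have "N *v p \<notin> ray w'" using ray_eig[OF _ w(7) MNp nz] w(8) by auto
    then show ?thesis using NpE w(9) same[OF 1] by auto
  next
    case 2
    then have "m = l'" using ray_eig w(7) p by blast
    then have "N *v p \<notin> ray w" using ray_eig[OF _ w(6) MNp nz] w(8) by auto
    then show ?thesis using NpE w(9) same[OF 2] by auto
  qed
  then show "p \<in> eigs N" using p by (auto simp: eigs_def)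
qed

lemma commute_eigs:
  assumes "M \<in> G" "M \<noteq> mat 1" "N \<in> G" "N \<noteq> mat 1" "M ** N = N ** M"
  shows "eigs M = eigs N"
  using commute_eigs_subset[OF assms(1,2,3,5)] commute_eigs_subset[OF assms(3,4,1) assms(5)[symmetric]]
  by (rule subset_antisym)

lemma eigs_conj:
  assumes N: "N \<in> G" "N' \<in> G" "N ** N' = mat 1" "N' ** N = mat 1"
  shows "(*v) N ` eigs M \<subseteq> eigs (N ** M ** N')"
proof
  fix z assume "z \<in> (*v) N ` eigs M"
  then obtain p l where p: "z = N *v p" "p \<in> Kc" "p \<noteq> 0" "M *v p = l *\<^sub>R p" by (auto simp: eigs_def)
  have N'z: "N' *v z = p" by (simp add: p(1) matrix_vector_mul_assoc N)
  have "N ** M ** N' *v z = N *v (M *v (N' *v z))" by (simp only: matrix_vector_mul_assoc matrix_mul_assoc)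
  also have "\<dots> = l *\<^sub>R z" by (simp only: N'z p(4) matrix_vector_mult_scaleR) (simp only: p(1))
  finally have "N ** M ** N' *v z = l *\<^sub>R z" .
  moreover have "z \<noteq> 0" using N'z p(3) by auto
  moreover have "z \<in> Kc" unfolding p(1) using N p by (intro pres_P)
  ultimately show "z \<in> eigs (N ** M ** N')" by (auto simp: eigs_def)
qed

text \<open>\<open>A x >= (1 - a) x\<close> gives \<open>A' x <= x / (1 - a)\<close>, and by
  \<open>obnd_disp\<close> this one inequality bounds the whole operator; \<open>8/7\<close> is
  \<open>1 / (1 - 1/8)\<close>.\<close>

lemma obnd_small_inverse:
  assumes A: "A \<in> G" "A' \<in> G" "A' ** A = mat 1" and x: "x \<in> K" and a: "obnd x (A - mat 1) a" "a \<le> 1/8"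
  shows "obnd x A' (8/7)"
proof -
  have "bnd x (A *v x - x) a"
    using obndD[OF a(1) bnd_self[OF K_subset[OF x]]] by (simp add: matrix_vector_mult_diff_rdistrib)
  then have "A *v x - (1 - a) *\<^sub>R x \<in> Kc" using bnd_near by blast
  then have "(1 / (1 - a)) *\<^sub>R x - A' *v x \<in> Kc"
    using a(2) by (intro disp_inv'[OF A(2,3)]) auto
  then have "obnd x A' (1 / (1 - a))" by (rule obnd_disp[OF A(2) x])
  moreover have "1 / (1 - a) \<le> 8/7" using a(2) by (simp add: field_simps)
  ultimately show ?thesis using obnd_mono[OF x] by blast
qed

text \<open>Zassenhaus: \<open>A B A\<inverse> B\<inverse> - 1 = ((A - 1)(B - 1) - (B - 1)(A - 1)) A\<inverse> B\<inverse>\<close>.\<close>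

lemma commutator_contracts:
  assumes A: "A \<in> G" "A' \<in> G" "A ** A' = mat 1" "A' ** A = mat 1"
    and B: "B \<in> G" "B' \<in> G" "B ** B' = mat 1" "B' ** B = mat 1"
    and x: "x \<in> K" and a: "obnd x (A - mat 1) (1/8)" and b: "obnd x (B - mat 1) b" "b \<le> 1/8"
  shows "obnd x (A ** B ** A' ** B' - mat 1) (b / 2)"
proof -
  have "b \<ge> 0" using obnd_nonneg[OF x b(1)] .
  have "obnd x ((A - mat 1) ** (B - mat 1) - (B - mat 1) ** (A - mat 1)) (1/8 * b + b * (1/8))"
    by (intro obnd_diff obnd_mult a b)
  moreover have "(A - mat 1) ** (B - mat 1) - (B - mat 1) ** (A - mat 1) = A ** B - B ** A"
    by (simp add: mat_mult_diff mat_diff_mult)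
  ultimately have 1: "obnd x (A ** B - B ** A) (b/4)" by simp
  have 2: "obnd x (A' ** B') (8/7 * (8/7))"
    by (intro obnd_mult obnd_small_inverse[OF A(1,2,4) x a] obnd_small_inverse[OF B(1,2,4) x b]) simp
  have 3: "obnd x ((A ** B - B ** A) ** (A' ** B')) (b/4 * (8/7 * (8/7)))"
    by (rule obnd_mult[OF 1 2])
  have "B ** A ** (A' ** B') = B ** (A ** A') ** B'" by (simp only: matrix_mul_assoc)
  also have "\<dots> = mat 1" by (simp add: A B)
  finally have "(A ** B - B ** A) ** (A' ** B') = A ** B ** A' ** B' - mat 1"
    by (simp add: mat_diff_mult matrix_mul_assoc)
  then have "obnd x (A ** B ** A' ** B' - mat 1) (b/4 * (8/7 * (8/7)))" using 3 by simp
  \<comment> \<open>The two products contribute \<open>b/8\<close> each and the two inverses a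
    factor \<open>8/7\<close> each; the result \<open>16 b / 49\<close> is below
    \<open>b / 2\<close>.\<close>
  then show ?thesis by (rule obnd_mono[OF x]) (use \<open>b \<ge> 0\<close> in simp)
qed

text \<open>The strict inequality makes smallness an open condition on \<open>x\<close>;
  \<open>1/8\<close> is the threshold of \<open>commutator_contracts\<close>.\<close>

definition small :: "real^'m \<Rightarrow> real^'m^'m \<Rightarrow> bool"
  where "small x M \<longleftrightarrow> (\<exists>e<1/8. obnd x (M - mat 1) e)"

definition central :: "real^'m \<Rightarrow> real^'m^'m \<Rightarrow> bool"
  where "central x M \<longleftrightarrow> M \<in> G \<and> M \<noteq> mat 1 \<and> small x M \<and> (\<forall>A\<in>G. small x A \<longrightarrow> A ** M = M ** A)"

text \<open>The commutator of an almost smallest nontrivial element with any small one lies below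
  the infimum of all sizes, hence is trivial. Discreteness makes this infimum positive.\<close>

lemma ex_central:
  assumes x: "x \<in> K" and ex: "\<exists>M\<in>G. M \<noteq> mat 1 \<and> small x M"
  shows "\<exists>M. central x M"
proof -
  define T where "T = {e. \<exists>M\<in>G. M \<noteq> mat 1 \<and> obnd x (M - mat 1) e}"
  obtain d where d: "d > 0" "\<And>M. M \<in> G \<Longrightarrow> obnd x (M - mat 1) d \<Longrightarrow> M = mat 1"
    using discrete_obnd[OF x] by auto
  have Td: "d \<le> e" if "e \<in> T" for e
    using that d(2) obnd_mono[OF x, of _ e d] by (force simp: T_def)
  obtain e1 where e1: "e1 \<in> T" "e1 < 1/8" using ex by (auto simp: T_def small_def)
  have bdd: "bdd_below T" using Td by (rule bdd_belowI)
  have Ige: "Inf T \<ge> d" using e1 Td by (intro cInf_greatest) auto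
  have Ile: "Inf T \<le> e1" using e1 bdd by (intro cInf_lower)
  \<comment> \<open>Commutators halve the size, so a size below twice the infimum suffices and no
    minimum has to be attained.\<close>
  obtain e where e: "e \<in> T" "e < min (1/8) (2 * Inf T)"
  proof -
    have "Inf T < min (1/8) (2 * Inf T)" using Ige Ile d(1) e1 by auto
    then show ?thesis using that cInf_less_iff[OF _ bdd] e1(1) by blast
  qed
  obtain M where M: "M \<in> G" "M \<noteq> mat 1" "obnd x (M - mat 1) e" using e(1) by (auto simp: T_def)
  obtain M' where M': "M' \<in> G" "M ** M' = mat 1" "M' ** M = mat 1" using inv_G[OF M(1)] by auto
  have "A ** M = M ** A" if A: "A \<in> G" "small x A" for A
  proof -
    obtain A' where A': "A' \<in> G" "A ** A' = mat 1" "A' ** A = mat 1" using inv_G[OF A(1)] by auto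
    obtain f where f: "f < 1/8" "obnd x (A - mat 1) f" using A(2) by (auto simp: small_def)
    have "obnd x (A - mat 1) (1/8)" by (rule obnd_mono[OF x f(2)]) (use f in simp)
    then have c: "obnd x (A ** M ** A' ** M' - mat 1) (e / 2)"
      using e(2) by (intro commutator_contracts[OF A(1) A' M(1) M' x _ M(3)]) auto
    have "A ** M ** A' ** M' = mat 1"
    proof (rule ccontr)
      assume "A ** M ** A' ** M' \<noteq> mat 1"
      then have "e / 2 \<in> T" using c A(1) A'(1) M(1) M'(1) mult_G unfolding T_def by blast
      then have "Inf T \<le> e / 2" using bdd by (rule cInf_lower)
      then show False using e(2) by simp
    qed
    then have "A ** M ** A' ** M' ** (M ** A) = M ** A" by simp
    moreover have "A ** M ** A' ** M' ** (M ** A) = A ** M ** (A' ** (M' ** M) ** A)"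
      by (simp only: matrix_mul_assoc)
    ultimately show ?thesis by (simp add: M' A')
  qed
  then show ?thesis using M e(2) unfolding central_def small_def by auto
qed

text \<open>For \<open>x = y\<close> this says that the eigenrays do not depend on the choice of the
  central element; for \<open>y\<close> close to \<open>x\<close>, that they do not depend on the
  point.\<close>

lemma central_eigs:
  assumes "central x M" "central y N" "small y M"
  shows "eigs M = eigs N"
  using assms commute_eigs unfolding central_def by blast

lemma small_open:
  assumes x: "x \<in> K" and M: "small x M"
  shows "\<exists>d>0. \<forall>y\<in>K. dist y x < d \<longrightarrow> small y M"
proof -
  obtain e where e: "e < 1/8" "obnd x (M - mat 1) e" using M by (auto simp: small_def)
  have e0: "e \<ge> 0" by (rule obnd_nonneg[OF x e(2)])
  \<comment> \<open>A bound strictly between \<open>e\<close> and \<open>1/8\<close>, positive even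
    if \<open>e = 0\<close>, because \<open>c\<close> divides by it. A change of base point
    multiplies it by \<open>c * c\<close>, chosen to give the midpoint of \<open>f\<close> and
    \<open>1/8\<close>.\<close>
  define f where "f = (e + 1/8) / 2"
  have f: "f > 0" "e < f" "f < 1/8" using e e0 by (auto simp: f_def)
  have ef: "obnd x (M - mat 1) f" by (rule obnd_mono[OF x e(2)]) (use f in simp)
  define c where "c = sqrt ((f + 1/8) / 2 / f)"
  have q: "(f + 1/8) / 2 / f > 1" using f by (simp add: field_simps)
  then have c: "c > 1" by (simp add: c_def)
  have cc: "c * c = (f + 1/8) / 2 / f" using q real_sqrt_mult_self[of "(f + 1/8) / 2 / f"] unfolding c_def by linarith
  have "c * f * c = (c * c) * f" by simp
  also have "\<dots> = (f + 1/8) / 2" using f by (simp add: cc)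
  finally have cfc: "c * f * c < 1/8" using f by simp
  obtain d where d: "d > 0" "\<And>y. dist y x < d \<Longrightarrow> c *\<^sub>R x - y \<in> Kc \<and> c *\<^sub>R y - x \<in> Kc"
    using near_K'[OF x c] by auto
  have "small y M" if y: "y \<in> K" "dist y x < d" for y
  proof -
    have "obnd y (M - mat 1) (c * f * c)" using d(2)[OF y(2)] by (intro obnd_base[OF x y(1) ef]) auto
    then show ?thesis using cfc unfolding small_def by blast
  qed
  then show ?thesis using d(1) by blast
qed

lemma central_conj:
  assumes N: "N \<in> G" "N' \<in> G" "N ** N' = mat 1" "N' ** N = mat 1" and M: "central x M"
  shows "central (N *v x) (N ** M ** N')"
proof -
  have conj: "small (U *v y) (U ** A ** U')"
    if U: "U \<in> G" "U' \<in> G" "U ** U' = mat 1" "U' ** U = mat 1" and A: "small y A" for U U' A y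
  proof -
    obtain e where e: "e < 1/8" "obnd y (A - mat 1) e" using A by (auto simp: small_def)
    have "obnd (U *v y) (U ** (A - mat 1) ** U') e" by (rule obnd_conj[OF U(1,2,4) e(2)])
    moreover have "U ** (A - mat 1) ** U' = U ** A ** U' - mat 1"
      by (simp add: mat_mult_diff mat_diff_mult U)
    ultimately show ?thesis using e(1) unfolding small_def by auto
  qed
  have "N ** M ** N' \<noteq> mat 1"
  proof
    assume "N ** M ** N' = mat 1"
    then have "N' ** (N ** M ** N') ** N = N' ** N" by simp
    moreover have "N' ** (N ** M ** N') ** N = (N' ** N) ** M ** (N' ** N)" by (simp only: matrix_mul_assoc)
    ultimately show False using M by (simp add: N central_def)
  qed
  moreover have "A ** (N ** M ** N') = (N ** M ** N') ** A" if A: "A \<in> G" "small (N *v x) A" for A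
  proof -
    have "small (N' *v (N *v x)) (N' ** A ** N)" by (rule conj[OF N(2,1,4,3) A(2)])
    then have "small x (N' ** A ** N)" by (simp add: matrix_vector_mul_assoc N)
    then have "(N' ** A ** N) ** M = M ** (N' ** A ** N)"
      using M A N mult_G unfolding central_def by blast
    then have "N ** ((N' ** A ** N) ** M) ** N' = N ** (M ** (N' ** A ** N)) ** N'" by simp
    moreover have "N ** ((N' ** A ** N) ** M) ** N' = (N ** N') ** A ** (N ** M ** N')"
      by (simp only: matrix_mul_assoc)
    moreover have "N ** (M ** (N' ** A ** N)) ** N' = (N ** M ** N') ** A ** (N ** N')"
      by (simp only: matrix_mul_assoc)
    ultimately show ?thesis by (simp add: N)
  qed
  moreover have "N ** M ** N' \<in> G" using N M mult_G by (auto simp: central_def)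
  moreover have "small (N *v x) (N ** M ** N')" using conj[OF N] M by (auto simp: central_def)
  ultimately show ?thesis by (auto simp: central_def)
qed

text \<open>As the group preserves the sector \<open>S\<close> spanned by \<open>p\<close> and
  \<open>q\<close>, every \<open>x\<close> in \<open>K\<close> is comparable, with one constant, to
  a vector of \<open>S\<close>. Let \<open>x\<close> tend to a boundary vector \<open>r\<close>
  outside the plane of \<open>S\<close>: the comparison vectors subconverge to a vector of
  \<open>S\<close> below \<open>r\<close>, which strictness forces to be 0, and then
  \<open>r <= 0\<close>.\<close>

lemma not_invariant_two_rays:
  assumes p: "p \<in> Kc" "q \<in> Kc" "p + q \<in> K" "p \<notin> K" "q \<notin> K" "p \<noteq> 0" "q \<noteq> 0"
    and inv: "\<And>N. N \<in> G \<Longrightarrow> (*v) N ` (ray p \<union> ray q) \<subseteq> ray p \<union> ray q"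
  shows False
proof -
  obtain D where D: "compact D" "D \<subseteq> K" "\<And>x. x \<in> K \<Longrightarrow> \<exists>N\<in>G. \<exists>t>0. t *\<^sub>R (N *v x) \<in> D"
    using cocompact by blast
  let ?u = "p + q"
  \<comment> \<open>Strict comparability with \<open>?u\<close> is an open condition that each point
    of \<open>K\<close> satisfies for some constant, so compactness of \<open>D\<close> yields a
    common one.\<close>
  have "\<exists>c>0. \<forall>x\<in>D. c *\<^sub>R x - ?u \<in> Kc \<and> c *\<^sub>R ?u - x \<in> Kc"
  proof -
    define U where "U c = {x. c *\<^sub>R x - ?u \<in> K \<and> c *\<^sub>R ?u - x \<in> K}" for c
    have op: "open (U c)" for c
    proof -
      have "U c = (\<lambda>x. c *\<^sub>R x - ?u) -` K \<inter> (\<lambda>x. c *\<^sub>R ?u - x) -` K" by (auto simp: U_def)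
      then show ?thesis
        by (simp only:) (intro open_Int open_vimage open_K continuous_intros)
    qed
    have ex: "\<exists>c>0. x \<in> U c" if x: "x \<in> K" for x
    proof -
      obtain c where c: "c > 0" "c *\<^sub>R x - ?u \<in> Kc" using order_unit[OF x] by auto
      obtain c' where c': "c' > 0" "c' *\<^sub>R ?u - x \<in> Kc" using order_unit[OF p(3)] by auto
      have "(1 + c') *\<^sub>R x + (c *\<^sub>R x - ?u) \<in> K" "(1 + c) *\<^sub>R ?u + (c' *\<^sub>R ?u - x) \<in> K"
        using x c c' p(3) by (auto intro!: KP_add scale_K)
      then have "x \<in> U (1 + c + c')" by (simp add: U_def algebra_simps)
      then show ?thesis using c(1) c'(1) by (intro exI[of _ "1 + c + c'"]) auto
    qed
    have "D \<subseteq> (\<Union>c\<in>{0<..}. U c)"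
    proof
      fix x assume "x \<in> D"
      then obtain c where "c > 0" "x \<in> U c" using ex D(2) by blast
      then show "x \<in> (\<Union>c\<in>{0<..}. U c)" by blast
    qed
    then obtain C where C: "C \<subseteq> {0<..}" "finite C" "D \<subseteq> (\<Union>c\<in>C. U c)"
      by (rule compactE_image[OF D(1) op])
    define c where "c = Max (insert 1 C)"
    have c: "c \<ge> 1" "\<And>d. d \<in> C \<Longrightarrow> d \<le> c" using C(2) by (auto simp: c_def)
    have "c *\<^sub>R x - ?u \<in> Kc \<and> c *\<^sub>R ?u - x \<in> Kc" if x: "x \<in> D" for x
    proof -
      obtain d where d: "d \<in> C" "d *\<^sub>R x - ?u \<in> K" "d *\<^sub>R ?u - x \<in> K" using C(3) x by (auto simp: U_def)
      have "(c - d) *\<^sub>R x + (d *\<^sub>R x - ?u) \<in> Kc" "(c - d) *\<^sub>R ?u + (d *\<^sub>R ?u - x) \<in> Kc"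
        using d c(2)[OF d(1)] x D(2) p(3) by (auto intro!: P_add P_scale K_subset[of x] K_subset[of ?u] K_subset[of "d *\<^sub>R x - ?u"] K_subset[of "d *\<^sub>R ?u - x"])
      moreover have "(c - d) *\<^sub>R x + (d *\<^sub>R x - ?u) = c *\<^sub>R x - ?u" "(c - d) *\<^sub>R ?u + (d *\<^sub>R ?u - x) = c *\<^sub>R ?u - x"
        by (simp_all add: scaleR_diff_left)
      ultimately show ?thesis by (simp only:)
    qed
    then show ?thesis using c(1) by (intro exI[of _ c]) auto
  qed
  then obtain c where c: "c > 0" "\<And>x. x \<in> D \<Longrightarrow> c *\<^sub>R x - ?u \<in> Kc \<and> c *\<^sub>R ?u - x \<in> Kc" by auto
  define S where "S = {z. \<exists>s\<ge>0. \<exists>t\<ge>0. z = s *\<^sub>R p + t *\<^sub>R q}"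
  have SI: "s *\<^sub>R p + t *\<^sub>R q \<in> S" if "s \<ge> 0" "t \<ge> 0" for s t using that by (auto simp: S_def)
  have Sadd: "z + z' \<in> S" if zS: "z \<in> S" "z' \<in> S" for z z'
  proof -
    obtain s t where 1: "s \<ge> 0" "t \<ge> 0" "z = s *\<^sub>R p + t *\<^sub>R q" using zS(1) by (auto simp: S_def)
    obtain s' t' where 2: "s' \<ge> 0" "t' \<ge> 0" "z' = s' *\<^sub>R p + t' *\<^sub>R q" using zS(2) by (auto simp: S_def)
    from 1 2 have "z + z' = (s + s') *\<^sub>R p + (t + t') *\<^sub>R q" by (simp add: scaleR_add_left)
    then show ?thesis using SI[of "s + s'" "t + t'"] 1 2 by simp
  qed
  have Sscale: "k *\<^sub>R z \<in> S" if zS: "z \<in> S" "k \<ge> 0" for z k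
  proof -
    obtain s t where 1: "s \<ge> 0" "t \<ge> 0" "z = s *\<^sub>R p + t *\<^sub>R q" using zS(1) by (auto simp: S_def)
    then have "k *\<^sub>R z = (k * s) *\<^sub>R p + (k * t) *\<^sub>R q" by (simp add: scaleR_add_right)
    then show ?thesis using SI[of "k * s" "k * t"] 1 zS(2) by simp
  qed
  have rayS: "z \<in> S" if "z \<in> ray p \<union> ray q" for z
    using that SI[of _ 0] SI[of 0] by (auto simp: ray_def)
  have pray: "p \<in> ray p" "q \<in> ray q" unfolding ray_def by (rule CollectI, rule exI[of _ 1], simp)+
  have key: "\<exists>z\<in>S. x - z \<in> Kc \<and> (c * c) *\<^sub>R z - x \<in> Kc" if x: "x \<in> K" for x
  proof -
    obtain N t where N: "N \<in> G" "t > 0" "t *\<^sub>R (N *v x) \<in> D" using D(3)[OF x] by auto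
    obtain N' where N': "N' \<in> G" "N' ** N = mat 1" using inv_G[OF N(1)] by auto
    have "N' *v p \<in> S" "N' *v q \<in> S" using inv[OF N'(1)] pray rayS by blast+
    then have uS: "N' *v ?u \<in> S" by (simp add: matrix_vector_right_distrib Sadd)
    let ?z = "(1 / (c * t)) *\<^sub>R (N' *v ?u)"
    have zS: "?z \<in> S" using uS N c by (intro Sscale) auto
    have N'N: "N' *v (N *v x) = x" by (simp add: matrix_vector_mul_assoc N')
    have cu: "c *\<^sub>R (t *\<^sub>R (N *v x)) - ?u \<in> Kc" "c *\<^sub>R ?u - t *\<^sub>R (N *v x) \<in> Kc"
      using c(2)[OF N(3)] by blast+
    have "(1 / (c * t)) *\<^sub>R (N' *v (c *\<^sub>R (t *\<^sub>R (N *v x)) - ?u)) \<in> Kc"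
      by (rule P_scale[OF pres_P[OF N'(1) cu(1)]]) (use c(1) N(2) in simp)
    then have 1: "x - ?z \<in> Kc"
      using c N by (simp add: mv_simps N'N scaleR_diff_right)
    have "(1 / t) *\<^sub>R (N' *v (c *\<^sub>R ?u - t *\<^sub>R (N *v x))) \<in> Kc"
      by (rule P_scale[OF pres_P[OF N'(1) cu(2)]]) (use N(2) in simp)
    then have "(c / t) *\<^sub>R (N' *v ?u) - x \<in> Kc"
      using N by (simp add: mv_simps N'N scaleR_diff_right)
    moreover have "(c * c) *\<^sub>R ?z = (c / t) *\<^sub>R (N' *v ?u)" using c N by simp
    ultimately show ?thesis using zS 1 by auto
  qed
  obtain r where r: "r \<in> Kc" "r \<notin> K" "r \<notin> span {p, q}"
  proof -
    have "dim (span {p, q}) \<le> card {p, q}" by (intro dim_le_card) auto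
    also have "\<dots> \<le> 2" by (simp add: card_insert_if)
    also have "2 < DIM(real^'m)" using dim by simp
    finally have "span {p, q} \<noteq> UNIV" by (metis dim_UNIV nat_neq_iff)
    then obtain v0 where v0: "v0 \<notin> span {p, q}" by auto
    \<comment> \<open>Otherwise every vector outside the plane would be a direction of recession of
      \<open>K\<close>, and the closed cone would contain both \<open>v0\<close> and
      \<open>- v0\<close>.\<close>
    have "\<exists>v. v \<notin> span {p, q} \<and> (\<exists>t>0. ?u + t *\<^sub>R v \<notin> K)"
    proof (rule ccontr)
      assume n: "\<not> ?thesis"
      have lim: "v \<in> Kc" if v: "v \<notin> span {p, q}" for v
      proof (rule closed_sequentially[OF closed_closure])
        show "inverse (real (Suc k)) *\<^sub>R ?u + v \<in> Kc" for k
        proof -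
          have "?u + real (Suc k) *\<^sub>R v \<in> K" using n v by (metis of_nat_0_less_iff zero_less_Suc)
          then have "inverse (real (Suc k)) *\<^sub>R (?u + real (Suc k) *\<^sub>R v) \<in> Kc"
            by (intro P_scale K_subset) auto
          moreover have "inverse (real (Suc k)) *\<^sub>R (?u + real (Suc k) *\<^sub>R v) = inverse (real (Suc k)) *\<^sub>R ?u + v"
            by (simp only: scaleR_add_right scaleR_scaleR) simp
          ultimately show ?thesis by simp
        qed
        have "(\<lambda>k. inverse (real (Suc k)) *\<^sub>R ?u + v) \<longlonglongrightarrow> 0 *\<^sub>R ?u + v"
          by (intro tendsto_intros LIMSEQ_inverse_real_of_nat)
        then show "(\<lambda>k. inverse (real (Suc k)) *\<^sub>R ?u + v) \<longlonglongrightarrow> v" by simp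
      qed
      have "- v0 \<notin> span {p, q}" using v0 by (metis span_neg minus_minus)
      then have "v0 = 0" using P_pointed lim v0 by blast
      then show False using v0 span_zero by blast
    qed
    then obtain v t where v: "v \<notin> span {p, q}" "t > 0" "?u + t *\<^sub>R v \<notin> K" by auto
    let ?seg = "closed_segment ?u (?u + t *\<^sub>R v)"
    have "connected ?seg" by (rule connected_segment)
    moreover have "?seg \<inter> K \<noteq> {}" using p(3) by auto
    moreover have "?seg - K \<noteq> {}" using v(3) by auto
    ultimately have "?seg \<inter> frontier K \<noteq> {}" by (rule connected_Int_frontier)
    then obtain r where rf: "r \<in> frontier K" "r \<in> ?seg" by auto
    have rK: "r \<in> Kc" "r \<notin> K" using rf(1) open_K by (auto simp: frontier_def interior_open)
    obtain k where k: "r = ?u + (k * t) *\<^sub>R v"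
    proof -
      obtain k where "r = (1 - k) *\<^sub>R ?u + k *\<^sub>R (?u + t *\<^sub>R v)" using rf(2) by (auto simp: closed_segment_def)
      then have "r = ?u + (k * t) *\<^sub>R v" by (simp add: scaleR_diff_left scaleR_add_right)
      then show ?thesis by (rule that)
    qed
    have "k \<noteq> 0" using k rK(2) p(3) by auto
    have us: "?u \<in> span {p, q}" by (intro span_add span_base) auto
    have "r \<notin> span {p, q}"
    proof
      assume "r \<in> span {p, q}"
      then have "(1 / (k * t)) *\<^sub>R (r - ?u) \<in> span {p, q}" using us by (intro span_scale span_diff)
      then show False using v(1,2) k \<open>k \<noteq> 0\<close> by simp
    qed
    then show ?thesis using that rK by blast
  qed
  obtain f where f: "\<And>n. f n \<in> K" "f \<longlonglongrightarrow> r" using r(1) by (auto simp: closure_sequential)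
  have "\<exists>s t. s \<ge> 0 \<and> t \<ge> 0 \<and> f n - (s *\<^sub>R p + t *\<^sub>R q) \<in> Kc \<and> (c * c) *\<^sub>R (s *\<^sub>R p + t *\<^sub>R q) - f n \<in> Kc" for n
    using key[OF f(1)[of n]] by (auto simp: S_def)
  then obtain s t where st: "\<And>n. s n \<ge> 0" "\<And>n. t n \<ge> 0" "\<And>n. f n - (s n *\<^sub>R p + t n *\<^sub>R q) \<in> Kc"
      "\<And>n. (c * c) *\<^sub>R (s n *\<^sub>R p + t n *\<^sub>R q) - f n \<in> Kc" by metis
  obtain a where a: "\<And>x. x \<in> Kc \<Longrightarrow> norm x \<le> a \<bullet> x" using P_proper by auto
  \<comment> \<open>Pairing with \<open>a\<close> bounds the coefficients \<open>s n\<close> and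
    \<open>t n\<close>, which then converge along a subsequence.\<close>
  have ap: "a \<bullet> p > 0" "a \<bullet> q > 0" using a[OF p(1)] a[OF p(2)] p(6,7) by (smt (verit) zero_less_norm_iff)+
  have "bounded (range f)" by (rule convergent_imp_bounded[OF f(2)])
  then obtain B where B: "\<And>n. norm (f n) \<le> B" by (auto simp: bounded_iff)
  have "s n * (a \<bullet> p) + t n * (a \<bullet> q) \<le> norm a * B" for n
  proof -
    have "0 \<le> a \<bullet> (f n - (s n *\<^sub>R p + t n *\<^sub>R q))" using a[OF st(3)[of n]] by (smt (verit) norm_ge_zero)
    then have "s n * (a \<bullet> p) + t n * (a \<bullet> q) \<le> a \<bullet> f n" by (simp add: inner_diff_right inner_add_right)
    also have "\<dots> \<le> norm a * norm (f n)" by (rule norm_cauchy_schwarz)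
    also have "\<dots> \<le> norm a * B" using B by (intro mult_left_mono) auto
    finally show ?thesis .
  qed
  then have sb: "s n * (a \<bullet> p) \<le> norm a * B" "t n * (a \<bullet> q) \<le> norm a * B" for n
    using st(1,2)[of n] ap by (smt (verit) mult_nonneg_nonneg)+
  have box: "(s n, t n) \<in> {0..norm a * B / (a \<bullet> p)} \<times> {0..norm a * B / (a \<bullet> q)}" for n
    using st(1,2)[of n] sb[of n] ap by (auto simp: field_simps)
  have "compact ({0..norm a * B / (a \<bullet> p)} \<times> {0..norm a * B / (a \<bullet> q)})" by (intro compact_Times compact_Icc)
  then have "seq_compact ({0..norm a * B / (a \<bullet> p)} \<times> {0..norm a * B / (a \<bullet> q)})"
    by (rule compact_imp_seq_compact)
  moreover have "\<forall>n. (s n, t n) \<in> {0..norm a * B / (a \<bullet> p)} \<times> {0..norm a * B / (a \<bullet> q)}" using box by blast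
  ultimately obtain l g where g: "l \<in> {0..norm a * B / (a \<bullet> p)} \<times> {0..norm a * B / (a \<bullet> q)}" "strict_mono g"
      "((\<lambda>n. (s n, t n)) \<circ> g) \<longlonglongrightarrow> l"
    by (rule seq_compactE)
  obtain s0 t0 where l: "l = (s0, t0)" by force
  have sl: "(\<lambda>n. s (g n)) \<longlonglongrightarrow> s0" "(\<lambda>n. t (g n)) \<longlonglongrightarrow> t0"
    using tendsto_fst[OF g(3)] tendsto_snd[OF g(3)] by (simp_all add: l o_def)
  have fl: "(\<lambda>n. f (g n)) \<longlonglongrightarrow> r" using LIMSEQ_subseq_LIMSEQ[OF f(2) g(2)] by (simp add: o_def)
  have s0: "s0 \<ge> 0" "t0 \<ge> 0" using g(1) l by auto
  have l1: "r - (s0 *\<^sub>R p + t0 *\<^sub>R q) \<in> Kc"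
  proof (rule closed_sequentially[OF closed_closure])
    show "f (g n) - (s (g n) *\<^sub>R p + t (g n) *\<^sub>R q) \<in> Kc" for n by (rule st(3))
    show "(\<lambda>n. f (g n) - (s (g n) *\<^sub>R p + t (g n) *\<^sub>R q)) \<longlonglongrightarrow> r - (s0 *\<^sub>R p + t0 *\<^sub>R q)"
      by (intro tendsto_intros sl fl)
  qed
  have l2: "(c * c) *\<^sub>R (s0 *\<^sub>R p + t0 *\<^sub>R q) - r \<in> Kc"
  proof (rule closed_sequentially[OF closed_closure])
    show "(c * c) *\<^sub>R (s (g n) *\<^sub>R p + t (g n) *\<^sub>R q) - f (g n) \<in> Kc" for n by (rule st(4))
    show "(\<lambda>n. (c * c) *\<^sub>R (s (g n) *\<^sub>R p + t (g n) *\<^sub>R q) - f (g n)) \<longlonglongrightarrow> (c * c) *\<^sub>R (s0 *\<^sub>R p + t0 *\<^sub>R q) - r"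
      by (intro tendsto_intros sl fl)
  qed
  \<comment> \<open>If \<open>s0 > 0\<close>, then \<open>s0 p <= r\<close>, and
    \<open>strict_order\<close> puts \<open>r\<close> on the ray of \<open>p\<close>, inside the
    plane.\<close>
  have "s0 = 0"
  proof (rule ccontr)
    assume "s0 \<noteq> 0"
    have "r - (s0 *\<^sub>R p + t0 *\<^sub>R q) + t0 *\<^sub>R q \<in> Kc" using l1 s0 p by (intro P_add P_scale)
    then have "r - s0 *\<^sub>R p \<in> Kc" by simp
    then obtain k where "r = k *\<^sub>R p" using strict_order[OF r(1,2) p(1,6), of s0] s0 \<open>s0 \<noteq> 0\<close> by auto
    then show False using r(3) by (simp add: span_base span_scale)
  qed
  moreover have "t0 = 0"
  proof (rule ccontr)
    assume "t0 \<noteq> 0"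
    have "r - (s0 *\<^sub>R p + t0 *\<^sub>R q) + s0 *\<^sub>R p \<in> Kc" using l1 s0 p by (intro P_add P_scale)
    then have "r - t0 *\<^sub>R q \<in> Kc" by simp
    then obtain k where "r = k *\<^sub>R q" using strict_order[OF r(1,2) p(2,7), of t0] s0 \<open>t0 \<noteq> 0\<close> by auto
    then show False using r(3) by (simp add: span_base span_scale)
  qed
  ultimately have "- r \<in> Kc" using l2 by simp
  then have "r = 0" using P_pointed r(1) by blast
  then show False using r(3) span_zero by blast
qed

lemma ex_thick: "\<exists>x\<in>K. \<forall>M\<in>G. small x M \<longrightarrow> M = mat 1"
proof (rule ccontr)
  assume "\<not> ?thesis"
  then have thin: "\<And>x. x \<in> K \<Longrightarrow> \<exists>M\<in>G. M \<noteq> mat 1 \<and> small x M" by auto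
  \<comment> \<open>The choice is immaterial: by \<open>central_eigs\<close> all central elements at
    \<open>x\<close> have the same eigenrays.\<close>
  define \<Phi> where "\<Phi> x = eigs (SOME M. central x M)" for x
  have central: "central x (SOME M. central x M)" if "x \<in> K" for x
    using ex_central[OF that thin[OF that]] by (rule someI_ex)
  have \<Phi>: "\<Phi> x = eigs M" if "x \<in> K" "central x M" for x M
  proof -
    have "small x (SOME M. central x M)" using central[OF that(1)] unfolding central_def[of x] by (elim conjE)
    then show ?thesis unfolding \<Phi>_def by (rule central_eigs[OF central[OF that(1)] that(2)])
  qed
  have const: "\<Phi> x = \<Phi> y" if xy: "x \<in> K" "y \<in> K" for x y
  proof (rule connected_equivalence_relation[of K x y "\<lambda>x y. \<Phi> x = \<Phi> y"])
    have "convex K"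
    proof (rule convexI)
      fix x y :: "real^'m" and u v :: real
      assume uv: "x \<in> K" "y \<in> K" "0 \<le> u" "0 \<le> v" "u + v = 1"
      show "u *\<^sub>R x + v *\<^sub>R y \<in> K"
      proof (cases "u = 0")
        case True then show ?thesis using uv by simp
      next
        case False
        then show ?thesis using uv by (intro KP_add scale_K P_scale K_subset) auto
      qed
    qed
    then show "connected K" by (rule convex_connected)
    fix z assume z: "z \<in> K"
    obtain M where M: "central z M" using central[OF z] by blast
    obtain d where d: "d > 0" "\<And>y. y \<in> K \<Longrightarrow> dist y z < d \<Longrightarrow> small y M"
      using small_open[OF z, of M] M by (auto simp: central_def)
    have "\<Phi> z = \<Phi> y" if y: "y \<in> K" "dist y z < d" for y
    proof -
      have "eigs M = \<Phi> y" unfolding \<Phi>_def by (rule central_eigs[OF M central[OF y(1)] d(2)[OF y]])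
      then show ?thesis using \<Phi>[OF z M] by simp
    qed
    then show "\<exists>T. openin (top_of_set K) T \<and> z \<in> T \<and> (\<forall>x\<in>T. \<Phi> z = \<Phi> x)"
    proof (intro exI[of _ "K \<inter> ball z d"] conjI ballI)
      show "openin (top_of_set K) (K \<inter> ball z d)" by (intro openin_open_Int open_ball)
      show "z \<in> K \<inter> ball z d" using z d(1) by simp
      fix y assume "y \<in> K \<inter> ball z d"
      then show "\<Phi> z = \<Phi> y" using \<open>\<And>y. y \<in> K \<Longrightarrow> dist y z < d \<Longrightarrow> \<Phi> z = \<Phi> y\<close>[of y] by (simp add: dist_commute)
    qed
  qed (simp_all add: xy)
  obtain x where x: "x \<in> K" using nonempty_K by auto
  obtain M where M: "central x M" using central[OF x] by blast
  then have MG: "M \<in> G" "M \<noteq> mat 1" by (auto simp: central_def)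
  obtain w w' l l' where w: "w \<in> Kc" "w' \<in> Kc" "w \<noteq> 0" "w' \<noteq> 0" "w + w' \<in> K"
    "M *v w = l *\<^sub>R w" "M *v w' = l' *\<^sub>R w'" "l \<noteq> l'" "eigs M = ray w \<union> ray w'"
    by (rule eigs_two_rays[OF MG])
  show False
  proof (rule not_invariant_two_rays[OF w(1,2,5) _ _ w(3,4)])
    show "w \<notin> K" "w' \<notin> K" using fixed_imp_one[OF MG(1)] MG(2) w(6,7) by blast+
    fix N assume N: "N \<in> G"
    obtain N' where N': "N' \<in> G" "N ** N' = mat 1" "N' ** N = mat 1" using inv_G[OF N] by auto
    have "eigs (N ** M ** N') = \<Phi> (N *v x)"
      using \<Phi>[OF pres_K[OF N x] central_conj[OF N N' M]] by simp
    also have "\<dots> = \<Phi> x" by (rule const[OF pres_K[OF N x] x])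
    also have "\<dots> = ray w \<union> ray w'" using \<Phi>[OF x M] w(9) by simp
    finally show "(*v) N ` (ray w \<union> ray w') \<subseteq> ray w \<union> ray w'"
      using eigs_conj[OF N N', of M] w(9) by simp
  qed
qed

end

section \<open>From closeness to the identity to displacement\<close>

lemma matpow_inverse:
  assumes "N ** M = mat 1"
  shows "matpow N i ** matpow M i = mat 1"
proof (induction i)
  case (Suc i)
  have "matpow N (Suc i) = matpow N i ** N" using matpow_add[of N i 1] by simp
  then have "matpow N (Suc i) ** matpow M (Suc i) = matpow N i ** (N ** M) ** matpow M i"
    by (simp only: matpow_Suc matrix_mul_assoc)
  then show ?case using Suc assms by simp
qed simp

text \<open>Exceeds the number of operators of norm at most 2 that are pairwise more than
  \<open>1/17\<close> apart: \<open>1 + 2 * 2 / (1/17) = 69\<close> is the base of the packing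
  bound.\<close>

definition gap_exponent :: "'m::finite itself \<Rightarrow> nat"
  where "gap_exponent _ = nat \<lceil>69 ^ DIM(real^'m^'m) :: real\<rceil> + 1"

text \<open>This root keeps the powers up to \<open>gap_exponent\<close> of an operator of norm at
  most \<open>gap\<close> within norm 2.\<close>

definition gap :: "'m::finite itself \<Rightarrow> real"
  where "gap T = root (gap_exponent T) 2"

lemma gap_gt_1: "gap T > 1"
  by (simp add: gap_def gap_exponent_def)

lemma gap_power: "gap T ^ gap_exponent T = 2"
  unfolding gap_def by (rule real_root_pow_pos2) (simp_all add: gap_exponent_def)

context divisible_cone
begin

text \<open>
  An element with small displacement at \<open>x\<close> is only close to an isometry fixing \<open>x\<close>; by pigeonhole one
  of its powers is close to the identity.
\<close>

lemma ex_large_displacement: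
  "\<exists>x\<in>K. \<forall>M\<in>G. gap TYPE('m) *\<^sub>R x - M *v x \<in> Kc \<longrightarrow>
     M *v x - (1 / gap TYPE('m)) *\<^sub>R x \<in> Kc \<longrightarrow> M = mat 1"
proof -
  obtain x where x: "x \<in> K" and thick: "\<And>M. M \<in> G \<Longrightarrow> small x M \<Longrightarrow> M = mat 1" using ex_thick by auto
  let ?b = "gap TYPE('m)" and ?k = "gap_exponent TYPE('m)"
  have b1: "?b > 1" by (rule gap_gt_1)
  have "M = mat 1" if M: "M \<in> G" "?b *\<^sub>R x - M *v x \<in> Kc" "M *v x - (1 / ?b) *\<^sub>R x \<in> Kc" for M
  proof (rule ccontr)
    assume "M \<noteq> mat 1"
    obtain N where N: "N \<in> G" "M ** N = mat 1" "N ** M = mat 1" using inv_G[OF M(1)] by auto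
    have oM: "obnd x M ?b" by (rule obnd_disp[OF M(1) x M(2)])
    have "(1 / (1 / ?b)) *\<^sub>R x - N *v x \<in> Kc"
      using b1 by (intro disp_inv'[OF N(1,3) M(3)]) simp
    then have oN: "obnd x N ?b" using obnd_disp[OF N(1) x, of ?b] by simp
    have pw: "obnd x (matpow L i) (?b ^ i)" if "obnd x L ?b" for L i
    proof (induction i)
      case 0 then show ?case by (simp add: obnd_one)
    next
      case (Suc i) then show ?case using obnd_mult[OF that Suc] by simp
    qed
    have b2: "?b ^ i \<le> 2" if "i \<le> ?k" for i
      using power_increasing[OF that, of ?b] b1 gap_power[of "TYPE('m)"] by simp
    have pw2: "obnd x (matpow L i) 2" if "obnd x L ?b" "i \<le> ?k" for L i
      by (rule obnd_mono[OF x pw[OF that(1)] b2[OF that(2)]])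
    \<comment> \<open>Multiplying the difference of two powers by \<open>matpow N i\<close>, of norm
      at most 2, gives \<open>2/17\<close>, just below the threshold \<open>1/8\<close>.\<close>
    have sep: "\<not> obnd x (matpow M j - matpow M i) (1/17)" if ij: "i < j" "j \<le> ?k" for i j
    proof
      assume o: "obnd x (matpow M j - matpow M i) (1/17)"
      have "obnd x (matpow N i ** (matpow M j - matpow M i)) (2 * (1/17))"
        using ij by (intro obnd_mult[OF pw2[OF oN] o]) simp
      moreover have "matpow N i ** (matpow M j - matpow M i) = matpow M (j - i) - mat 1"
      proof -
        have "matpow M j = matpow M i ** matpow M (j - i)" using ij matpow_add[of M i "j - i"] by simp
        then show ?thesis by (simp add: mat_mult_diff matrix_mul_assoc matpow_inverse[OF N(3)])
      qed
      ultimately have "small x (matpow M (j - i))"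
        unfolding small_def by (intro exI[of _ "2 * (1/17)"]) simp
      then have "matpow M (j - i) = mat 1" using thick matpow_G[OF M(1)] by blast
      then show False using torsion_free[OF M(1), of "j - i"] ij \<open>M \<noteq> mat 1\<close> by simp
    qed
    have sep': "\<not> obnd x (matpow M i - matpow M j) (1/17)" if "i \<noteq> j" "i \<le> ?k" "j \<le> ?k" for i j
    proof (cases "i < j")
      case True
      show ?thesis
      proof
        assume "obnd x (matpow M i - matpow M j) (1/17)"
        from obnd_minus[OF this] show False using sep[OF True that(3)] by simp
      qed
    qed (use sep[of j i] that in auto)
    have o0: "obnd x 0 (1/17)" using obnd_scale[OF obnd_one, of x 0] obnd_mono[OF x, of 0 0 "1/17"] by simp
    have inj: "inj_on (matpow M) {..<?k}"
    proof (rule inj_onI)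
      fix i j assume "i \<in> {..<?k}" "j \<in> {..<?k}" "matpow M i = matpow M j"
      then show "i = j" using sep'[of i j] o0 by auto
    qed
    have "real (card (matpow M ` {..<?k})) \<le> (1 + 2 * 2 / (1/17)) ^ DIM(real^'m^'m)"
    proof (rule card_obnd_separated[OF x])
      show "obnd x L 2" if "L \<in> matpow M ` {..<?k}" for L using that pw2[OF oM] by auto
      show "\<not> obnd x (L - L') (1/17)" if LL: "L \<in> matpow M ` {..<?k}" "L' \<in> matpow M ` {..<?k}" "L \<noteq> L'" for L L'
      proof -
        obtain i j where ij: "L = matpow M i" "L' = matpow M j" "i < ?k" "j < ?k" using LL by auto
        then have "i \<noteq> j" using LL(3) by auto
        then show ?thesis unfolding ij using ij(3,4) by (intro sep') auto
      qed
    qed auto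
    then have "real ?k \<le> 69 ^ DIM(real^'m^'m)" by (simp add: card_image[OF inj])
    moreover have "real ?k \<ge> 69 ^ DIM(real^'m^'m) + 1"
    proof -
      have "real (nat \<lceil>69 ^ DIM(real^'m^'m) :: real\<rceil>) \<ge> 69 ^ DIM(real^'m^'m)" by (rule real_nat_ceiling_ge)
      then show ?thesis by (simp only: gap_exponent_def of_nat_add of_nat_1 add_le_cancel_right)
    qed
    ultimately show False by linarith
  qed
  then show ?thesis using x by blast
qed

end

section \<open>The Hilbert volume of a small neighbourhood\<close>

text \<open>Gram-Schmidt for the inner product \<open>Q\<close>: fewer than \<open>CARD('n)\<close>
  vectors \<open>Q *v b j\<close> leave a nonzero vector that is orthogonal to all of them in the
  Euclidean sense, and this only needs rescaling.\<close>

lemma ex_gram_orthonormal: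
  fixes Q :: "real^'n::finite^'n"
  assumes sym: "transpose Q = Q" and pos: "\<And>v. v \<noteq> 0 \<Longrightarrow> v \<bullet> (Q *v v) > 0"
  shows "\<exists>b :: 'n \<Rightarrow> real^'n. \<forall>i\<in>S. \<forall>j\<in>S. b i \<bullet> (Q *v b j) = (if i = j then 1 else 0)"
  using finite[of S]
proof (induction S rule: finite_induct)
  case empty then show ?case by simp
next
  case (insert k S)
  have symQ: "v \<bullet> (Q *v w) = w \<bullet> (Q *v v)" for v w
    using dot_lmul_matrix[of v Q w] sym by (metis inner_commute transpose_matrix_vector)
  obtain b where b: "\<And>i j. i \<in> S \<Longrightarrow> j \<in> S \<Longrightarrow> b i \<bullet> (Q *v b j) = (if i = j then 1 else 0)" using insert by blast
  let ?T = "(\<lambda>j. Q *v b j) ` S"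
  have "dim ?T \<le> card ?T" by (rule dim_le_card') simp
  also have "\<dots> \<le> card S" by (rule card_image_le) simp
  also have "\<dots> < CARD('n)" using insert(2) by (metis UNIV_I finite psubset_card_mono psubsetI subset_UNIV)
  finally have "dim ?T < DIM(real^'n)" by simp
  from orthogonal_to_subspace_exists[OF this]
  obtain v where v: "v \<noteq> 0" "\<And>y. y \<in> span ?T \<Longrightarrow> orthogonal v y" by metis
  define q where "q = v \<bullet> (Q *v v)"
  have q: "q > 0" unfolding q_def by (rule pos[OF v(1)])
  define w where "w = (1 / sqrt q) *\<^sub>R v"
  have ww: "w \<bullet> (Q *v w) = 1"
    using q by (simp add: w_def matrix_vector_mult_scaleR q_def[symmetric] real_sqrt_mult_self[symmetric] del: real_sqrt_mult_self)
      (metis less_imp_le real_sqrt_mult_self abs_of_pos)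
  have wb: "w \<bullet> (Q *v b j) = 0" if "j \<in> S" for j
    using v(2)[of "Q *v b j"] that by (simp add: w_def orthogonal_def span_base)
  have bw: "b j \<bullet> (Q *v w) = 0" if "j \<in> S" for j
    using wb[OF that] symQ by metis
  show ?case
    using b ww wb bw insert(2) by (intro exI[of _ "b(k := w)"]) auto
qed

text \<open>The matrix \<open>P\<close> of a \<open>Q\<close>-orthonormal basis carries Euclidean
  balls to \<open>Q\<close>-balls, and \<open>sqrt (det Q) * \<bar>det P\<bar> = 1\<close>. The
  radius \<open>1/2\<close> provides a compact ball inside the open unit ball, to which
  \<open>measure_linear_image_compact\<close> applies.\<close>

lemma gram_volume_unit_ball_ge:
  fixes Q :: "real^'n::finite^'n"
  assumes sym: "transpose Q = Q" and pos: "\<And>v. v \<noteq> 0 \<Longrightarrow> v \<bullet> (Q *v v) > 0"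
  shows "det Q > 0"
    and "gram_volume Q {v. sqrt (v \<bullet> (Q *v v)) < 1} \<ge> measure lebesgue (cball (0::real^'n) (1/2))"
proof -
  obtain b :: "'n \<Rightarrow> real^'n" where b: "\<And>i j. b i \<bullet> (Q *v b j) = (if i = j then 1 else 0)"
    using ex_gram_orthonormal[OF sym pos, of UNIV] by auto
  define P :: "real^'n^'n" where "P = (\<chi> r c. b c $ r)"
  have PQP: "transpose P ** (Q ** P) = mat 1"
  proof -
    have "(transpose P ** (Q ** P)) $ i $ j = b i \<bullet> (Q *v b j)" for i j
      by (simp add: matrix_matrix_mult_def transpose_def P_def inner_vec_def matrix_vector_mult_def)
    then show ?thesis by (simp add: vec_eq_iff mat_def b)
  qed
  then have "det (transpose P ** (Q ** P)) = 1" by simp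
  then have dP: "det P * det P * det Q = 1" by (simp add: det_mul det_transpose ac_simps)
  then have P0: "det P \<noteq> 0" by auto
  have "det P * det P > 0" using P0 by (simp only: zero_less_mult_iff) linarith
  then show d: "det Q > 0" using dP by (metis zero_less_mult_pos zero_less_one)
  have sq: "sqrt (det Q) * \<bar>det P\<bar> = 1"
  proof -
    have "sqrt (det Q) * \<bar>det P\<bar> = sqrt (det P * det P * det Q)" by (simp add: real_sqrt_mult)
    then show ?thesis by (simp only: dP real_sqrt_one)
  qed
  have form: "(P *v u) \<bullet> (Q *v (P *v u)) = u \<bullet> u" for u
  proof -
    have "(P *v u) \<bullet> (Q *v (P *v u)) = u \<bullet> (transpose P *v (Q *v (P *v u)))"
      using dot_lmul_matrix[of "Q *v (P *v u)" P u] by (simp add: inner_commute[of _ u] inner_commute[of _ "P *v u"])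
    also have "\<dots> = u \<bullet> u" by (simp add: matrix_vector_mul_assoc PQP)
    finally show ?thesis .
  qed
  let ?S = "{v. sqrt (v \<bullet> (Q *v v)) < 1}"
  have opS: "open ?S"
    by (intro open_Collect_less continuous_intros linear_continuous_on) (simp_all add: linear_conv_bounded_linear[symmetric])
  obtain P' where "P ** P' = mat 1" using P0 invertible_det_nz unfolding invertible_def by blast
  then have inv: "P *v (P' *v v) = v" for v by (simp add: matrix_vector_mul_assoc)
  have "?S \<subseteq> (*v) P ` cball 0 1"
  proof
    fix v assume "v \<in> ?S"
    then have "sqrt ((P' *v v) \<bullet> (P' *v v)) < 1"
      using form[of "P' *v v"] by (simp add: inv)
    then have "P' *v v \<in> cball 0 1" by (simp add: norm_eq_sqrt_inner)
    then show "v \<in> (*v) P ` cball 0 1" using inv by (metis image_eqI)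
  qed
  moreover have "bounded ((*v) P ` cball 0 1)"
    by (intro bounded_linear_image) (auto simp: linear_conv_bounded_linear[symmetric])
  ultimately have bS: "bounded ?S" by (rule bounded_subset[rotated])
  have mS: "?S \<in> lmeasurable" using opS bS by (rule lmeasurable_open[rotated])
  have "(*v) P ` cball 0 (1/2) \<subseteq> ?S"
  proof (rule image_subsetI)
    fix u :: "real^'n" assume u: "u \<in> cball 0 (1/2)"
    have "sqrt ((P *v u) \<bullet> (Q *v (P *v u))) = norm u" by (simp only: form norm_eq_sqrt_inner)
    then show "P *v u \<in> ?S" using u by (simp del: real_sqrt_lt_1_iff)
  qed
  moreover have c: "compact ((*v) P ` cball 0 (1/2))"
    by (intro compact_continuous_image matrix_vector_mult_linear_continuous_on) simp
  ultimately have "measure lebesgue ((*v) P ` cball 0 (1/2)) \<le> measure lebesgue ?S"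
    using mS by (intro measure_mono_fmeasurable) (auto simp: lmeasurable_compact fmeasurableD)
  then have "\<bar>det P\<bar> * measure lebesgue (cball (0::real^'n) (1/2)) \<le> measure lborel ?S"
    using opS by (simp add: measure_linear_image_compact measure_completion)
  then have "sqrt (det Q) * (\<bar>det P\<bar> * measure lebesgue (cball (0::real^'n) (1/2))) \<le> sqrt (det Q) * measure lborel ?S"
    using d by (intro mult_left_mono) auto
  then show "gram_volume Q ?S \<ge> measure lebesgue (cball (0::real^'n) (1/2))"
    unfolding gram_volume_def using sq by (simp add: mult.assoc[symmetric])
qed

text \<open>If the ray leaves \<open>C\<close> at parameter \<open>d\<close>, the quotient is
  \<open>1/d\<close>, and \<open>1/s < d\<close> says that the point at parameter \<open>1/s\<close>
  still lies in \<open>C\<close>. Boundary points are thus traded for membership in an open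
  set.\<close>

lemma boundary_hit_less:
  fixes C :: "(real^'n::finite) set"
  assumes C: "open C" "convex C" "bounded C" and z: "z \<in> C" and v: "v \<noteq> 0" and s: "s > 0"
  shows "norm v / norm (z - boundary_hit C z v) < s \<longleftrightarrow> z + (1/s) *\<^sub>R v \<in> C"
proof -
  have "z \<in> interior C" using C z by (simp add: interior_open)
  then obtain d where d: "d > 0" "z + d *\<^sub>R v \<in> frontier C"
      "\<And>e. 0 \<le> e \<Longrightarrow> e < d \<Longrightarrow> z + e *\<^sub>R v \<in> interior C"
    using ray_to_frontier[OF C(3) _ v] by metis
  have after: "z + t *\<^sub>R v \<notin> closure C" if "t > d" for t
  proof
    assume "z + t *\<^sub>R v \<in> closure C"
    moreover have "z + d *\<^sub>R v \<in> open_segment z (z + t *\<^sub>R v)"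
    proof -
      have "z + d *\<^sub>R v = (1 - d/t) *\<^sub>R z + (d/t) *\<^sub>R (z + t *\<^sub>R v)"
        using that d(1) by (simp add: scaleR_add_right scaleR_diff_left)
      moreover have "z \<noteq> z + t *\<^sub>R v" using that d(1) v by simp
      ultimately show ?thesis using that d(1) unfolding in_segment by (intro conjI exI[of _ "d/t"]) auto
    qed
    ultimately have "z + d *\<^sub>R v \<in> interior C"
      using in_interior_closure_convex_segment[OF C(2) \<open>z \<in> interior C\<close>] by blast
    then show False using d(2) by (simp add: frontier_def)
  qed
  have "boundary_hit C z v = z + d *\<^sub>R v"
    unfolding boundary_hit_def
  proof (rule the_equality)
    show "z + d *\<^sub>R v \<in> frontier C \<and> (\<exists>t>0. z + d *\<^sub>R v = z + t *\<^sub>R v)" using d by blast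
    fix w assume "w \<in> frontier C \<and> (\<exists>t>0. w = z + t *\<^sub>R v)"
    then obtain t where t: "t > 0" "w = z + t *\<^sub>R v" "w \<in> frontier C" by auto
    have "\<not> t < d" using d(3)[of t] t by (auto simp: frontier_def)
    moreover have "\<not> t > d" using after[of t] t by (auto simp: frontier_def)
    ultimately show "w = z + d *\<^sub>R v" using t by auto
  qed
  then have "norm v / norm (z - boundary_hit C z v) = 1 / d" using d(1) v by simp
  also have "1 / d < s \<longleftrightarrow> 1 / s < d" using d(1) s by (simp add: field_simps)
  also have "1 / s < d \<longleftrightarrow> z + (1/s) *\<^sub>R v \<in> C"
  proof
    assume "1 / s < d"
    then show "z + (1/s) *\<^sub>R v \<in> C" using d(3)[of "1/s"] s C by (simp add: interior_open)
  next
    assume m: "z + (1/s) *\<^sub>R v \<in> C"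
    have "\<not> 1/s > d" using after[of "1/s"] m closure_subset by blast
    moreover have "1/s \<noteq> d" using m d(2) C by (auto simp: frontier_def interior_open)
    ultimately show "1/s < d" by simp
  qed
  finally show ?thesis .
qed

text \<open>The Finsler norm is the mean of the two quotients \<open>a\<close> and \<open>b\<close>,
  and \<open>a + b < 2\<close> holds iff some \<open>s\<close> has \<open>a < s\<close> and
  \<open>b < 2 - s\<close>. This writes the unit ball as a union of open sets.\<close>

lemma hilbert_finsler_less_1:
  fixes C :: "(real^'n::finite) set"
  assumes C: "open C" "convex C" "bounded C" and z: "z \<in> C"
  shows "hilbert_finsler C z v < 1 \<longleftrightarrow>
    (\<exists>s\<in>{0<..<2}. z + (1/s) *\<^sub>R v \<in> C \<and> z - (1/(2 - s)) *\<^sub>R v \<in> C)"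
proof (cases "v = 0")
  case True
  then show ?thesis using z by (auto simp: hilbert_finsler_def intro!: exI[of _ 1])
next
  case False
  define a where "a = norm v / norm (z - boundary_hit C z v)"
  define b where "b = norm (- v) / norm (z - boundary_hit C z (- v))"
  have F: "hilbert_finsler C z v = (a + b) / 2"
    using False by (simp add: hilbert_finsler_def a_def b_def field_simps)
  have ab: "a \<ge> 0" "b \<ge> 0" by (simp_all add: a_def b_def)
  have a: "a < s \<longleftrightarrow> z + (1/s) *\<^sub>R v \<in> C" if "s > 0" for s
    unfolding a_def by (rule boundary_hit_less[OF C z False that])
  have b: "b < s \<longleftrightarrow> z - (1/s) *\<^sub>R v \<in> C" if "s > 0" for s
    unfolding b_def using boundary_hit_less[OF C z _ that, of "- v"] False by simp
  show ?thesis
  proof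
    assume "hilbert_finsler C z v < 1"
    then have "a < 2 - b" by (simp add: F)
    then obtain s where s: "a < s" "s < 2 - b" using dense by blast
    then show "\<exists>s\<in>{0<..<2}. z + (1/s) *\<^sub>R v \<in> C \<and> z - (1/(2 - s)) *\<^sub>R v \<in> C"
      using a[of s] b[of "2 - s"] ab by (intro bexI[of _ s]) auto
  next
    assume "\<exists>s\<in>{0<..<2}. z + (1/s) *\<^sub>R v \<in> C \<and> z - (1/(2 - s)) *\<^sub>R v \<in> C"
    then obtain s where "0 < s" "s < 2" "a < s" "b < 2 - s" using a b by auto
    then show "hilbert_finsler C z v < 1" by (simp add: F)
  qed
qed

lemma hilbert_ball:
  fixes C :: "(real^'n::finite) set"
  assumes C: "open C" "convex C" "bounded C" and z: "z \<in> C"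
  shows "open {v. hilbert_finsler C z v < 1}"
    and "{v. hilbert_finsler C z v < 1} \<subseteq> {v. z + (1/2) *\<^sub>R v \<in> C \<and> z - (1/2) *\<^sub>R v \<in> C}"
    and "0 \<in> {v. hilbert_finsler C z v < 1}"
proof -
  have "{v. hilbert_finsler C z v < 1} =
      (\<Union>s\<in>{0<..<2}. (\<lambda>v. z + (1/s) *\<^sub>R v) -` C \<inter> (\<lambda>v. z - (1/(2 - s)) *\<^sub>R v) -` C)"
    by (auto simp: hilbert_finsler_less_1[OF C z])
  also have "open \<dots>"
    by (intro open_UN ballI open_Int open_vimage C continuous_intros)
  finally show "open {v. hilbert_finsler C z v < 1}" .
  show "0 \<in> {v. hilbert_finsler C z v < 1}" by (simp add: hilbert_finsler_def)
  have shrink: "z + t *\<^sub>R w \<in> C" if "z + u *\<^sub>R w \<in> C" "0 \<le> t" "t \<le> u" "u > 0" for t u w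
  proof -
    have "(1 - t/u) *\<^sub>R z + (t/u) *\<^sub>R (z + u *\<^sub>R w) \<in> C" using that z by (intro convexD[OF C(2)]) auto
    then show ?thesis using that by (simp add: scaleR_add_right scaleR_diff_left)
  qed
  show "{v. hilbert_finsler C z v < 1} \<subseteq> {v. z + (1/2) *\<^sub>R v \<in> C \<and> z - (1/2) *\<^sub>R v \<in> C}"
  proof
    fix v assume "v \<in> {v. hilbert_finsler C z v < 1}"
    then obtain s where s: "0 < s" "s < 2" "z + (1/s) *\<^sub>R v \<in> C" "z + (1/(2 - s)) *\<^sub>R (- v) \<in> C"
      by (auto simp: hilbert_finsler_less_1[OF C z])
    have "z + (1/2) *\<^sub>R v \<in> C" using s by (intro shrink[OF s(3)]) (auto simp: field_simps)
    moreover have "z + (1/2) *\<^sub>R (- v) \<in> C" using s by (intro shrink[OF s(4)]) (auto simp: field_simps)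
    ultimately show "v \<in> {v. z + (1/2) *\<^sub>R v \<in> C \<and> z - (1/2) *\<^sub>R v \<in> C}" by simp
  qed
qed

text \<open>The Macbeath region of \<open>C\<close> at \<open>y\<close>, moved to the origin. In
  homogeneous coordinates it is a slice, parallel to the affine hyperplane, of the open unit ball of
  the order-unit norm at the point over \<open>y\<close>.\<close>

definition symmetral :: "(real^'n) set \<Rightarrow> real^'n \<Rightarrow> (real^'n::finite) set"
  where "symmetral C y = {v. y + v \<in> C \<and> y - v \<in> C}"

lemma symmetral:
  fixes C :: "(real^'n::finite) set"
  assumes C: "open C" "convex C" "bounded C" and y: "y \<in> C"
  shows "open (symmetral C y)" "bounded (symmetral C y)" "0 \<in> symmetral C y"
proof -
  have "symmetral C y = (\<lambda>v. y + v) -` C \<inter> (\<lambda>v. y - v) -` C" by (auto simp: symmetral_def)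
  also have "open \<dots>" by (intro open_Int open_vimage C continuous_intros)
  finally show "open (symmetral C y)" .
  have "symmetral C y \<subseteq> (\<lambda>z. z - y) ` C" by (force simp: symmetral_def image_iff)
  then show "bounded (symmetral C y)"
    by (rule bounded_subset[rotated]) (rule bounded_translation_minus[OF C(3)])
  show "0 \<in> symmetral C y" using y by (simp add: symmetral_def)
qed

text \<open>For \<open>v\<close> in the Hilbert ball at \<open>y + r u\<close>, the points
  \<open>y + r u + v/2\<close> and \<open>y + r u - v/2\<close> lie in \<open>C\<close>. Averaging
  each with \<open>y - u\<close> in the proportion 1 : r cancels \<open>u\<close> and leaves
  \<open>y\<close> displaced by \<open>v / (2 (1 + r))\<close> either way.\<close>

lemma hilbert_ball_subset_symmetral:
  fixes C :: "(real^'n::finite) set"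
  assumes C: "open C" "convex C" "bounded C" and u: "u \<in> symmetral C y" and r: "0 \<le> r"
    and z: "y + r *\<^sub>R u \<in> C"
  shows "{v. hilbert_finsler C (y + r *\<^sub>R u) v < 1} \<subseteq> (*\<^sub>R) (2 * (1 + r)) ` symmetral C y"
proof
  fix v assume "v \<in> {v. hilbert_finsler C (y + r *\<^sub>R u) v < 1}"
  then have v: "y + r *\<^sub>R u + (1/2) *\<^sub>R v \<in> C" "y + r *\<^sub>R u + (1/2) *\<^sub>R (- v) \<in> C"
    using hilbert_ball(2)[OF C z] by auto
  have yu: "y - u \<in> C" using u by (simp add: symmetral_def)
  have *: "y + (1 / (2 * (1 + r))) *\<^sub>R w \<in> C" if w: "y + r *\<^sub>R u + (1/2) *\<^sub>R w \<in> C" for w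
  proof -
    define t where "t = 1 / (1 + r)"
    have t: "t \<ge> 0" "t * r \<ge> 0" "t + t * r = 1" using r by (simp_all add: t_def field_simps)
    have "t *\<^sub>R (y + r *\<^sub>R u + (1/2) *\<^sub>R w) + (t * r) *\<^sub>R (y - u) \<in> C"
      by (rule convexD[OF C(2) w yu t])
    also have "t *\<^sub>R (y + r *\<^sub>R u + (1/2) *\<^sub>R w) + (t * r) *\<^sub>R (y - u) = (t + t * r) *\<^sub>R y + (t / 2) *\<^sub>R w"
      by (simp add: scaleR_add_right scaleR_diff_right scaleR_add_left)
    also have "\<dots> = y + (1 / (2 * (1 + r))) *\<^sub>R w" unfolding t(3) by (simp add: t_def distrib_left[symmetric] mult.commute)
    finally show ?thesis .
  qed
  have "(1 / (2 * (1 + r))) *\<^sub>R v \<in> symmetral C y"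
    using *[OF v(1)] *[OF v(2)] by (simp add: symmetral_def)
  then show "v \<in> (*\<^sub>R) (2 * (1 + r)) ` symmetral C y"
    using r by (intro image_eqI[of _ _ "(1 / (2 * (1 + r))) *\<^sub>R v"]) auto
qed

text \<open>With \<open>W = symmetral C y\<close>, the integrand is at least a Euclidean ball volume
  divided by the volume of \<open>2 (1 + r) W\<close>, and \<open>D\<close> has the volume of
  \<open>r W\<close>. The volume of \<open>W\<close>, which depends on \<open>C\<close> and
  \<open>y\<close>, cancels.\<close>

lemma hilbert_mass_ge:
  fixes C :: "(real^'n::finite) set"
  assumes C: "open C" "convex C" "bounded C" and y: "y \<in> C" and r: "0 < r" "r \<le> 1"
    and g: "\<And>z. z \<in> C \<Longrightarrow> transpose (g z) = g z" "\<And>z v. z \<in> C \<Longrightarrow> v \<noteq> 0 \<Longrightarrow> v \<bullet> (g z *v v) > 0"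
  defines "D \<equiv> (\<lambda>v. y + r *\<^sub>R v) ` symmetral C y"
  shows "open D" "D \<subseteq> C"
    and "(\<integral>\<^sup>+z\<in>D. ennreal (hilbert_density C g z * sqrt (det (g z))) \<partial>lborel)
      \<ge> ennreal (measure lebesgue (cball (0::real^'n) (1/2)) * (r / (2 * (1 + r))) ^ CARD('n))"
proof -
  let ?W = "symmetral C y" and ?c = "2 * (1 + r)" and ?k = "measure lebesgue (cball (0::real^'n) (1/2))"
  note W = symmetral[OF C y]
  have D_eq: "D = (+) y ` (*\<^sub>R) r ` ?W" by (simp add: D_def image_image)
  show opD: "open D" unfolding D_eq using r W by (intro open_translation open_scaling) auto
  have inC: "y + r *\<^sub>R u \<in> C" if "u \<in> ?W" for u
  proof -
    have "(1 - r) *\<^sub>R y + r *\<^sub>R (y + u) \<in> C"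
      using that y r by (intro convexD[OF C(2)]) (auto simp: symmetral_def)
    then show ?thesis by (simp add: scaleR_add_right scaleR_diff_left)
  qed
  show DC: "D \<subseteq> C" using inC by (auto simp: D_def)
  define m where "m = measure lebesgue ?W"
  have Wm: "?W \<in> lmeasurable" using W by (intro lmeasurable_open)
  obtain e where e: "e > 0" "ball 0 e \<subseteq> ?W" using W(1,3) by (meson openE)
  have mpos: "m > 0" unfolding m_def by (rule measure_pos_interior[OF Wm e(2,1)])
  have dens: "hilbert_density C g z * sqrt (det (g z)) \<ge> ?k / (?c ^ CARD('n) * m)" if zD: "z \<in> D" for z
  proof -
    obtain u where u: "u \<in> ?W" "z = y + r *\<^sub>R u" using zD by (auto simp: D_def)
    have zC: "z \<in> C" using zD DC by blast
    let ?B = "{v. hilbert_finsler C z v < 1}"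
    note B = hilbert_ball[OF C zC]
    have Bsub: "?B \<subseteq> (*\<^sub>R) ?c ` ?W"
      unfolding u(2) using r u inC by (intro hilbert_ball_subset_symmetral C) auto
    have cWb: "bounded ((*\<^sub>R) ?c ` ?W)" using W(2) by (rule bounded_scaling)
    have cWo: "open ((*\<^sub>R) ?c ` ?W)" using W(1) r by (intro open_scaling) auto
    have cWm: "(*\<^sub>R) ?c ` ?W \<in> lmeasurable" using cWb cWo by (intro lmeasurable_open)
    have Bm: "?B \<in> lmeasurable" using B(1) bounded_subset[OF cWb Bsub] by (intro lmeasurable_open)
    obtain e where e: "e > 0" "ball 0 e \<subseteq> ?B" using B(1,3) by (meson openE)
    have Bpos: "measure lebesgue ?B > 0" by (rule measure_pos_interior[OF Bm e(2,1)])
    have "measure lebesgue ?B \<le> measure lebesgue ((*\<^sub>R) ?c ` ?W)"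
      using Bsub Bm cWm by (intro measure_mono_fmeasurable fmeasurableD)
    also have "\<dots> = ?c ^ CARD('n) * m" using r by (simp add: measure_scaleR_image m_def)
    finally have Ble: "measure lborel ?B \<le> ?c ^ CARD('n) * m" using B(1) by (simp add: measure_completion)
    have Bpos': "measure lborel ?B > 0" using Bpos B(1) by (simp add: measure_completion)
    note G = gram_volume_unit_ball_ge[OF g(1)[OF zC] g(2)[OF zC]]
    have s: "sqrt (det (g z)) > 0" using G(1) by simp
    let ?V = "gram_volume (g z) {v. sqrt (v \<bullet> (g z *v v)) < 1}"
    have "hilbert_density C g z * sqrt (det (g z)) = ?V / measure lborel ?B"
      using s by (simp add: hilbert_density_def gram_volume_def)
    moreover have "?V / measure lborel ?B \<ge> ?k / (?c ^ CARD('n) * m)"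
      by (rule frac_le[OF order_trans[OF measure_nonneg G(2)] G(2) Bpos' Ble])
    ultimately show ?thesis by simp
  qed
  have mD: "emeasure lborel D = ennreal (r ^ CARD('n) * m)"
  proof -
    have "bounded D" using DC C(3) by (rule bounded_subset[rotated])
    then have Dm: "D \<in> lmeasurable" using opD by (rule lmeasurable_open)
    have "measure lebesgue D = r ^ CARD('n) * m"
      unfolding D_eq using r by (simp add: measure_translation measure_scaleR_image m_def)
    then have "emeasure lebesgue D = ennreal (r ^ CARD('n) * m)"
      using Dm by (simp add: emeasure_eq_measure2)
    then show ?thesis using opD by simp
  qed
  have "?k * (r / ?c) ^ CARD('n) = ?k / (?c ^ CARD('n) * m) * (r ^ CARD('n) * m)"
    using mpos by (simp add: power_divide)
  then have "ennreal (?k * (r / ?c) ^ CARD('n)) = ennreal (?k / (?c ^ CARD('n) * m)) * emeasure lborel D"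
    unfolding mD using mpos r by (simp add: ennreal_mult[symmetric])
  also have "\<dots> = (\<integral>\<^sup>+z\<in>D. ennreal (?k / (?c ^ CARD('n) * m)) \<partial>lborel)"
    using opD by (simp add: nn_integral_cmult_indicator)
  also have "\<dots> \<le> (\<integral>\<^sup>+z\<in>D. ennreal (hilbert_density C g z * sqrt (det (g z))) \<partial>lborel)"
    using dens by (intro nn_integral_mono) (auto simp: indicator_def intro!: ennreal_leI)
  finally show "(\<integral>\<^sup>+z\<in>D. ennreal (hilbert_density C g z * sqrt (det (g z))) \<partial>lborel)
      \<ge> ennreal (?k * (r / ?c) ^ CARD('n))" .
qed

section \<open>Determinants, convexity and connectedness\<close>

lemma det_scaleR: "det (c *\<^sub>R M) = c ^ CARD('m) * det (M :: real^'m::finite^'m)"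
proof -
  have "c *\<^sub>R M = (\<chi> i. c *s M $ i)" by (simp add: vec_eq_iff)
  then have "det (c *\<^sub>R M) = prod (\<lambda>_. c) (UNIV :: 'm set) * det (\<chi> i. M $ i)"
    by (simp only: det_rows_mul)
  then show ?thesis by simp
qed

text \<open>Points strictly between an interior point and a point of the closure are interior. From
  \<open>d\<close> this covers the side of \<open>a\<close>, and by symmetry that of
  \<open>b\<close>.\<close>

lemma open_segment_in_convex:
  fixes C :: "'a::euclidean_space set"
  assumes C: "open C" "convex C" and a: "a \<in> closure C" and b: "b \<in> closure C"
    and d: "d \<in> open_segment a b" "d \<in> C" and v: "0 < v" "v < 1"
  shows "(1 - v) *\<^sub>R a + v *\<^sub>R b \<in> C"
proof -
  have left: "(1 - v) *\<^sub>R a + v *\<^sub>R b \<in> C"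
    if a: "a \<in> closure C" and k: "0 < v" "v < k" "k < 1" "(1 - k) *\<^sub>R a + k *\<^sub>R b \<in> C" "a \<noteq> b" for a b :: 'a and v k
  proof -
    define d where "d = (1 - k) *\<^sub>R a + k *\<^sub>R b"
    have "d - a = k *\<^sub>R (b - a)" by (simp add: d_def algebra_simps)
    then have "a \<noteq> d" using k by auto
    have "(1 - v) *\<^sub>R a + v *\<^sub>R b = a + (v / k) *\<^sub>R (d - a)"
      using k(1,2) by (simp add: d_def algebra_simps)
    also have "\<dots> = (1 - (1 - v / k)) *\<^sub>R d + (1 - v / k) *\<^sub>R a" by (simp add: algebra_simps)
    finally have "(1 - v) *\<^sub>R a + v *\<^sub>R b \<in> open_segment d a"
      using k \<open>a \<noteq> d\<close> unfolding in_segment by (intro conjI exI[of _ "1 - v / k"]) auto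
    then show ?thesis
      using in_interior_closure_convex_segment[OF C(2) _ a, of d] k(4) C(1) by (auto simp: interior_open d_def)
  qed
  obtain k where k: "0 < k" "k < 1" "d = (1 - k) *\<^sub>R a + k *\<^sub>R b" "a \<noteq> b" using d(1) by (auto simp: in_segment)
  consider "v = k" | "v < k" | "v > k" by linarith
  then show ?thesis
  proof cases
    case 1 then show ?thesis using d(2) k(3) by simp
  next
    case 2 then show ?thesis using left[OF a v(1)] k d(2) by blast
  next
    case 3
    have "(1 - (1 - v)) *\<^sub>R b + (1 - v) *\<^sub>R a \<in> C"
      by (rule left[OF b, of "1 - v" "1 - k"]) (use 3 v k d(2) in \<open>auto simp: add.commute\<close>)
    then show ?thesis by (simp add: add.commute)
  qed
qed

text \<open>Projective data determine membership in a cone only up to sign; connectedness makes the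
  sign uniform. This serves for images of a cone under a matrix and for cones taken from two
  patches.\<close>

lemma connected_symmetric_dichotomy:
  fixes K :: "'a::real_normed_vector set"
  assumes "connected T" "open K" "\<And>x. x \<in> K \<Longrightarrow> - x \<notin> K" "\<And>x. x \<in> T \<Longrightarrow> x \<in> K \<or> - x \<in> K"
  shows "T \<subseteq> K \<or> (\<forall>x\<in>T. - x \<in> K)"
proof -
  have "open (uminus -` K)" using assms(2) by (intro open_vimage continuous_intros)
  moreover have "K \<inter> (uminus -` K) \<inter> T = {}" using assms(3) by auto
  moreover have "T \<subseteq> K \<union> (uminus -` K)" using assms(4) by auto
  ultimately have "K \<inter> T = {} \<or> (uminus -` K) \<inter> T = {}" using connectedD[OF assms(1,2)] by blast
  then show ?thesis using assms(4) by blast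
qed

section \<open>The cone over a subset of an affine patch\<close>

definition dehom :: "real^('n::finite option) \<Rightarrow> real^'n"
  where "dehom v = (\<chi> j. v $ Some j / v $ None)"

lemma homog_None [simp]: "homog y $ None = 1"
  by (simp add: homog_def)

lemma dehom_homog: "t \<noteq> 0 \<Longrightarrow> dehom (t *\<^sub>R homog y) = y"
  by (simp add: dehom_def homog_def vec_eq_iff)

lemma homog_dehom: "v $ None \<noteq> 0 \<Longrightarrow> v $ None *\<^sub>R homog (dehom v) = v"
  by (simp add: dehom_def homog_def vec_eq_iff split: option.split)

lemma homog_convex: "u + v = 1 \<Longrightarrow> homog (u *\<^sub>R a + v *\<^sub>R b) = u *\<^sub>R homog a + v *\<^sub>R homog b"
  by (simp add: homog_def vec_eq_iff split: option.split)

lemma homog_continuous: "continuous_on S homog"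
  unfolding homog_def
proof (rule continuous_on_vec_lambda)
  fix i :: "'a option"
  show "continuous_on S (\<lambda>y. case i of None \<Rightarrow> 1 | Some j \<Rightarrow> y $ j)"
    by (cases i) (auto intro!: continuous_intros)
qed

lemma dehom_continuous: "continuous_on {v. v $ None > 0} dehom"
  unfolding dehom_def by (intro continuous_on_vec_lambda continuous_intros) auto

definition cone_over :: "real^('n option)^('n option) \<Rightarrow> (real^'n) set \<Rightarrow> (real^('n::finite option)) set"
  where "cone_over A C = {t *\<^sub>R (A *v homog y) | t y. t > 0 \<and> y \<in> C}"

locale patch_cone =
  fixes A B :: "real^('n::finite option)^('n option)" and C :: "(real^'n) set"
  assumes AB: "A ** B = mat 1" "B ** A = mat 1"
    and C: "open C" "convex C" "bounded C" "C \<noteq> {}"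
begin

lemma BA [simp]: "B *v (A *v x) = x" "A *v (B *v x) = x"
  by (simp_all add: matrix_vector_mul_assoc AB)

lemma mem_cone: "x \<in> cone_over A C \<longleftrightarrow> (B *v x) $ None > 0 \<and> dehom (B *v x) \<in> C"
proof
  assume "x \<in> cone_over A C"
  then obtain t y where "x = t *\<^sub>R (A *v homog y)" "t > 0" "y \<in> C" by (auto simp: cone_over_def)
  then show "(B *v x) $ None > 0 \<and> dehom (B *v x) \<in> C"
    by (simp add: matrix_vector_mult_scaleR dehom_homog)
next
  assume *: "(B *v x) $ None > 0 \<and> dehom (B *v x) \<in> C"
  have "x = A *v (B *v x)" by simp
  also have "\<dots> = (B *v x) $ None *\<^sub>R (A *v homog (dehom (B *v x)))"
    using * homog_dehom[of "B *v x"] by (simp flip: matrix_vector_mult_scaleR)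
  finally show "x \<in> cone_over A C" unfolding cone_over_def using * by blast
qed

lemma coneI: "t > 0 \<Longrightarrow> y \<in> C \<Longrightarrow> t *\<^sub>R (A *v homog y) \<in> cone_over A C"
  by (auto simp: cone_over_def)

lemma cone_pos: "x \<in> cone_over A C \<Longrightarrow> (B *v x) $ None > 0"
  by (simp add: mem_cone)

lemma open_cone: "open (cone_over A C)"
proof -
  have "open ({v. v $ None > 0} \<inter> dehom -` C)"
    by (rule continuous_open_preimage[OF dehom_continuous _ C(1)]) (intro open_Collect_less continuous_intros)
  then have "open ((*v) B -` ({v. v $ None > 0} \<inter> dehom -` C))"
    by (rule open_vimage) (rule matrix_vector_mult_linear_continuous_on)
  also have "(*v) B -` ({v. v $ None > 0} \<inter> dehom -` C) = cone_over A C"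
    by (auto simp: mem_cone)
  finally show ?thesis .
qed

lemma cone_nonempty: "cone_over A C \<noteq> {}"
  using C(4) coneI[of 1] by fastforce

lemma cone_scale: "x \<in> cone_over A C \<Longrightarrow> c > 0 \<Longrightarrow> c *\<^sub>R x \<in> cone_over A C"
proof -
  assume "x \<in> cone_over A C" "c > 0"
  then obtain t y where "x = t *\<^sub>R (A *v homog y)" "t > 0" "y \<in> C" by (auto simp: cone_over_def)
  then show ?thesis using coneI[of "c * t" y] \<open>c > 0\<close> by simp
qed

lemma cone_add: "x \<in> cone_over A C \<Longrightarrow> x' \<in> cone_over A C \<Longrightarrow> x + x' \<in> cone_over A C"
proof -
  assume "x \<in> cone_over A C" "x' \<in> cone_over A C"
  then obtain t y t' y' where 1: "x = t *\<^sub>R (A *v homog y)" "t > 0" "y \<in> C"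
     "x' = t' *\<^sub>R (A *v homog y')" "t' > 0" "y' \<in> C" by (auto simp: cone_over_def)
  let ?u = "t / (t + t')" and ?v = "t' / (t + t')"
  have uv: "?u + ?v = 1" using 1 by (simp add: add_divide_distrib[symmetric])
  have "x + x' = (t + t') *\<^sub>R (A *v homog (?u *\<^sub>R y + ?v *\<^sub>R y'))"
    unfolding homog_convex[OF uv] using 1 by (simp add: mv_simps scaleR_add_right)
  moreover have "?u *\<^sub>R y + ?v *\<^sub>R y' \<in> C" using 1 uv by (intro convexD[OF C(2)]) auto
  ultimately show ?thesis using coneI[of "t + t'"] 1 by simp
qed

lemma norm_homog_bounded: "\<exists>R. \<forall>y\<in>closure C. norm (A *v homog y) \<le> R"
proof -
  have "compact ((\<lambda>y. A *v homog y) ` closure C)"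
    using C(3) homog_continuous
    by (intro compact_continuous_image continuous_on_compose2[OF matrix_vector_mult_linear_continuous_on[of UNIV]]) auto
  then show ?thesis by (auto simp: bounded_iff dest!: compact_imp_bounded)
qed

text \<open>The functional is \<open>R\<close> times the coordinate \<open>None\<close> after
  \<open>B\<close>. On \<open>t\<close> times a point \<open>A *v homog y\<close> it equals
  \<open>R * t\<close>, while the norm is at most \<open>R * t\<close>.\<close>

lemma cone_proper: "\<exists>a. \<forall>x\<in>cone_over A C. norm x \<le> a \<bullet> x"
proof -
  obtain R where R: "\<And>y. y \<in> closure C \<Longrightarrow> norm (A *v homog y) \<le> R" using norm_homog_bounded by blast
  have "norm x \<le> (R *\<^sub>R (axis None 1 v* B)) \<bullet> x" if xC: "x \<in> cone_over A C" for x
  proof -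
    obtain t y where x: "x = t *\<^sub>R (A *v homog y)" "t > 0" "y \<in> C" using xC by (auto simp: cone_over_def)
    have "(R *\<^sub>R (axis None 1 v* B)) \<bullet> x = R * t"
      by (simp add: dot_lmul_matrix x matrix_vector_mult_scaleR inner_axis')
    moreover have "norm x \<le> R * t" using x R[of y] closure_subset[of C] by auto
    ultimately show ?thesis by (simp only:)
  qed
  then show ?thesis by blast
qed

text \<open>A limit of points of the cone could a priori lie at height 0, outside the patch.
  Boundedness of \<open>C\<close> bounds the norm by \<open>R\<close> times the height, so a nonzero
  limit has positive height, where \<open>dehom\<close> is continuous.\<close>

lemma closure_cone:
  assumes "p \<in> closure (cone_over A C)" "p \<noteq> 0"
  shows "\<exists>t>0. \<exists>a\<in>closure C. p = t *\<^sub>R (A *v homog a)"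
proof -
  obtain f where f: "\<And>n. f n \<in> cone_over A C" "f \<longlonglongrightarrow> p" using assms(1) by (auto simp: closure_sequential)
  have Bf: "(\<lambda>n. B *v f n) \<longlonglongrightarrow> B *v p"
    by (rule isCont_tendsto_compose[OF _ f(2)]) (simp add: linear_continuous_at linear_conv_bounded_linear[symmetric])
  then have nl: "(\<lambda>n. (B *v f n) $ None) \<longlonglongrightarrow> (B *v p) $ None" by (rule tendsto_vec_nth)
  obtain a where a: "\<And>x. x \<in> cone_over A C \<Longrightarrow> norm x \<le> a \<bullet> x" using cone_proper by auto
  obtain R where R: "\<And>y. y \<in> closure C \<Longrightarrow> norm (A *v homog y) \<le> R" using norm_homog_bounded by blast
  have le: "norm (f n) \<le> (B *v f n) $ None * R" for n
  proof -
    obtain t y where x: "f n = t *\<^sub>R (A *v homog y)" "t > 0" "y \<in> C" using f(1)[of n] by (auto simp: cone_over_def)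
    then show ?thesis using R[of y] closure_subset[of C] by (auto simp: matrix_vector_mult_scaleR)
  qed
  have "norm p \<le> (B *v p) $ None * R"
    by (rule LIMSEQ_le[OF tendsto_norm[OF f(2)] tendsto_mult_right[OF nl]]) (use le in auto)
  moreover have "(B *v p) $ None \<ge> 0"
    by (rule LIMSEQ_le_const[OF nl]) (use f(1) cone_pos in \<open>auto intro: less_imp_le\<close>)
  ultimately have pos: "(B *v p) $ None > 0" using assms(2) by (cases "(B *v p) $ None = 0") auto
  have "(\<lambda>n. dehom (B *v f n)) \<longlonglongrightarrow> dehom (B *v p)"
    unfolding dehom_def using pos
    by (intro vec_tendstoI) (auto intro!: tendsto_divide tendsto_vec_nth Bf)
  moreover have "\<And>n. dehom (B *v f n) \<in> C" using f(1) by (simp add: mem_cone)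
  ultimately have "dehom (B *v p) \<in> closure C"
    unfolding closure_sequential by (intro exI[of _ "\<lambda>n. dehom (B *v f n)"] conjI allI)
  moreover have "p = (B *v p) $ None *\<^sub>R (A *v homog (dehom (B *v p)))"
    using pos homog_dehom[of "B *v p"] by (simp flip: matrix_vector_mult_scaleR)
  ultimately show ?thesis using pos by blast
qed

text \<open>\<open>p + q\<close> lies over a point strictly between the projections \<open>a\<close>
  and \<open>b\<close>. If these differ, their open segment is not contained in the frontier, so it
  meets the interior and then lies in \<open>C\<close> entirely.\<close>

lemma cone_strict:
  assumes seg: "\<not> (\<exists>a b. a \<noteq> b \<and> open_segment a b \<subseteq> frontier C)"
    and p: "p \<in> closure (cone_over A C)" "p \<noteq> 0" and q: "q \<in> closure (cone_over A C)" "q \<noteq> 0"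
    and pq: "p + q \<notin> cone_over A C"
  shows "\<exists>c>0. q = c *\<^sub>R p"
proof -
  obtain s a where a: "s > 0" "a \<in> closure C" "p = s *\<^sub>R (A *v homog a)" using closure_cone[OF p] by auto
  obtain t b where b: "t > 0" "b \<in> closure C" "q = t *\<^sub>R (A *v homog b)" using closure_cone[OF q] by auto
  show ?thesis
  proof (cases "a = b")
    case True
    then have "q = (t / s) *\<^sub>R p" using a b by simp
    then show ?thesis using a b by (intro exI[of _ "t / s"]) auto
  next
    case False
    have cc: "convex (closure C)" using C(2) by (rule convex_closure)
    have "open_segment a b \<subseteq> closure C"
      using cc a(2) b(2) by (metis closed_segment_subset open_closed_segment subset_iff)
    moreover have "\<not> open_segment a b \<subseteq> frontier C" using seg False by blast
    ultimately obtain d where d: "d \<in> open_segment a b" "d \<in> interior C"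
      unfolding frontier_def by blast
    let ?u = "s / (s + t)" and ?v = "t / (s + t)"
    have uv: "?u + ?v = 1" using a b by (simp add: add_divide_distrib[symmetric])
    let ?e = "?u *\<^sub>R a + ?v *\<^sub>R b"
    have "p + q = (s + t) *\<^sub>R (A *v homog ?e)"
      unfolding homog_convex[OF uv] using a b by (simp add: mv_simps scaleR_add_right)
    moreover have "?e \<in> C"
    proof -
      have v: "0 < ?v" "?v < 1" "?u = 1 - ?v" using a(1) b(1) uv by (auto simp: field_simps)
      show ?thesis unfolding v(3) by (rule open_segment_in_convex[OF C(1,2) a(2) b(2) _ _ v(1,2)]) (use d C(1) in \<open>simp_all add: interior_open\<close>)
    qed
    ultimately have "p + q \<in> cone_over A C" using coneI[of "s + t" ?e] a(1) b(1) by simp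
    then show ?thesis using pq by blast
  qed
qed

end

section \<open>Projective space in homogeneous coordinates\<close>

lemma rp_class_eq_iff:
  assumes "x \<noteq> 0" "y \<noteq> 0"
  shows "rp_class x = rp_class y \<longleftrightarrow> (\<exists>c. c \<noteq> 0 \<and> x = c *\<^sub>R y)"
proof
  assume "rp_class x = rp_class y"
  then have "span {x} = span {y}" using assms line_of_rp_class by metis
  then have "x \<in> span {y}" by (metis span_base singletonI)
  then obtain c where "x = c *\<^sub>R y" by (auto simp: span_singleton)
  then show "\<exists>c. c \<noteq> 0 \<and> x = c *\<^sub>R y" using assms by auto
next
  assume "\<exists>c. c \<noteq> 0 \<and> x = c *\<^sub>R y"
  then obtain c where c: "c \<noteq> 0" "x = c *\<^sub>R y" by auto
  have "span {x} = span {y}"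
  proof (rule span_eq[THEN iffD2], intro conjI)
    show "{x} \<subseteq> span {y}" using c by (auto intro: span_scale span_base)
    have "y = (1/c) *\<^sub>R x" using c by simp
    then show "{y} \<subseteq> span {x}" by (auto intro: span_scale span_base)
  qed
  then show "rp_class x = rp_class y" by (simp add: rp_class_def)
qed

lemma ex_rp_class: "\<exists>x. x \<noteq> 0 \<and> p = rp_class x"
proof -
  obtain x where "x \<noteq> 0" "line_of p = span {x}" using line_of[of p] by auto
  then show ?thesis unfolding rp_class_def by (metis line_of_inverse)
qed

lemma rp_class_scaleR: "c \<noteq> 0 \<Longrightarrow> x \<noteq> 0 \<Longrightarrow> rp_class (c *\<^sub>R x) = rp_class x"
  by (subst rp_class_eq_iff) auto

text \<open>Convexity is given through projective lines. If a point \<open>c\<close> between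
  \<open>a\<close> and \<open>b\<close> were missing, then \<open>c\<close> and the point at
  infinity would cut the line into two arcs, both met by the domain, against connectedness.\<close>

lemma convex_patch:
  fixes \<Omega> :: "'n::finite rp set"
  assumes conv: "proj_convex \<Omega>" and A: "invertible A" "\<Omega> \<subseteq> range (patch A)"
  shows "convex (patch A -` \<Omega>)"
proof -
  obtain B where AB: "A ** B = mat 1" "B ** A = mat 1" using A(1) unfolding invertible_def by auto
  have BA [simp]: "B *v (A *v x) = x" for x by (simp add: matrix_vector_mul_assoc AB)
  have hnz: "homog y \<noteq> 0" for y :: "real^'n"
  proof
    assume "homog y = 0"
    then have "homog y $ None = 0" by simp
    then show False by simp
  qed
  have nz: "A *v homog y \<noteq> 0" for y
  proof
    assume "A *v homog y = 0"
    then have "B *v (A *v homog y) = 0" by simp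
    then show False using hnz by simp
  qed
  show ?thesis
  proof (rule convexI, rule ccontr)
    fix a b u t assume ab: "a \<in> patch A -` \<Omega>" "b \<in> patch A -` \<Omega>" and ut: "0 \<le> u" "0 \<le> t" "u + t = (1::real)"
      and n: "u *\<^sub>R a + t *\<^sub>R b \<notin> patch A -` \<Omega>"
    define c where "c = u *\<^sub>R a + t *\<^sub>R b"
    have t: "0 < t" "t < 1" "a \<noteq> b"
    proof -
      show "t > 0" using n ab ut by (cases "t = 0") auto
      show "t < 1" using n ab ut by (cases "t = 1") auto
      show "a \<noteq> b"
      proof
        assume "a = b"
        then have "u *\<^sub>R a + t *\<^sub>R b = a" using ut(3) by (metis scaleR_add_left scaleR_one)
        then show False using n ab(1) by simp
      qed
    qed
    have u: "u = 1 - t" using ut by simp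
    define P where "P = span {A *v homog a, A *v homog b}"
    define L where "L = {p. line_of p \<subseteq> P}"
    have "projective_line L"
    proof -
      have "A *v homog a \<notin> span {A *v homog b}"
      proof
        assume "A *v homog a \<in> span {A *v homog b}"
        then obtain k where "A *v homog a = k *\<^sub>R (A *v homog b)" by (auto simp: span_singleton)
        then have "B *v (A *v homog a) = B *v (k *\<^sub>R (A *v homog b))" by simp
        then have h: "homog a = k *\<^sub>R homog b" by (simp add: matrix_vector_mult_scaleR)
        then have "homog a $ None = k * homog b $ None" by simp
        then have "k = 1" by simp
        then have "homog a = homog b" using h by simp
        then have "dehom (1 *\<^sub>R homog a) = dehom (1 *\<^sub>R homog b)" by simp
        then show False using t(3) by (simp only: dehom_homog one_neq_zero not_False_eq_True)
      qed
      then have "independent {A *v homog a, A *v homog b}" "A *v homog a \<noteq> A *v homog b"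
        using nz by (auto simp: independent_insert span_base)
      then have "dim P = 2" unfolding P_def by (simp add: dim_eq_card_independent del: dim_span_eq_card_independent)
      then show ?thesis unfolding projective_line_def L_def P_def by blast
    qed
    then have con: "connected (\<Omega> \<inter> L)" using conv by (simp add: proj_convex_def)
    \<comment> \<open>The sign of the product of \<open>b - a\<close> with \<open>y - c\<close>
      tells the two arcs apart. The extra factor \<open>w $ None\<close> makes \<open>\<phi>\<close>
      homogeneous of degree 2, so that its sign is well defined on projective space.\<close>
    define \<phi> where "\<phi> w = (b - a) \<bullet> ((\<chi> j. w $ Some j) - w $ None *\<^sub>R c) * w $ None" for w :: "real^('n option)"
    have \<phi>_scale: "\<phi> (k *\<^sub>R w) = k * k * \<phi> w" for k w
    proof -
      have "(\<chi> j. (k *\<^sub>R w) $ Some j) - (k *\<^sub>R w) $ None *\<^sub>R c = k *\<^sub>R ((\<chi> j. w $ Some j) - w $ None *\<^sub>R c)"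
        by (simp add: vec_eq_iff right_diff_distrib)
      then show ?thesis by (simp add: \<phi>_def)
    qed
    have \<phi>_homog: "\<phi> (homog y) = (b - a) \<bullet> (y - c)" for y
    proof -
      have "(\<chi> j. homog y $ Some j) = y" by (simp add: homog_def vec_eq_iff)
      then show ?thesis by (simp add: \<phi>_def)
    qed
    have \<phi>_cont: "continuous_on UNIV (\<lambda>x. \<phi> (B *v x))"
      unfolding \<phi>_def
      by (intro continuous_intros continuous_on_vec_lambda continuous_on_component matrix_vector_mult_linear_continuous_on)
    define U where "U \<sigma> = {rp_class x | x. x \<noteq> 0 \<and> \<sigma> * \<phi> (B *v x) > 0}" for \<sigma> :: real
    have memU: "rp_class x \<in> U \<sigma> \<longleftrightarrow> \<sigma> * \<phi> (B *v x) > 0" if xn: "x \<noteq> 0" for x \<sigma>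
    proof
      assume "rp_class x \<in> U \<sigma>"
      then obtain z where z: "z \<noteq> 0" "rp_class z = rp_class x" "\<sigma> * \<phi> (B *v z) > 0" by (auto simp: U_def)
      then obtain k where k: "k \<noteq> 0" "z = k *\<^sub>R x" using rp_class_eq_iff[OF z(1) xn] by auto
      have "\<sigma> * \<phi> (B *v z) = (k * k) * (\<sigma> * \<phi> (B *v x))" by (simp add: k(2) matrix_vector_mult_scaleR \<phi>_scale)
      moreover have "k * k > 0" using k(1) by (simp add: zero_less_mult_iff) linarith
      ultimately show "\<sigma> * \<phi> (B *v x) > 0" using z(3) by (metis zero_less_mult_pos)
    qed (use xn in \<open>auto simp: U_def\<close>)
    have opU: "open (U \<sigma>)" for \<sigma>
    proof -
      have "{x. x \<noteq> 0 \<and> rp_class x \<in> U \<sigma>} = {x. 0 < \<sigma> * \<phi> (B *v x)}"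
      proof -
        have "\<phi> (B *v 0) = 0" by (simp add: \<phi>_def)
        then have "x \<noteq> 0" if "0 < \<sigma> * \<phi> (B *v x)" for x using that by auto
        then show ?thesis using memU by blast
      qed
      also have "open \<dots>" by (intro open_Collect_less continuous_intros \<phi>_cont)
      finally show ?thesis by (simp add: open_rp_def)
    qed
    have on: "\<exists>v. p = patch A ((1 - v) *\<^sub>R a + v *\<^sub>R b) \<and> v \<noteq> t" if p: "p \<in> \<Omega> \<inter> L" for p
    proof -
      obtain y where y: "p = patch A y" using p A(2) by auto
      have "A *v homog y \<in> line_of p" unfolding y patch_def line_of_rp_class[OF nz] by (simp add: span_base)
      then have "A *v homog y \<in> P" using p by (auto simp: L_def)
      then obtain k l where "A *v homog y = k *\<^sub>R (A *v homog a) + l *\<^sub>R (A *v homog b)"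
        unfolding P_def by (auto simp: span_insert span_singleton algebra_simps)
      then have "B *v (A *v homog y) = B *v (k *\<^sub>R (A *v homog a) + l *\<^sub>R (A *v homog b))" by simp
      then have h: "homog y = k *\<^sub>R homog a + l *\<^sub>R homog b"
        by (simp add: mv_simps)
      then have "homog y $ None = k * homog a $ None + l * homog b $ None" by simp
      then have kl: "k + l = 1" by simp
      then have "homog y = homog (k *\<^sub>R a + l *\<^sub>R b)" using h homog_convex by metis
      then have "dehom (1 *\<^sub>R homog y) = dehom (1 *\<^sub>R homog (k *\<^sub>R a + l *\<^sub>R b))" by simp
      then have ye: "y = k *\<^sub>R a + l *\<^sub>R b" by (simp only: dehom_homog one_neq_zero not_False_eq_True)
      have k: "k = 1 - l" using kl by simp
      have "l \<noteq> t"
      proof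
        assume "l = t"
        then have "y = u *\<^sub>R a + t *\<^sub>R b" using ye k u by simp
        then show False using n p y by simp
      qed
      then show ?thesis using y ye k by auto
    qed
    have val: "\<phi> (B *v (A *v homog ((1 - v) *\<^sub>R a + v *\<^sub>R b))) = (v - t) * ((b - a) \<bullet> (b - a))" for v
    proof -
      have "((1 - v) *\<^sub>R a + v *\<^sub>R b) - c = (v - t) *\<^sub>R (b - a)"
        by (simp add: c_def u algebra_simps)
      then show ?thesis by (simp add: \<phi>_homog)
    qed
    have pos: "(b - a) \<bullet> (b - a) > 0" using t(3) by simp
    have cover: "\<Omega> \<inter> L \<subseteq> U 1 \<union> U (-1)"
    proof
      fix p assume "p \<in> \<Omega> \<inter> L"
      then obtain v where v: "p = patch A ((1 - v) *\<^sub>R a + v *\<^sub>R b)" "v \<noteq> t" using on by blast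
      have "(v - t) * ((b - a) \<bullet> (b - a)) > 0 \<or> (v - t) * ((b - a) \<bullet> (b - a)) < 0"
        using v(2) pos by (simp add: zero_less_mult_iff mult_less_0_iff) linarith
      then show "p \<in> U 1 \<union> U (-1)" unfolding v(1) patch_def Un_iff memU[OF nz] val by auto
    qed
    have disj: "U 1 \<inter> U (-1) \<inter> (\<Omega> \<inter> L) = {}"
    proof (rule ccontr)
      assume "U 1 \<inter> U (-1) \<inter> (\<Omega> \<inter> L) \<noteq> {}"
      then obtain p where p: "p \<in> U 1" "p \<in> U (-1)" by auto
      obtain x where x: "x \<noteq> 0" "p = rp_class x" using ex_rp_class by blast
      show False using p unfolding x(2) memU[OF x(1)] by simp
    qed
    have aL: "patch A a \<in> L" "patch A b \<in> L"
      unfolding L_def P_def patch_def by (auto simp: line_of_rp_class[OF nz] intro: subsetD[OF span_mono, rotated])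
    have "patch A a \<in> U (-1)"
      using val[of 0] t(1) pos unfolding patch_def memU[OF nz] by simp
    moreover have "patch A b \<in> U 1"
      using val[of 1] t(2) pos unfolding patch_def memU[OF nz] by simp
    moreover have "U 1 \<inter> (\<Omega> \<inter> L) = {} \<or> U (-1) \<inter> (\<Omega> \<inter> L) = {}"
      by (rule connectedD[OF con opU opU disj cover])
    ultimately show False using ab aL by blast
  qed
qed

section \<open>The group in homogeneous coordinates\<close>

definition cls :: "real^'m::finite^'m \<Rightarrow> (real^'m^'m) set"
  where "cls M = GL_scalars #>\<^bsub>GL\<^esub> M"

lemma cls_eq: "cls M = {c *\<^sub>R M | c. c \<noteq> 0}"
  by (simp add: cls_def GL_coset)

lemma cls_scaleR:
  assumes "c \<noteq> 0"
  shows "cls (c *\<^sub>R M) = cls M"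
proof -
  have "\<exists>e. d *\<^sub>R M = e *\<^sub>R (c *\<^sub>R M) \<and> e \<noteq> 0" if "d \<noteq> 0" for d
    using that assms by (intro exI[of _ "d / c"]) auto
  then show ?thesis using assms by (auto simp: cls_eq)
qed

lemma scaleR_matrix_mult: "(c *\<^sub>R M) ** (d *\<^sub>R N) = (c * d) *\<^sub>R (M ** N)" for M N :: "real^'m::finite^'m"
  by (simp add: matrix_eq matrix_vector_mul_assoc[symmetric] matrix_vector_mult_scaleR flip: scaleR_matrix_vector_assoc)

lemma cls_mult: "cls M \<otimes>\<^bsub>PGL\<^esub> cls N = cls (M ** N)"
proof -
  have "cls M \<otimes>\<^bsub>PGL\<^esub> cls N = (\<Union>h\<in>cls M. \<Union>k\<in>cls N. {h ** k})"
    by (simp add: PGL_def FactGroup_def set_mult_def GL_def)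
  also have "\<dots> = cls (M ** N)"
  proof
    show "(\<Union>h\<in>cls M. \<Union>k\<in>cls N. {h ** k}) \<subseteq> cls (M ** N)"
      by (auto simp: cls_eq scaleR_matrix_mult)
    show "cls (M ** N) \<subseteq> (\<Union>h\<in>cls M. \<Union>k\<in>cls N. {h ** k})"
    proof
      fix L assume "L \<in> cls (M ** N)"
      then obtain c where "c \<noteq> 0" "L = (c *\<^sub>R M) ** (1 *\<^sub>R N)"
        by (auto simp: cls_eq scaleR_matrix_mult simp del: scaleR_one)
      moreover have "1 *\<^sub>R N \<in> cls N" unfolding cls_eq by (rule CollectI, rule exI[of _ 1]) simp
      ultimately show "L \<in> (\<Union>h\<in>cls M. \<Union>k\<in>cls N. {h ** k})" by (auto simp: cls_eq)
    qed
  qed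
  finally show ?thesis .
qed

lemma cls_one: "cls (mat 1) = \<one>\<^bsub>PGL\<^esub>"
  by (auto simp: cls_eq PGL_def FactGroup_def GL_scalars_def)

lemma cls_pow: "cls M [^]\<^bsub>PGL\<^esub> (k::nat) = cls (matpow M k)"
proof (induction k)
  case 0 then show ?case by (simp add: cls_one)
next
  case (Suc k)
  have "matpow M k ** M = matpow M (Suc k)" using matpow_add[of M k 1] by simp
  then show ?case using Suc by (simp add: cls_mult)
qed

lemma cls_carrier: "invertible M \<Longrightarrow> cls M \<in> carrier PGL"
  by (auto simp: PGL_def FactGroup_def RCOSETS_def cls_def GL_def)

lemma ex_cls: "\<gamma> \<in> carrier PGL \<Longrightarrow> \<exists>M. invertible M \<and> \<gamma> = cls M"
  by (auto simp: PGL_def FactGroup_def RCOSETS_def cls_def GL_def)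

lemma pgl_act_cls: "invertible M \<Longrightarrow> x \<noteq> 0 \<Longrightarrow> pgl_act (cls M) (rp_class x) = rp_class (M *v x)"
  unfolding cls_def by (rule pgl_act_coset)

lemma invertible_mult_nonzero:
  fixes M :: "real^'m::finite^'m"
  assumes "invertible M" "x \<noteq> 0"
  shows "M *v x \<noteq> 0"
proof
  assume "M *v x = 0"
  obtain N where "N ** M = mat 1" using assms(1) unfolding invertible_def by auto
  then have "N *v (M *v x) = x" by (simp add: matrix_vector_mul_assoc)
  then show False using \<open>M *v x = 0\<close> assms(2) by simp
qed

lemma homog_nonzero: "homog y \<noteq> 0"
proof
  assume "homog y = 0"
  then have "homog y $ None = 0" by simp
  then show False by simp
qed

lemma patch_cone_patch:
  fixes \<Omega> :: "'n::finite rp set"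
  assumes "open \<Omega>" "\<Omega> \<noteq> {}" "proj_convex \<Omega>" "bounded_in_patch A \<Omega>" "A ** B = mat 1" "B ** A = mat 1"
  shows "patch_cone A B (patch A -` \<Omega>)"
proof
  have A: "invertible A" "\<Omega> \<subseteq> range (patch A)" using assms(4) by (auto simp: bounded_in_patch_def)
  show "open (patch A -` \<Omega>)"
  proof -
    have "patch A -` \<Omega> = (\<lambda>y. A *v homog y) -` {x. x \<noteq> 0 \<and> rp_class x \<in> \<Omega>}"
      using invertible_mult_nonzero[OF A(1) homog_nonzero] by (auto simp: patch_def)
    also have "open \<dots>"
    proof (rule open_vimage)
      show "open {x. x \<noteq> 0 \<and> rp_class x \<in> \<Omega>}" using assms(1) by (simp add: open_rp_def)
      show "continuous_on UNIV (\<lambda>y. A *v homog y)"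
        by (rule continuous_on_compose2[OF matrix_vector_mult_linear_continuous_on[of UNIV] homog_continuous]) simp
    qed
    finally show ?thesis .
  qed
  show "convex (patch A -` \<Omega>)" by (rule convex_patch[OF assms(3) A])
  show "bounded (patch A -` \<Omega>)" using assms(4) by (simp add: bounded_in_patch_def)
  show "patch A -` \<Omega> \<noteq> {}" using A(2) assms(2) by auto
qed (use assms in auto)

context patch_cone
begin

lemma rp_class_mem:
  assumes "C = patch A -` \<Omega>" "\<Omega> \<subseteq> range (patch A)" "x \<noteq> 0"
  shows "rp_class x \<in> \<Omega> \<longleftrightarrow> x \<in> cone_over A C \<or> - x \<in> cone_over A C"
proof
  have inv: "invertible A" using AB unfolding invertible_def by auto
  note nz = invertible_mult_nonzero[OF inv homog_nonzero]
  {
    assume "rp_class x \<in> \<Omega>"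
    then obtain y where y: "rp_class x = patch A y" "y \<in> C" using assms(1,2) by auto
    then obtain c where c: "c \<noteq> 0" "x = c *\<^sub>R (A *v homog y)"
      using rp_class_eq_iff[OF assms(3) nz[of y]] by (auto simp: patch_def)
    show "x \<in> cone_over A C \<or> - x \<in> cone_over A C"
    proof (cases "c > 0")
      case True then show ?thesis using coneI c y by auto
    next
      case False
      then have "(- c) *\<^sub>R (A *v homog y) \<in> cone_over A C" using c y by (intro coneI) auto
      then show ?thesis using c by simp
    qed
  }
  have in\<Omega>: "rp_class z \<in> \<Omega>" if z: "z \<in> cone_over A C" for z
  proof -
    obtain t y where "z = t *\<^sub>R (A *v homog y)" "t > 0" "y \<in> C" using z by (auto simp: cone_over_def)
    then show ?thesis using assms(1) nz[of y] by (simp add: rp_class_scaleR patch_def)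
  qed
  assume "x \<in> cone_over A C \<or> - x \<in> cone_over A C"
  then show "rp_class x \<in> \<Omega>"
    using in\<Omega>[of x] in\<Omega>[of "- x"] rp_class_scaleR[of "-1" x] assms(3) by auto
qed

lemma cone_minus: "x \<in> cone_over A C \<Longrightarrow> - x \<notin> cone_over A C"
proof
  assume "x \<in> cone_over A C" "- x \<in> cone_over A C"
  then have "(B *v x) $ None > 0" "(B *v (- x)) $ None > 0" by (auto simp: mem_cone)
  moreover have "B *v (- x) = - (B *v x)" using matrix_vector_mult_scaleR[of B "-1" x] by simp
  ultimately show False by simp
qed

lemma cone_nonzero: "x \<in> cone_over A C \<Longrightarrow> x \<noteq> 0"
  by (auto simp: mem_cone)

lemma connected_cone: "connected (cone_over A C)"
proof (rule convex_connected, rule convexI)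
  fix x y :: "real^('n option)" and u v :: real
  assume uv: "x \<in> cone_over A C" "y \<in> cone_over A C" "0 \<le> u" "0 \<le> v" "u + v = 1"
  consider "u = 0" "v = 1" | "v = 0" "u = 1" | "u > 0" "v > 0" using uv by linarith
  then show "u *\<^sub>R x + v *\<^sub>R y \<in> cone_over A C"
    by cases (use uv in \<open>auto intro: cone_add cone_scale\<close>)
qed

end

section \<open>The group of a closed manifold acting on its cone\<close>

locale closed_projective_manifold =
  fixes \<Omega> :: "'n::finite rp set" and \<Gamma> :: "(real^('n option)^('n option)) set set"
    and A B :: "real^('n option)^('n option)"
  assumes AB: "A ** B = mat 1" "B ** A = mat 1"
    and manifold: "closed_strictly_convex_projective_manifold \<Omega> \<Gamma>"
    and patch: "bounded_in_patch A \<Omega>"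
    and dim_ge_2: "CARD('n) \<ge> 2"
begin

abbreviation "C \<equiv> patch A -` \<Omega>"
abbreviation "K \<equiv> cone_over A C"

text \<open>The determinant fixes a matrix in its class up to sign, and preserving \<open>K\<close>
  rather than its negative fixes the sign. With determinant 1 in place of absolute value 1, some
  classes could lack a representative.\<close>

definition "G = {M. \<bar>det M\<bar> = 1 \<and> cls M \<in> \<Gamma> \<and> (\<forall>x\<in>K. M *v x \<in> K)}"

lemma \<Omega>: "open \<Omega>" "\<Omega> \<noteq> {}" "proj_convex \<Omega>" "properly_strictly_convex \<Omega>"
    "\<And>\<gamma>. \<gamma> \<in> \<Gamma> \<Longrightarrow> pgl_act \<gamma> ` \<Omega> = \<Omega>" "torsion_free \<Gamma>" "discrete_subgroup \<Gamma>" "subgroup \<Gamma> PGL"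
    "compact_space (quotient_manifold \<Omega> \<Gamma>)" "\<Omega> \<subseteq> range (patch A)"
  using manifold patch
  by (auto simp: closed_strictly_convex_projective_manifold_def strictly_convex_projective_manifold_def
      properly_strictly_convex_def discrete_subgroup_def bounded_in_patch_def)

sublocale patch_cone A B C
  by (rule patch_cone_patch[OF \<Omega>(1,2,3) patch AB])

lemmas mem_\<Omega> = rp_class_mem[OF refl \<Omega>(10)]

lemma rp_in_\<Omega>: "x \<in> K \<Longrightarrow> rp_class x \<in> \<Omega>"
  using mem_\<Omega> cone_nonzero by blast

text \<open>Strict convexity is witnessed in some patch \<open>A'\<close>, not necessarily in
  \<open>A\<close>. The two cones consist of the same lines, so they coincide up to a global sign,
  to which \<open>strict\<close> is insensitive.\<close>

lemma cone_strict_K: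
  assumes p: "p \<in> closure K" "p \<noteq> 0" and q: "q \<in> closure K" "q \<noteq> 0" and pq: "p + q \<notin> K"
  shows "\<exists>c>0. q = c *\<^sub>R p"
proof -
  obtain A' where A': "bounded_in_patch A' \<Omega>"
      "\<not> (\<exists>a b. a \<noteq> b \<and> open_segment a b \<subseteq> frontier (patch A' -` \<Omega>))"
    using \<Omega>(4) by (auto simp: properly_strictly_convex_def)
  then obtain B' where B': "A' ** B' = mat 1" "B' ** A' = mat 1"
    by (auto simp: bounded_in_patch_def invertible_def)
  interpret P: patch_cone A' B' "patch A' -` \<Omega>"
    by (rule patch_cone_patch[OF \<Omega>(1,2,3) A'(1) B'])
  have r': "\<Omega> \<subseteq> range (patch A')" using A'(1) by (simp add: bounded_in_patch_def)
  let ?K' = "cone_over A' (patch A' -` \<Omega>)"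
  have same: "x \<in> K \<or> - x \<in> K \<longleftrightarrow> x \<in> ?K' \<or> - x \<in> ?K'" if "x \<noteq> 0" for x
    using mem_\<Omega>[OF that] P.rp_class_mem[OF refl r' that] by blast
  have "K \<subseteq> ?K' \<or> (\<forall>x\<in>K. - x \<in> ?K')"
  proof (rule connected_symmetric_dichotomy[OF connected_cone P.open_cone P.cone_minus])
    show "x \<in> ?K' \<or> - x \<in> ?K'" if "x \<in> K" for x using same[of x] cone_nonzero[OF that] that by blast
  qed
  then show ?thesis
  proof
    assume sub: "K \<subseteq> ?K'"
    have "K = ?K'"
    proof
      show "?K' \<subseteq> K"
      proof
        fix x assume x: "x \<in> ?K'"
        then have "x \<in> K \<or> - x \<in> K" using same P.cone_nonzero by blast
        then show "x \<in> K" using sub P.cone_minus[OF x] by blast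
      qed
    qed (rule sub)
    then show ?thesis using P.cone_strict[OF A'(2)] p q pq by simp
  next
    assume sub: "\<forall>x\<in>K. - x \<in> ?K'"
    have iff: "x \<in> K \<longleftrightarrow> - x \<in> ?K'" for x
    proof
      assume x: "- x \<in> ?K'"
      then have "x \<in> K \<or> - x \<in> K" using same[of "- x"] P.cone_nonzero[OF x] by auto
      moreover have "- x \<notin> K"
      proof
        assume "- x \<in> K"
        then have "- (- x) \<in> ?K'" using sub by blast
        then show False using P.cone_minus[OF x] by simp
      qed
      ultimately show "x \<in> K" by blast
    qed (use sub in auto)
    have cl: "- z \<in> closure ?K'" if z: "z \<in> closure K" for z
    proof -
      obtain f where f: "\<And>n. f n \<in> K" "f \<longlonglongrightarrow> z" using z by (auto simp: closure_sequential)
      have "(\<lambda>n. - f n) \<longlonglongrightarrow> - z" by (intro tendsto_intros f)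
      moreover have "\<forall>n. - f n \<in> ?K'" using f(1) iff by blast
      ultimately show ?thesis unfolding closure_sequential by (intro exI[of _ "\<lambda>n. - f n"] conjI)
    qed
    have "- p + - q \<notin> ?K'" using pq iff[of "p + q"] by (simp add: add.commute)
    then obtain c where c: "c > 0" "- q = c *\<^sub>R (- p)"
      using P.cone_strict[OF A'(2) cl[OF p(1)] _ cl[OF q(1)]] p q by auto
    then have "q = c *\<^sub>R p" by (metis neg_equal_iff_equal scaleR_minus_right)
    then show ?thesis using c(1) by blast
  qed
qed

sublocale strictly_convex_cone K
  using open_cone cone_nonempty cone_add cone_scale cone_proper cone_strict_K
  by unfold_locales auto

lemma invertible_det_1: "\<bar>det M\<bar> = 1 \<Longrightarrow> invertible (M :: real^'k::finite^'k)"
  by (auto simp: invertible_det_nz)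

lemma act_mem:
  assumes M: "invertible M" "cls M \<in> \<Gamma>" and x: "x \<in> K"
  shows "M *v x \<in> K \<or> - (M *v x) \<in> K"
proof -
  have nz: "x \<noteq> 0" by (rule cone_nonzero[OF x])
  have "pgl_act (cls M) (rp_class x) \<in> \<Omega>" using \<Omega>(5)[OF M(2)] rp_in_\<Omega>[OF x] by blast
  then have "rp_class (M *v x) \<in> \<Omega>" by (simp add: pgl_act_cls[OF M(1) nz])
  then show ?thesis using mem_\<Omega>[OF invertible_mult_nonzero[OF M(1) nz]] by blast
qed

text \<open>A representative scaled to determinant of absolute value 1 maps the connected set
  \<open>K\<close> into \<open>K\<close> or into its negative; in the second case its negative is
  taken.\<close>

lemma ex_G:
  assumes "\<gamma> \<in> \<Gamma>"
  shows "\<exists>M\<in>G. \<gamma> = cls M"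
proof -
  obtain M0 where M0: "invertible M0" "\<gamma> = cls M0"
    using ex_cls subgroup.mem_carrier[OF \<Omega>(8) assms] by blast
  let ?m = "CARD('n option)"
  have d0: "\<bar>det M0\<bar> > 0" using M0(1) by (simp add: invertible_det_nz)
  define c where "c = root ?m (1 / \<bar>det M0\<bar>)"
  have c: "c > 0" unfolding c_def using d0 by simp
  have cm: "c ^ ?m = 1 / \<bar>det M0\<bar>" unfolding c_def by (rule real_root_pow_pos2) (use d0 in simp_all)
  define M where "M = c *\<^sub>R M0"
  have detM: "\<bar>det M\<bar> = 1" using c cm d0 unfolding M_def det_scaleR abs_mult power_abs by simp
  have clsM: "cls M = \<gamma>" using M0 c by (simp add: M_def cls_scaleR)
  have invM: "invertible M" by (rule invertible_det_1[OF detM])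
  have "(*v) M ` K \<subseteq> K \<or> (\<forall>x\<in>(*v) M ` K. - x \<in> K)"
  proof (rule connected_symmetric_dichotomy[OF _ open_cone cone_minus])
    show "connected ((*v) M ` K)"
      by (intro connected_continuous_image connected_cone matrix_vector_mult_linear_continuous_on)
    show "x \<in> K \<or> - x \<in> K" if "x \<in> (*v) M ` K" for x
      using that act_mem[OF invM] clsM assms by auto
  qed
  then show ?thesis
  proof
    assume "(*v) M ` K \<subseteq> K"
    then have "M \<in> G" using detM clsM assms by (auto simp: G_def)
    then show ?thesis using clsM by blast
  next
    assume n: "\<forall>x\<in>(*v) M ` K. - x \<in> K"
    have cM: "cls ((-1) *\<^sub>R M) = \<gamma>" using clsM cls_scaleR[of "-1" M] by simp
    have "\<bar>det ((-1) *\<^sub>R M)\<bar> = 1" unfolding det_scaleR using detM by (simp add: abs_mult power_abs)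
    moreover have "((-1) *\<^sub>R M) *v x \<in> K" if "x \<in> K" for x
    proof -
      have "((-1) *\<^sub>R M) *v x = - (M *v x)" by (subst scaleR_matrix_vector_assoc[symmetric]) simp
      then show ?thesis using n that by simp
    qed
    ultimately have "(-1) *\<^sub>R M \<in> G" using cM assms by (simp add: G_def)
    then show ?thesis using cM by blast
  qed
qed

text \<open>A scalar matrix with determinant of absolute value 1 is the identity or its negative,
  and the latter does not preserve \<open>K\<close>.\<close>

lemma cls_one_G:
  assumes "M \<in> G" "cls M = \<one>\<^bsub>PGL\<^esub>"
  shows "M = mat 1"
proof -
  have "M \<in> cls M" unfolding cls_eq by (rule CollectI, rule exI[of _ 1]) simp
  then have "M \<in> cls (mat 1)" by (simp only: assms(2) cls_one)
  then obtain c where c: "c \<noteq> 0" "M = c *\<^sub>R mat 1" by (auto simp: cls_eq)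
  have "\<bar>det M\<bar> = 1" using assms(1) by (simp add: G_def)
  then have "\<bar>c ^ CARD('n option)\<bar> = 1" by (simp only: c(2) det_scaleR det_I mult_1_right)
  then have "\<bar>c\<bar> ^ CARD('n option) = 1 ^ CARD('n option)" by (simp only: power_abs power_one)
  then have "\<bar>c\<bar> = 1" by (rule power_eq_imp_eq_base) simp_all
  moreover have "c \<noteq> -1"
  proof
    assume "c = -1"
    obtain x where x: "x \<in> K" using cone_nonempty by auto
    then have "M *v x \<in> K" using assms(1) by (auto simp: G_def)
    moreover have "M *v x = - x"
      unfolding c(2) \<open>c = -1\<close> by (subst scaleR_matrix_vector_assoc[symmetric]) simp
    ultimately show False using cone_minus[OF x] by simp
  qed
  ultimately have "c = 1" by linarith
  then show ?thesis using c(2) by simp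
qed

lemma G_one: "mat 1 \<in> G"
  using subgroup.one_closed[OF \<Omega>(8)] by (simp add: G_def cls_one)

lemma G_mult: "M \<in> G \<Longrightarrow> N \<in> G \<Longrightarrow> M ** N \<in> G"
  using subgroup.m_closed[OF \<Omega>(8), of "cls M" "cls N"]
  by (auto simp: G_def cls_mult det_mul abs_mult matrix_vector_mul_assoc[symmetric])

lemma G_inv:
  assumes M: "M \<in> G"
  shows "\<exists>N\<in>G. M ** N = mat 1 \<and> N ** M = mat 1"
proof -
  have "invertible M" using M by (intro invertible_det_1) (simp add: G_def)
  then obtain N where N: "M ** N = mat 1" "N ** M = mat 1" by (auto simp: invertible_def)
  then have invN: "invertible N" by (auto simp: invertible_def)
  have "det M * det N = 1" using N(1) by (metis det_mul det_I)
  then have "\<bar>det M\<bar> * \<bar>det N\<bar> = 1" by (metis abs_mult abs_one)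
  then have dN: "\<bar>det N\<bar> = 1" using M by (simp add: G_def)
  have "inv\<^bsub>PGL\<^esub> (cls M) = cls N"
    using \<open>invertible M\<close> invN
    by (intro group.inv_equality group_PGL cls_carrier) (simp_all add: cls_mult N cls_one)
  then have cN: "cls N \<in> \<Gamma>" using subgroup.m_inv_closed[OF \<Omega>(8), of "cls M"] M by (simp add: G_def)
  have "N *v x \<in> K" if x: "x \<in> K" for x
  proof -
    \<comment> \<open>\<open>N\<close> preserves \<open>K\<close> up to sign, and a minus sign would
      make \<open>M\<close> send a point of \<open>K\<close> to \<open>- x\<close>.\<close>
    have "\<not> - (N *v x) \<in> K"
    proof
      assume "- (N *v x) \<in> K"
      then have "M *v (- (N *v x)) \<in> K" using M by (auto simp: G_def)
      moreover have "M *v (- (N *v x)) = - x"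
        using matrix_vector_mult_scaleR[of M "-1" "N *v x"] by (simp add: matrix_vector_mul_assoc N)
      ultimately show False using cone_minus[OF x] by simp
    qed
    then show ?thesis using act_mem[OF invN cN x] by blast
  qed
  then show ?thesis using dN cN N by (intro bexI[of _ N]) (auto simp: G_def)
qed

lemma G_discrete: "\<exists>e>0. \<forall>M\<in>G. norm (M - mat 1) < e \<longrightarrow> M = mat 1"
proof -
  have one: "\<one>\<^bsub>PGL\<^esub> \<in> \<Gamma>" by (rule subgroup.one_closed[OF \<Omega>(8)])
  have "openin (subtopology PGL_topology \<Gamma>) {\<one>\<^bsub>PGL\<^esub>}"
    using \<Omega>(7) one by (simp add: discrete_subgroup_def)
  then obtain U where U: "openin PGL_topology U" "{\<one>\<^bsub>PGL\<^esub>} = U \<inter> \<Gamma>" by (auto simp: openin_subtopology)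
  have "openin (top_of_set (carrier GL)) {M \<in> topspace (top_of_set (carrier GL)). cls M \<in> U}"
    using U(1) unfolding PGL_topology_def openin_quotient_topology cls_def by blast
  then obtain T where T: "open T" "{M \<in> carrier GL. cls M \<in> U} = carrier GL \<inter> T"
    by (auto simp: openin_open)
  have "mat 1 \<in> {M \<in> carrier GL. cls M \<in> U}"
    using U(2) by (auto simp: GL_def cls_one invertible_def)
  then have "mat 1 \<in> T" using T(2) by blast
  then obtain e where e: "e > 0" "ball (mat 1) e \<subseteq> T" using T(1) by (meson openE)
  have "M = mat 1" if M: "M \<in> G" "norm (M - mat 1) < e" for M
  proof (rule cls_one_G[OF M(1)])
    have "M \<in> T" using e(2) M(2) by (auto simp: dist_norm norm_minus_commute)
    moreover have "M \<in> carrier GL" using M(1) invertible_det_1 by (auto simp: GL_def G_def)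
    ultimately have "cls M \<in> U" using T(2) by blast
    then show "cls M = \<one>\<^bsub>PGL\<^esub>" using U(2) M(1) by (auto simp: G_def)
  qed
  then show ?thesis using e(1) by blast
qed

lemma G_torsion_free:
  assumes "M \<in> G" "k > 0" "matpow M k = mat 1"
  shows "M = mat 1"
proof (rule cls_one_G[OF assms(1)])
  have "cls M [^]\<^bsub>PGL\<^esub> k = \<one>\<^bsub>PGL\<^esub>" by (simp add: cls_pow assms(3) cls_one)
  then show "cls M = \<one>\<^bsub>PGL\<^esub>" using \<Omega>(6) assms(1,2) by (auto simp: torsion_free_def G_def)
qed

lemma orbit_eq_iff:
  assumes x: "x \<noteq> 0" and z: "z \<noteq> 0"
  shows "orbit \<Gamma> (rp_class x) = orbit \<Gamma> (rp_class z) \<longleftrightarrow> (\<exists>M\<in>G. \<exists>c. c \<noteq> 0 \<and> z = c *\<^sub>R (M *v x))"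
proof -
  have inv: "invertible M" if "M \<in> G" for M using that by (intro invertible_det_1) (simp add: G_def)
  have orb: "orbit \<Gamma> (rp_class y) = {rp_class (M *v y) | M. M \<in> G}" if y: "y \<noteq> 0" for y
  proof -
    have "\<Gamma> = cls ` G" using ex_G by (auto simp: G_def)
    from arg_cong[OF this, of "\<lambda>S. (\<lambda>\<gamma>. pgl_act \<gamma> (rp_class y)) ` S"]
    have "orbit \<Gamma> (rp_class y) = (\<lambda>M. pgl_act (cls M) (rp_class y)) ` G"
      unfolding orbit_def image_image .
    also have "\<dots> = {rp_class (M *v y) | M. M \<in> G}"
      using pgl_act_cls[OF inv y] by (auto simp: image_iff Bex_def)
    finally show ?thesis .
  qed
  show ?thesis
  proof
    assume eq: "orbit \<Gamma> (rp_class x) = orbit \<Gamma> (rp_class z)"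
    have "rp_class z \<in> orbit \<Gamma> (rp_class z)"
      unfolding orb[OF z] using G_one by (intro CollectI exI[of _ "mat 1"]) simp
    then obtain M where M: "M \<in> G" "rp_class z = rp_class (M *v x)" using eq orb[OF x] by auto
    then show "\<exists>M\<in>G. \<exists>c. c \<noteq> 0 \<and> z = c *\<^sub>R (M *v x)"
      using rp_class_eq_iff[OF z invertible_mult_nonzero[OF inv[OF M(1)] x]] by blast
  next
    assume "\<exists>M\<in>G. \<exists>c. c \<noteq> 0 \<and> z = c *\<^sub>R (M *v x)"
    then obtain M c where M: "M \<in> G" "c \<noteq> 0" "z = c *\<^sub>R (M *v x)" by auto
    obtain N where N: "N \<in> G" "M ** N = mat 1" "N ** M = mat 1" using G_inv[OF M(1)] by auto
    have 1: "rp_class (L *v z) = rp_class (L ** M *v x)" if "L \<in> G" for L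
      using rp_class_scaleR[OF M(2) invertible_mult_nonzero[OF inv[OF G_mult[OF that M(1)]] x]]
      by (simp add: M(3) matrix_vector_mult_scaleR matrix_vector_mul_assoc)
    have 2: "rp_class (L *v x) = rp_class (L ** N *v z)" if "L \<in> G" for L
      using 1[OF G_mult[OF that N(1)]] by (simp add: N flip: matrix_mul_assoc)
    show "orbit \<Gamma> (rp_class x) = orbit \<Gamma> (rp_class z)"
      unfolding orb[OF x] orb[OF z] using 1 2 G_mult M(1) N(1) by blast
  qed
qed

text \<open>Balls inside \<open>K\<close> project to open sets that cover the quotient; finitely
  many suffice, and the corresponding closed balls form the compact set.\<close>

lemma G_cocompact: "\<exists>D. compact D \<and> D \<subseteq> K \<and> (\<forall>x\<in>K. \<exists>N\<in>G. \<exists>t>0. t *\<^sub>R (N *v x) \<in> D)"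
proof -
  have "\<forall>x\<in>K. \<exists>r>0. cball x r \<subseteq> K" using open_cone by (meson open_contains_cball)
  then obtain r where r: "\<And>x. x \<in> K \<Longrightarrow> r x > 0" "\<And>x. x \<in> K \<Longrightarrow> cball x (r x) \<subseteq> K" by metis
  define V where "V x = (\<lambda>z. orbit \<Gamma> (rp_class z)) ` ball x (r x)" for x
  have bK: "z \<in> K" if "x \<in> K" "z \<in> ball x (r x)" for x z using r(2)[OF that(1)] that(2) by auto
  have opV: "openin (quotient_manifold \<Omega> \<Gamma>) (V x)" if x: "x \<in> K" for x
    unfolding quotient_manifold_def openin_quotient_topology
  proof
    show "V x \<subseteq> orbit \<Gamma> ` topspace (top_of_set \<Omega>)" using bK[OF x] rp_in_\<Omega> by (auto simp: V_def)
    let ?S = "{p \<in> \<Omega>. orbit \<Gamma> p \<in> V x}"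
    \<comment> \<open>Openness in projective space is tested on nonzero vectors; those over the
      preimage are the vectors that some element of \<open>G\<close> and some nonzero scalar bring
      into the ball.\<close>
    have "{v. v \<noteq> 0 \<and> rp_class v \<in> ?S} = (\<Union>M\<in>G. \<Union>c\<in>-{0}. (\<lambda>v. c *\<^sub>R (M *v v)) -` ball x (r x))"
    proof (intro equalityI subsetI)
      fix v assume "v \<in> {v. v \<noteq> 0 \<and> rp_class v \<in> ?S}"
      then obtain z where v: "v \<noteq> 0" "z \<in> ball x (r x)" "orbit \<Gamma> (rp_class v) = orbit \<Gamma> (rp_class z)"
        by (auto simp: V_def)
      then obtain M c where "M \<in> G" "c \<noteq> 0" "z = c *\<^sub>R (M *v v)"
        using orbit_eq_iff[OF v(1), of z] cone_nonzero[OF bK[OF x v(2)]] by auto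
      then show "v \<in> (\<Union>M\<in>G. \<Union>c\<in>-{0}. (\<lambda>v. c *\<^sub>R (M *v v)) -` ball x (r x))" using v(2) by auto
    next
      fix v assume "v \<in> (\<Union>M\<in>G. \<Union>c\<in>-{0}. (\<lambda>v. c *\<^sub>R (M *v v)) -` ball x (r x))"
      then obtain M c where M: "M \<in> G" "c \<noteq> 0" "c *\<^sub>R (M *v v) \<in> ball x (r x)" by auto
      have zK: "c *\<^sub>R (M *v v) \<in> K" by (rule bK[OF x M(3)])
      have v0: "v \<noteq> 0" using cone_nonzero[OF zK] by auto
      have orb: "orbit \<Gamma> (rp_class v) = orbit \<Gamma> (rp_class (c *\<^sub>R (M *v v)))"
        using orbit_eq_iff[OF v0 cone_nonzero[OF zK]] M by blast
      obtain N where N: "N \<in> G" "N ** M = mat 1" using G_inv[OF M(1)] by auto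
      have "N *v (c *\<^sub>R (M *v v)) \<in> K" using N(1) zK by (auto simp: G_def)
      then have cv: "c *\<^sub>R v \<in> K" by (simp add: matrix_vector_mult_scaleR matrix_vector_mul_assoc N(2))
      have "rp_class v \<in> \<Omega>" using rp_in_\<Omega>[OF cv] rp_class_scaleR[OF M(2) v0] by simp
      then show "v \<in> {v. v \<noteq> 0 \<and> rp_class v \<in> ?S}" using v0 orb M(3) by (auto simp: V_def)
    qed
    also have "open \<dots>"
      by (intro open_UN ballI open_vimage open_ball continuous_on_scaleR continuous_on_const matrix_vector_mult_linear_continuous_on)
    finally have "open ?S" by (simp add: open_rp_def)
    moreover have "?S \<subseteq> \<Omega>" by auto
    ultimately show "openin (top_of_set \<Omega>) {p \<in> topspace (top_of_set \<Omega>). orbit \<Gamma> p \<in> V x}"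
      by (simp add: openin_open_eq \<Omega>(1))
  qed
  have top: "topspace (quotient_manifold \<Omega> \<Gamma>) \<subseteq> \<Union>(V ` K)"
  proof
    fix q assume "q \<in> topspace (quotient_manifold \<Omega> \<Gamma>)"
    then have "q \<in> orbit \<Gamma> ` \<Omega>"
      using openin_topspace[of "quotient_manifold \<Omega> \<Gamma>"]
      unfolding quotient_manifold_def openin_quotient_topology by auto
    then obtain p where p: "p \<in> \<Omega>" "q = orbit \<Gamma> p" by auto
    obtain x where x: "x \<noteq> 0" "p = rp_class x" using ex_rp_class by blast
    have inV: "orbit \<Gamma> (rp_class y) \<in> V y" if "y \<in> K" for y using r(1)[OF that] by (auto simp: V_def)
    have "x \<in> K \<or> - x \<in> K" using mem_\<Omega>[OF x(1)] p x by blast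
    moreover have "rp_class (- x) = rp_class x" using rp_class_scaleR[of "-1" x] x(1) by simp
    ultimately show "q \<in> \<Union>(V ` K)" using inV p(2) x(2) by (metis UN_I)
  qed
  have "\<forall>U\<in>V ` K. openin (quotient_manifold \<Omega> \<Gamma>) U" using opV by auto
  then have "\<exists>\<F>. finite \<F> \<and> \<F> \<subseteq> V ` K \<and> topspace (quotient_manifold \<Omega> \<Gamma>) \<subseteq> \<Union>\<F>"
    by (intro \<Omega>(9)[unfolded compact_space_alt, THEN spec, THEN mp] conjI top)
  then obtain \<F> where \<F>: "finite \<F>" "\<F> \<subseteq> V ` K" "topspace (quotient_manifold \<Omega> \<Gamma>) \<subseteq> \<Union>\<F>"
    by blast
  then obtain F where F: "F \<subseteq> K" "finite F" "\<F> = V ` F" by (meson finite_subset_image)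
  define D where "D = (\<Union>x\<in>F. cball x (r x))"
  have "compact D" unfolding D_def using F(2) by (intro compact_UN) auto
  moreover have "D \<subseteq> K" using F(1) r(2) by (auto simp: D_def)
  moreover have "\<exists>N\<in>G. \<exists>t>0. t *\<^sub>R (N *v x) \<in> D" if x: "x \<in> K" for x
  proof -
    have "orbit \<Gamma> (rp_class x) \<in> V x" using r(1)[OF x] by (auto simp: V_def)
    then have "orbit \<Gamma> (rp_class x) \<in> topspace (quotient_manifold \<Omega> \<Gamma>)"
      using opV[OF x] openin_subset by blast
    then obtain y z where y: "y \<in> F" "z \<in> ball y (r y)" "orbit \<Gamma> (rp_class x) = orbit \<Gamma> (rp_class z)"
      using \<F>(3) F(3) by (auto simp: V_def)
    have zK: "z \<in> K" using bK y F(1) by blast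
    obtain M c where M: "M \<in> G" "c \<noteq> 0" "z = c *\<^sub>R (M *v x)"
      using orbit_eq_iff[OF cone_nonzero[OF x] cone_nonzero[OF zK]] y(3) by blast
    have MxK: "M *v x \<in> K" using M(1) x by (auto simp: G_def)
    \<comment> \<open>The orbit relation yields only a nonzero scalar; a negative one would put both
      \<open>z\<close> and \<open>- z\<close> in \<open>K\<close>.\<close>
    have "c > 0"
    proof (rule ccontr)
      assume "\<not> c > 0"
      then have "(- c) *\<^sub>R (M *v x) \<in> K" using M(2) by (intro cone_scale[OF MxK]) auto
      then show False using cone_minus[OF zK] M(3) by simp
    qed
    moreover have "z \<in> D" unfolding D_def using y(2) by (intro UN_I[OF y(1)]) simp
    then have "c *\<^sub>R (M *v x) \<in> D" by (simp only: M(3))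
    ultimately show ?thesis using M(1) by blast
  qed
  ultimately show ?thesis by blast
qed

sublocale divisible_cone K G
proof
  show "CARD('n option) \<ge> 3" using dim_ge_2 by (simp add: card_option)
qed (use G_one G_mult G_inv G_discrete G_torsion_free G_cocompact in \<open>auto simp: G_def\<close>)

end

text \<open>The solution \<open>r\<close> of \<open>(1 + r) / (1 - r) = sqrt gap\<close>. Points
  over \<open>y + r W\<close>, with \<open>W = symmetral C y\<close>, lie between
  \<open>1 - r\<close> and \<open>1 + r\<close> times the point over \<open>y\<close>; two of them
  enter an identification, hence the square root.\<close>

definition radius :: "'n::finite itself \<Rightarrow> real"
  where "radius _ = (sqrt (gap TYPE('n option)) - 1) / (sqrt (gap TYPE('n option)) + 1)"

lemma radius: "0 < radius T" "radius T < 1"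
  "(1 + radius (T :: 'n::finite itself)) = sqrt (gap TYPE('n option)) * (1 - radius T)"
proof -
  let ?q = "sqrt (gap TYPE('n option))"
  have q: "?q > 1" using gap_gt_1 by simp
  show "0 < radius T" unfolding radius_def by (rule divide_pos_pos) (use q in linarith)+
  show "radius T < 1" unfolding radius_def by (subst divide_less_eq_1_pos) (use q in linarith)+
  have "1 + (s - 1) / (s + 1) = s * (1 - (s - 1) / (s + 1))" if "s > 1" for s :: real
    using that by (simp add: field_simps)
  then show "(1 + radius T) = ?q * (1 - radius T)" using q unfolding radius_def by blast
qed

context closed_projective_manifold
begin

text \<open>If \<open>M\<close> carries the point over \<open>z\<close> to a multiple of the one
  over \<open>z'\<close>, both close to the point \<open>?X\<close> over \<open>y\<close>, then
  \<open>M\<close> moves \<open>?X\<close> little, and \<open>far\<close> makes \<open>M\<close>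
  trivial.\<close>

lemma inj_orbit_near:
  assumes y: "y \<in> C"
    and far: "\<And>M. M \<in> G \<Longrightarrow> gap TYPE('n option) *\<^sub>R (A *v homog y) - M *v (A *v homog y) \<in> Kc \<Longrightarrow>
      M *v (A *v homog y) - (1 / gap TYPE('n option)) *\<^sub>R (A *v homog y) \<in> Kc \<Longrightarrow> M = mat 1"
  shows "inj_on (\<lambda>z. orbit \<Gamma> (patch A z)) ((\<lambda>v. y + radius TYPE('n) *\<^sub>R v) ` symmetral C y)"
proof (rule inj_onI)
  let ?r = "radius TYPE('n)" and ?X = "A *v homog y" and ?b = "gap TYPE('n option)"
  let ?q = "sqrt ?b"
  note r = radius[of "TYPE('n)"]
  have q: "?q > 1" "?q * ?q = ?b" using gap_gt_1[of "TYPE('n option)"] by auto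
  have XK: "?X \<in> K" using coneI[of 1] y by fastforce
  have near: "(1 + ?r) *\<^sub>R ?X - A *v homog z \<in> Kc" "A *v homog z - (1 - ?r) *\<^sub>R ?X \<in> Kc"
      "A *v homog z \<in> K"
    if z: "z \<in> (\<lambda>v. y + ?r *\<^sub>R v) ` symmetral C y" for z
  proof -
    obtain u where u: "u \<in> symmetral C y" "z = y + ?r *\<^sub>R u" using z by auto
    \<comment> \<open>\<open>z\<close> lies between \<open>y\<close> and \<open>y + u\<close>, and
      beyond \<open>y\<close> as seen from \<open>y - u\<close>. The first gives the lower and the
      second the upper comparison with \<open>?X\<close>.\<close>
    have h: "homog z = (1 - ?r) *\<^sub>R homog y + ?r *\<^sub>R homog (y + u)"
      by (simp add: u(2) homog_def vec_eq_iff algebra_simps split: option.split)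
    have h': "homog z = (1 + ?r) *\<^sub>R homog y - ?r *\<^sub>R homog (y - u)"
      by (simp add: u(2) homog_def vec_eq_iff algebra_simps split: option.split)
    have k: "?r *\<^sub>R (A *v homog (y + u)) \<in> K" "?r *\<^sub>R (A *v homog (y - u)) \<in> K"
      using u(1) r by (auto intro!: coneI simp: symmetral_def)
    have "A *v homog z - (1 - ?r) *\<^sub>R ?X = ?r *\<^sub>R (A *v homog (y + u))"
      unfolding h by (simp add: mv_simps)
    then show 1: "A *v homog z - (1 - ?r) *\<^sub>R ?X \<in> Kc" using k K_subset by simp
    have "(1 + ?r) *\<^sub>R ?X - A *v homog z = ?r *\<^sub>R (A *v homog (y - u))"
      unfolding h' by (simp add: mv_simps)
    then show "(1 + ?r) *\<^sub>R ?X - A *v homog z \<in> Kc" using k K_subset by simp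
    have "(1 - ?r) *\<^sub>R ?X + (A *v homog z - (1 - ?r) *\<^sub>R ?X) \<in> K"
      using 1 r XK by (intro KP_add scale_K) auto
    then show "A *v homog z \<in> K" by simp
  qed
  fix z z' assume z: "z \<in> (\<lambda>v. y + ?r *\<^sub>R v) ` symmetral C y" and z': "z' \<in> (\<lambda>v. y + ?r *\<^sub>R v) ` symmetral C y"
    and eq: "orbit \<Gamma> (patch A z) = orbit \<Gamma> (patch A z')"
  let ?Z = "A *v homog z" and ?Z' = "A *v homog z'"
  obtain M c where M: "M \<in> G" "c \<noteq> 0" "?Z' = c *\<^sub>R (M *v ?Z)"
    using orbit_eq_iff[OF cone_nonzero[OF near(3)[OF z]] cone_nonzero[OF near(3)[OF z']]] eq
    unfolding patch_def by blast
  have MZK: "M *v ?Z \<in> K" by (rule pres_K[OF M(1) near(3)[OF z]])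
  have c: "c > 0"
  proof (rule ccontr)
    assume "\<not> c > 0"
    then have "(- c) *\<^sub>R (M *v ?Z) \<in> K" using M(2) by (intro cone_scale[OF MZK]) auto
    then show False using cone_minus[OF near(3)[OF z']] M(3) by simp
  qed
  have MZ: "M *v ?Z = (1 / c) *\<^sub>R ?Z'" using M(3) c by simp
  have up: "(?q / c) *\<^sub>R ?X - M *v ?X \<in> Kc"
  proof -
    have 1: "M *v (?Z - (1 - ?r) *\<^sub>R ?X) \<in> Kc" by (rule pres_P[OF M(1) near(2)[OF z]])
    have 2: "(1 / c) *\<^sub>R ((1 + ?r) *\<^sub>R ?X - ?Z') \<in> Kc" by (rule P_scale[OF near(1)[OF z']]) (use c in simp)
    have "M *v (?Z - (1 - ?r) *\<^sub>R ?X) + (1 / c) *\<^sub>R ((1 + ?r) *\<^sub>R ?X - ?Z') \<in> Kc" by (rule P_add[OF 1 2])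
    also have "M *v (?Z - (1 - ?r) *\<^sub>R ?X) + (1 / c) *\<^sub>R ((1 + ?r) *\<^sub>R ?X - ?Z')
        = ((1 + ?r) / c) *\<^sub>R ?X - (1 - ?r) *\<^sub>R (M *v ?X)"
      by (simp add: mv_simps MZ scaleR_diff_right)
    finally have "(1 / (1 - ?r)) *\<^sub>R (((1 + ?r) / c) *\<^sub>R ?X - (1 - ?r) *\<^sub>R (M *v ?X)) \<in> Kc"
      by (rule P_scale) (use r in simp)
    moreover have "(1 / (1 - ?r)) * ((1 + ?r) / c) = ?q / c" unfolding r(3) using r(2) by simp
    ultimately show ?thesis using r(2) by (simp add: scaleR_diff_right)
  qed
  have low: "M *v ?X - (1 / (?q * c)) *\<^sub>R ?X \<in> Kc"
  proof -
    have 1: "M *v ((1 + ?r) *\<^sub>R ?X - ?Z) \<in> Kc" by (rule pres_P[OF M(1) near(1)[OF z]])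
    have 2: "(1 / c) *\<^sub>R (?Z' - (1 - ?r) *\<^sub>R ?X) \<in> Kc" by (rule P_scale[OF near(2)[OF z']]) (use c in simp)
    have "M *v ((1 + ?r) *\<^sub>R ?X - ?Z) + (1 / c) *\<^sub>R (?Z' - (1 - ?r) *\<^sub>R ?X) \<in> Kc" by (rule P_add[OF 1 2])
    also have "M *v ((1 + ?r) *\<^sub>R ?X - ?Z) + (1 / c) *\<^sub>R (?Z' - (1 - ?r) *\<^sub>R ?X)
        = (1 + ?r) *\<^sub>R (M *v ?X) - ((1 - ?r) / c) *\<^sub>R ?X"
      by (simp add: mv_simps MZ scaleR_diff_right)
    finally have "(1 / (1 + ?r)) *\<^sub>R ((1 + ?r) *\<^sub>R (M *v ?X) - ((1 - ?r) / c) *\<^sub>R ?X) \<in> Kc"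
      by (rule P_scale) (use r in simp)
    moreover have "(1 / (1 + ?r)) * ((1 - ?r) / c) = 1 / (?q * c)" unfolding r(3) using r(2) by simp
    ultimately show ?thesis using r(1) by (simp add: scaleR_diff_right)
  qed
  \<comment> \<open>So far the displacement of \<open>?X\<close> is known up to the scalar
    \<open>c\<close>. The interval from \<open>1 / (?q * c)\<close> to \<open>?q / c\<close> must
    contain 1, which confines \<open>c\<close> to the range from \<open>1 / ?q\<close> to
    \<open>?q\<close> and the interval to the range from \<open>1 / ?b\<close> to
    \<open>?b\<close>.\<close>
  have "1 / (?q * c) \<le> 1" by (rule disp_lower_le_1[OF M(1) XK low])
  then have qc: "1 \<le> ?q * c" using q c by (simp add: field_simps)
  have "?q / c \<ge> 1" by (rule disp_upper_ge_1[OF M(1) XK up])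
  then have cq: "c \<le> ?q" using c by (simp add: field_simps)
  have "?q \<le> ?q * (?q * c)" using qc q by simp
  then have "?q / c \<le> ?b" using c q(2) by (simp add: field_simps)
  then have "(?b - ?q / c) *\<^sub>R ?X + ((?q / c) *\<^sub>R ?X - M *v ?X) \<in> Kc"
    by (intro P_add[OF P_scale[OF K_subset[OF XK]] up]) simp
  then have up': "?b *\<^sub>R ?X - M *v ?X \<in> Kc" by (simp add: scaleR_diff_left)
  have "?q * c \<le> ?b" using cq q by (metis mult_left_mono less_imp_le less_trans zero_less_one)
  then have "1 / ?b \<le> 1 / (?q * c)" using q c by (intro divide_left_mono) auto
  then have "(1 / (?q * c) - 1 / ?b) *\<^sub>R ?X + (M *v ?X - (1 / (?q * c)) *\<^sub>R ?X) \<in> Kc"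
    by (intro P_add[OF P_scale[OF K_subset[OF XK]] low]) simp
  then have low': "M *v ?X - (1 / ?b) *\<^sub>R ?X \<in> Kc" by (simp add: scaleR_diff_left)
  have "M = mat 1" by (rule far[OF M(1) up' low'])
  then have "?Z' = c *\<^sub>R ?Z" using M(3) by simp
  then have "B *v ?Z' = B *v (c *\<^sub>R ?Z)" by simp
  then have "homog z' = c *\<^sub>R homog z" by (simp add: matrix_vector_mult_scaleR)
  then have "dehom (1 *\<^sub>R homog z') = dehom (c *\<^sub>R homog z)" by simp
  then show "z = z'" using M(2) by (simp only: dehom_homog one_neq_zero not_False_eq_True)
qed

lemma hilbert_volume_ge:
  assumes g: "riemannian_metric A \<Omega> \<Gamma> g"
  shows "hilbert_volume A \<Omega> \<Gamma> g \<ge>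
    ennreal (measure lebesgue (cball (0::real^'n) (1/2)) * (radius TYPE('n) / (2 * (1 + radius TYPE('n)))) ^ CARD('n))"
proof -
  let ?b = "gap TYPE('n option)"
  obtain x where x: "x \<in> K" "\<And>M. M \<in> G \<Longrightarrow> ?b *\<^sub>R x - M *v x \<in> Kc \<Longrightarrow>
      M *v x - (1 / ?b) *\<^sub>R x \<in> Kc \<Longrightarrow> M = mat 1"
    using ex_large_displacement by blast
  obtain t y where ty: "x = t *\<^sub>R (A *v homog y)" "t > 0" "y \<in> C" using x(1) by (auto simp: cone_over_def)
  have far: "M = mat 1" if M: "M \<in> G" "?b *\<^sub>R (A *v homog y) - M *v (A *v homog y) \<in> Kc"
      "M *v (A *v homog y) - (1 / ?b) *\<^sub>R (A *v homog y) \<in> Kc" for M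
  proof (rule x(2)[OF M(1)])
    show "?b *\<^sub>R x - M *v x \<in> Kc"
      using P_scale[OF M(2), of t] ty(2) by (simp add: ty(1) matrix_vector_mult_scaleR scaleR_diff_right mult.commute)
    show "M *v x - (1 / ?b) *\<^sub>R x \<in> Kc"
      using P_scale[OF M(3), of t] ty(2) by (simp add: ty(1) matrix_vector_mult_scaleR scaleR_diff_right)
  qed
  let ?D = "(\<lambda>v. y + radius TYPE('n) *\<^sub>R v) ` symmetral C y"
  have gC: "transpose (g z) = g z" "v \<noteq> 0 \<Longrightarrow> v \<bullet> (g z *v v) > 0" if "z \<in> C" for z v
    using g that by (auto simp: riemannian_metric_def)
  note mass = hilbert_mass_ge[where g = g and r = "radius TYPE('n)", OF C(1,2,3) ty(3) radius(1) less_imp_le[OF radius(2)] gC]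
  have "?D \<in> {D \<in> sets borel. D \<subseteq> C \<and> inj_on (\<lambda>y. orbit \<Gamma> (patch A y)) D}"
    using mass(1,2) inj_orbit_near[OF ty(3) far] by auto
  then show ?thesis unfolding hilbert_volume_def by (rule SUP_upper2) (rule mass(3))
qed

end

theorem corollary1p2:
  assumes "CARD('n::finite) \<ge> 3"
  shows "\<exists>e::real. e > 0 \<and>
    (\<forall>(\<Omega> :: 'n rp set) \<Gamma>.
      closed_strictly_convex_projective_manifold \<Omega> \<Gamma> \<and> admits_hyperbolic_structure \<Omega> \<Gamma> \<longrightarrow>
      (\<forall>A g. bounded_in_patch A \<Omega> \<and> riemannian_metric A \<Omega> \<Gamma> g \<longrightarrow>
        hilbert_volume A \<Omega> \<Gamma> g \<ge> ennreal e))"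
proof -
  let ?r = "radius TYPE('n)"
  \<comment> \<open>The Euclidean volume from \<open>gram_volume_unit_ball_ge\<close> times the
    volume ratio of \<open>r W\<close> and \<open>2 (1 + r) W\<close>; both factors depend on the
    dimension alone.\<close>
  define e where "e = measure lebesgue (cball (0::real^'n) (1/2)) * (?r / (2 * (1 + ?r))) ^ CARD('n)"
  have "measure lebesgue (cball (0::real^'n) (1/2)) > 0" by (simp add: content_cball_pos)
  moreover have "?r / (2 * (1 + ?r)) > 0" using radius(1)[of "TYPE('n)"] by simp
  ultimately have "e > 0" unfolding e_def by simp
  moreover have "hilbert_volume A \<Omega> \<Gamma> g \<ge> ennreal e"
    if m: "closed_strictly_convex_projective_manifold \<Omega> \<Gamma>" "bounded_in_patch A \<Omega>" "riemannian_metric A \<Omega> \<Gamma> g"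
    for \<Omega> :: "'n rp set" and \<Gamma> A g
  proof -
    obtain B where "A ** B = mat 1" "B ** A = mat 1"
      using m(2) by (auto simp: bounded_in_patch_def invertible_def)
    then interpret closed_projective_manifold \<Omega> \<Gamma> A B
      using m(1,2) assms by unfold_locales simp_all
    show ?thesis unfolding e_def by (rule hilbert_volume_ge[OF m(3)])
  qed
  ultimately show ?thesis by blast
qed

end
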